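(* The following problem is NP-complete: given a binary matrix $M$ and an integer $k\ge0$, decide whether there exists a set of at most $k$ entries of $M$ (each may be a $0$-entry or a $1$-entry) such that flipping them yields a matrix with the simultaneous consecutive ones property.
   Context: A binary matrix has the consecutive ones property (C1P) for rows if its columns can be permuted so that in every row the $1$-entries occur consecutively; it has the C1P for columns if its rows can be permuted so that in every column the $1$-entries occur consecutively. It has the simultaneous consecutive ones property (SC1P) if it has both. Flipping an entry changes $0$ to $1$ or $1$ to $0$. *)

theory Defs
  imports
    "HOL-Computational_Algebra.Polynomial"
    "HOL-Combinatorics.Permutations"
    "Jordan_Normal_Form.Matrix"
begin

section \<open>Multi-tape Turing machines\<close>

text \<open>
  Deterministic machines with finitely many two-way infinite tapes, given by the finite sets of
  states \<open>{..<tm_states M}\<close> and of symbols \<open>{..<tm_symbols M}\<close> and by a transition function that maps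
  the current state and the scanned symbols (one per tape) to the next state and one
  write-and-move action per tape. State 0 is initial; the number \<open>tm_states M\<close>, which is not itself
  a state with outgoing transitions, is the halting state. Symbol 0 is the blank, symbols 1 and 2
  stand for the bits 0 and 1.
\<close>

datatype move = MoveLeft | MoveStay | MoveRight

fun displacement :: "move \<Rightarrow> int" where
  "displacement MoveLeft = - 1"
| "displacement MoveStay = 0"
| "displacement MoveRight = 1"

record tm =
  tm_tapes :: nat
  tm_symbols :: nat
  tm_states :: nat
  tm_delta :: "nat \<Rightarrow> nat list \<Rightarrow> nat \<times> (nat \<times> move) list"

definition turing_machine :: "tm \<Rightarrow> bool" where
  "turing_machine M \<longleftrightarrow>
     3 \<le> tm_symbols M \<and>
     (\<forall>q < tm_states M. \<forall>ss. length ss = tm_tapes M \<and> set ss \<subseteq> {..<tm_symbols M} \<longrightarrow>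
        fst (tm_delta M q ss) \<le> tm_states M \<and>
        length (snd (tm_delta M q ss)) = tm_tapes M \<and>
        fst ` set (snd (tm_delta M q ss)) \<subseteq> {..<tm_symbols M})"

record config =
  cfg_state :: nat
  cfg_cells :: "nat \<Rightarrow> int \<Rightarrow> nat"
  cfg_heads :: "nat \<Rightarrow> int"

definition scanned :: "tm \<Rightarrow> config \<Rightarrow> nat list" where
  "scanned M c = map (\<lambda>j. cfg_cells c j (cfg_heads c j)) [0..<tm_tapes M]"

definition tm_step :: "tm \<Rightarrow> config \<Rightarrow> config" where
  "tm_step M c =
     (if cfg_state c < tm_states M then
        let (q, acts) = tm_delta M (cfg_state c) (scanned M c) in
        \<lparr> cfg_state = q,
          cfg_cells = (\<lambda>j. if j < tm_tapes M
             then (cfg_cells c j)(cfg_heads c j := fst (acts ! j)) else cfg_cells c j),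
          cfg_heads = (\<lambda>j. if j < tm_tapes M
             then cfg_heads c j + displacement (snd (acts ! j)) else cfg_heads c j) \<rparr>
      else c)"

definition tape_of :: "bool list \<Rightarrow> int \<Rightarrow> nat" where
  "tape_of x = (\<lambda>i. if 0 \<le> i \<and> i < int (length x) then (if x ! nat i then 2 else 1) else 0)"

text \<open>
  A machine run on the words \<open>xs\<close> starts with these words on its first \<open>length xs\<close> tapes, all other
  tapes being blank. Its result is read from the next tape, number \<open>length xs\<close>: it is the word
  that starts in cell 0 and extends up to the first blank.
\<close>

definition start_config :: "bool list list \<Rightarrow> config" where
  "start_config xs =
     \<lparr> cfg_state = 0,
       cfg_cells = (\<lambda>j. tape_of (if j < length xs then xs ! j else [])),
       cfg_heads = (\<lambda>_. 0) \<rparr>"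

definition computes_within :: "tm \<Rightarrow> bool list list \<Rightarrow> bool list \<Rightarrow> nat \<Rightarrow> bool" where
  "computes_within M xs y t \<longleftrightarrow>
     (let c = (tm_step M ^^ t) (start_config xs) in
        cfg_state c = tm_states M \<and>
        (\<forall>i \<le> length y. cfg_cells c (length xs) (int i) = tape_of y (int i)))"

section \<open>Polynomial time, NP and NP-completeness\<close>

text \<open>
  Since a halted machine no longer changes its configuration, being halted with result \<open>y\<close> after
  exactly \<open>t\<close> steps means having halted with result \<open>y\<close> after at most \<open>t\<close> steps.
\<close>

definition poly_time_function :: "nat \<Rightarrow> (bool list list \<Rightarrow> bool list) \<Rightarrow> bool" where
  "poly_time_function n f \<longleftrightarrow>
     (\<exists>M (p :: nat poly). turing_machine M \<and> n < tm_tapes M \<and>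
        (\<forall>xs. length xs = n \<longrightarrow>
           computes_within M xs (f xs) (poly p (\<Sum>x\<leftarrow>xs. length x))))"

definition in_NP :: "bool list set \<Rightarrow> bool" where
  "in_NP L \<longleftrightarrow>
     (\<exists>V (q :: nat poly). poly_time_function 2 (\<lambda>xs. [V (xs ! 0) (xs ! 1)]) \<and>
        (\<forall>x. x \<in> L \<longleftrightarrow> (\<exists>u. length u \<le> poly q (length x) \<and> V x u)))"

definition poly_time_reducible :: "bool list set \<Rightarrow> bool list set \<Rightarrow> bool" where
  "poly_time_reducible L L' \<longleftrightarrow>
     (\<exists>f. poly_time_function 1 (\<lambda>xs. f (xs ! 0)) \<and> (\<forall>x. x \<in> L \<longleftrightarrow> f x \<in> L'))"

definition NP_hard :: "bool list set \<Rightarrow> bool" where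
  "NP_hard L \<longleftrightarrow> (\<forall>L'. in_NP L' \<longrightarrow> poly_time_reducible L' L)"

definition NP_complete :: "bool list set \<Rightarrow> bool" where
  "NP_complete L \<longleftrightarrow> in_NP L \<and> NP_hard L"

section \<open>Consecutive ones properties and the editing problem\<close>

text \<open>A binary matrix is a \<open>bool mat\<close>, with \<open>True\<close> for the entry 1.\<close>

definition C1P_rows :: "bool mat \<Rightarrow> bool" where
  "C1P_rows A \<longleftrightarrow>
     (\<exists>\<pi>. \<pi> permutes {..<dim_col A} \<and>
        (\<forall>i < dim_row A. \<exists>a b. {j. j < dim_col A \<and> A $$ (i, \<pi> j)} = {a..<b}))"

definition C1P_cols :: "bool mat \<Rightarrow> bool" where
  "C1P_cols A \<longleftrightarrow>
     (\<exists>\<pi>. \<pi> permutes {..<dim_row A} \<and>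
        (\<forall>j < dim_col A. \<exists>a b. {i. i < dim_row A \<and> A $$ (\<pi> i, j)} = {a..<b}))"

definition SC1P :: "bool mat \<Rightarrow> bool" where
  "SC1P A \<longleftrightarrow> C1P_rows A \<and> C1P_cols A"

definition flip :: "(nat \<times> nat) set \<Rightarrow> bool mat \<Rightarrow> bool mat" where
  "flip F A = mat (dim_row A) (dim_col A) (\<lambda>ij. if ij \<in> F then \<not> A $$ ij else A $$ ij)"

definition SC1P_editing :: "(bool mat \<times> nat) set" where
  "SC1P_editing =
     {(A, k). \<exists>F \<subseteq> {..<dim_row A} \<times> {..<dim_col A}. card F \<le> k \<and> SC1P (flip F A)}"

section \<open>Instances as words\<close>

text \<open>
  An instance \<open>(A, k)\<close> is encoded by the two dimensions in unary, each terminated by \<open>False\<close>, the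
  entries row by row, and \<open>k\<close> in binary (least significant bit first, no leading zeros).
\<close>

fun binary :: "nat \<Rightarrow> bool list" where
  "binary n = (if n = 0 then [] else odd n # binary (n div 2))"

declare binary.simps [simp del]

definition unary :: "nat \<Rightarrow> bool list" where
  "unary n = replicate n True @ [False]"

definition entries :: "bool mat \<Rightarrow> bool list" where
  "entries A = concat (map (\<lambda>i. map (\<lambda>j. A $$ (i, j)) [0..<dim_col A]) [0..<dim_row A])"

fun encode :: "bool mat \<times> nat \<Rightarrow> bool list" where
  "encode (A, k) = unary (dim_row A) @ unary (dim_col A) @ entries A @ binary k"

lemma binary_inj: "binary m = binary n \<Longrightarrow> m = n"
proof (induction m arbitrary: n rule: less_induct)
  case (less m)
  show ?case
  proof (cases "m = 0 \<or> n = 0")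
    case True
    then show ?thesis
      using less.prems by (auto simp: binary.simps[of m] binary.simps[of n] split: if_splits)
  next
    case False
    then have *: "odd m = odd n" "binary (m div 2) = binary (n div 2)"
      using less.prems by (auto simp: binary.simps[of m] binary.simps[of n])
    have "m div 2 = n div 2"
      using False less.IH[OF _ *(2)] by simp
    moreover have "m mod 2 = n mod 2"
      using *(1) by (auto simp: odd_iff_mod_2_eq_one even_iff_mod_2_eq_zero)
    ultimately show ?thesis
      by (metis div_mult_mod_eq)
  qed
qed

lemma unary_append_inj: "unary m @ v = unary n @ w \<longleftrightarrow> m = n \<and> v = w"
proof (induction m arbitrary: n)
  case 0
  then show ?case by (cases n) (auto simp: unary_def)
next
  case (Suc m)
  then show ?case by (cases n) (auto simp: unary_def)
qed

lemma length_entries: "length (entries A) = dim_row A * dim_col A"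
  by (simp add: entries_def length_concat o_def sum_list_triv)

lemma entries_inj:
  assumes "entries A = entries B" "dim_row A = dim_row B" "dim_col A = dim_col B"
  shows "A = B"
proof (rule eq_matI)
  fix i j assume ij: "i < dim_row B" "j < dim_col B"
  have "map (\<lambda>i. map (\<lambda>j. A $$ (i, j)) [0..<dim_col B]) [0..<dim_row B] =
        map (\<lambda>i. map (\<lambda>j. B $$ (i, j)) [0..<dim_col B]) [0..<dim_row B]"
    using assms by (intro concat_injective) (auto simp: entries_def set_zip)
  with ij show "A $$ (i, j) = B $$ (i, j)"
    by simp
qed (use assms in auto)

lemma inj_encode: "inj encode"
proof (rule injI)
  fix P Q assume eq: "encode P = encode Q"
  obtain A k B l where PQ: "P = (A, k)" "Q = (B, l)"
    by (cases P, cases Q)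
  have dims: "dim_row A = dim_row B" "dim_col A = dim_col B"
    and rest: "entries A @ binary k = entries B @ binary l"
    using eq by (simp_all add: PQ unary_append_inj)
  have "entries A = entries B" "binary k = binary l"
    using rest dims by (simp_all add: length_entries)
  then show "P = Q"
    using dims by (simp add: PQ entries_inj binary_inj)
qed

end

theory Submission
  imports Defs
begin

text \<open>
  A matrix has the consecutive ones property for rows iff the columns can be given keys, possibly
  with ties, such that the ones of every row are the columns whose keys lie in an interval. Such
  keys for columns and rows are short certificates, which gives membership in NP.

  For hardness, the run of a polynomial-time verifier becomes a CNF formula, and the formula becomes
  a matrix with budget \<open>K\<close>. Rows with more than \<open>K\<close> copies cannot all be edited, so they enforce
  rods: a head, a tail of more than \<open>K\<close> columns, and an end, in this order up to reversal. The row of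
  a literal has its ones in the head of the rod of the variable, the head of the rod of the literal,
  and the columns of the clauses that contain the literal. No edited literal row covers a
  tail. Hence at most one of the two literals of a variable joins its two heads, the other one pays
  \<open>w\<close> for giving up the head of its own rod (giving up the other head costs \<open>2 w\<close>), and the budget
  lets every variable pay just once. The clause columns that a variable can reach then lie between
  the joined heads and belong to no other variable. The joining row covers them all, so that a clause
  of the opposite literal among them saves one flip there but costs one here. The budget moreover
  demands a saving for every clause, so every clause contains a joining literal.

  Machines enter through two facts only. Taking head positions as counters, they evaluate
  arithmetic expressions with bounded sums in unary; so every word whose length and bits are given by
  such expressions is computed in polynomial time. And with all tapes recorded relative to their
  heads, one step of a machine is a shift, so that its run is described by implications between the
  symbols at time \<open>t\<close> and at time \<open>t + 1\<close>; being Horn clauses, they need no uniqueness constraints.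
\<close>

section \<open>Structured programs for multi-tape machines\<close>

text \<open>The \<open>budget\<close> is \<open>n * wgt\<close> for one abandoned literal head per
  variable, plus \<open>occs\<close> for clearing every occurrence of a literal in a clause, minus
  one for each clause. The weight \<open>wgt = 2 * n * m + 1\<close> exceeds \<open>occs\<close>;
  therefore the budget is below \<open>(n + 1) * wgt\<close>, and as every variable spends one
  \<open>wgt\<close>, none can afford a second. The head of the rod of a variable is twice as
  expensive because the losing literal row has to stay attached to it: only then is that row
  confined to the clauses between the joined heads, where each clause it keeps is charged to the
  joining row. This exchange presupposes that no clause contains a variable together with its
  negation. On the machine side the obstacle is that the reduction must be a Turing machine that
  writes the encoded word; describing the word by its length and its bits avoids programming with
  data structures. Values of expressions are polynomially bounded, whereas \<open>2 ^ i\<close> is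
  not, so the binary numeral of an instance is handled only through powers capped by a known
  number.\<close>

datatype cmd =
  Do "nat list \<Rightarrow> nat \<Rightarrow> nat \<times> move"
| Seq cmd cmd (infixr ";;" 60)
| While "nat list \<Rightarrow> bool" cmd

type_synonym tapes = "(nat \<Rightarrow> int \<Rightarrow> nat) \<times> (nat \<Rightarrow> int)"

definition scan :: "nat \<Rightarrow> tapes \<Rightarrow> nat list" where
  "scan k s = map (\<lambda>j. fst s j (snd s j)) [0..<k]"

definition act :: "nat \<Rightarrow> (nat \<Rightarrow> nat \<times> move) \<Rightarrow> tapes \<Rightarrow> tapes" where
  "act k g s =
     ((\<lambda>j. if j < k then (fst s j)(snd s j := fst (g j)) else fst s j),
      (\<lambda>j. if j < k then snd s j + displacement (snd (g j)) else snd s j))"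

text \<open>The test of a loop is a machine step of its own, as it selects the next state; hence the
  failing test counts as well. Step counts are exact here, and \<open>runs\<close> turns them into
  upper bounds.\<close>

inductive exec :: "nat \<Rightarrow> cmd \<Rightarrow> tapes \<Rightarrow> nat \<Rightarrow> tapes \<Rightarrow> bool" for k where
  Do: "exec k (Do f) s 1 (act k (f (scan k s)) s)"
| Seq: "exec k a s t s' \<Longrightarrow> exec k b s' t' s'' \<Longrightarrow> exec k (a ;; b) s (t + t') s''"
| WhileF: "\<not> P (scan k s) \<Longrightarrow> exec k (While P a) s 1 s"
| WhileT: "P (scan k s) \<Longrightarrow> exec k a s t s' \<Longrightarrow> exec k (While P a) s' t' s'' \<Longrightarrow>
    exec k (While P a) s (1 + t + t') s''"

fun csize :: "cmd \<Rightarrow> nat" where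
  "csize (Do f) = 1"
| "csize (a ;; b) = csize a + csize b"
| "csize (While P a) = Suc (csize a)"

text \<open>\<open>code a p e\<close> lists the instructions of the states \<open>p, p + 1, \<dots>\<close>; \<open>e\<close> is the exit state.\<close>

fun code :: "cmd \<Rightarrow> nat \<Rightarrow> nat \<Rightarrow> (nat list \<Rightarrow> nat \<times> (nat \<times> move) list) list" where
  "code (Do f) p e = [\<lambda>ss. (e, map (f ss) [0..<length ss])]"
| "code (a ;; b) p e = code a p (p + csize a) @ code b (p + csize a) e"
| "code (While P a) p e =
     (\<lambda>ss. (if P ss then Suc p else e, map (\<lambda>j. (ss ! j, MoveStay)) [0..<length ss]))
       # code a (Suc p) p"

definition tm_of :: "nat \<Rightarrow> cmd \<Rightarrow> tm" where
  "tm_of k a = \<lparr>tm_tapes = k, tm_symbols = 3, tm_states = csize a,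
     tm_delta = (\<lambda>q ss. (code a 0 (csize a) ! q) ss)\<rparr>"

definition cfg :: "nat \<Rightarrow> tapes \<Rightarrow> config" where
  "cfg q s = \<lparr>cfg_state = q, cfg_cells = fst s, cfg_heads = snd s\<rparr>"

fun wf_cmd :: "cmd \<Rightarrow> bool" where
  "wf_cmd (Do f) \<longleftrightarrow> (\<forall>ss j. set ss \<subseteq> {..<3} \<longrightarrow> j < length ss \<longrightarrow> fst (f ss j) < 3)"
| "wf_cmd (a ;; b) \<longleftrightarrow> wf_cmd a \<and> wf_cmd b"
| "wf_cmd (While P a) \<longleftrightarrow> wf_cmd a"

lemma length_code [simp]: "length (code a p e) = csize a"
  by (induction a arbitrary: p e) auto

lemma code_wf:
  assumes "wf_cmd a" "q < csize a" "set ss \<subseteq> {..<3}" "e \<le> m" "p + csize a \<le> m"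
  shows "fst ((code a p e ! q) ss) \<le> m \<and>
    length (snd ((code a p e ! q) ss)) = length ss \<and>
    fst ` set (snd ((code a p e ! q) ss)) \<subseteq> {..<3}"
  using assms
proof (induction a arbitrary: p e q)
  case (Do f)
  then show ?case by auto
next
  case (Seq a b)
  then show ?case by (auto simp: nth_append)
next
  case (While P a)
  show ?case
  proof (cases q)
    case 0
    have "fst ` set (map (\<lambda>j. (ss ! j, MoveStay)) [0..<length ss]) \<subseteq> set ss" by auto
    with While 0 show ?thesis by (auto simp: set_conv_nth)
  next
    case (Suc q')
    with While show ?thesis by auto
  qed
qed

lemma turing_machine_tm_of: "wf_cmd a \<Longrightarrow> turing_machine (tm_of k a)"
  using code_wf[of a _ _ "csize a" "csize a" 0] by (auto simp: turing_machine_def tm_of_def)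

lemma tm_step_cfg:
  assumes "q < csize a"
    and "(code a 0 (csize a) ! q) (scan k s) = (q', map g [0..<k])"
  shows "tm_step (tm_of k a) (cfg q s) = cfg q' (act k g s)"
proof -
  have "scanned (tm_of k a) (cfg q s) = scan k s"
    by (simp add: scanned_def tm_of_def cfg_def scan_def)
  with assms show ?thesis
    by (auto simp: tm_step_def cfg_def tm_of_def act_def fun_eq_iff)
qed

lemma length_scan [simp]: "length (scan k s) = k"
  by (simp add: scan_def)

lemma scan_nth [simp]: "j < k \<Longrightarrow> scan k s ! j = fst s j (snd s j)"
  by (simp add: scan_def)

lemma act_id: "(\<And>j. j < k \<Longrightarrow> g j = (scan k s ! j, MoveStay)) \<Longrightarrow> act k g s = s"
  by (auto simp: act_def fun_eq_iff intro!: prod_eqI)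

text \<open>The code of \<open>a\<close> may sit anywhere inside that of \<open>P\<close>, with
  arbitrary exit state \<open>e\<close>. The induction needs both: the first part of a sequence
  exits into the second, and the body of a loop exits back to the test.\<close>

lemma exec_tm:
  assumes "exec k a s t s'"
    and "\<forall>i < csize a. code P 0 (csize P) ! (p + i) = code a p e ! i" "p + csize a \<le> csize P"
  shows "(tm_step (tm_of k P) ^^ t) (cfg p s) = cfg e s'"
  using assms
proof (induction arbitrary: p e rule: exec.induct)
  case (Do f s)
  then show ?case by (simp add: tm_step_cfg)
next
  case (Seq a s t s' b t' s'')
  have *: "(tm_step (tm_of k P) ^^ t) (cfg p s) = cfg (p + csize a) s'"
    by (rule Seq.IH(1)) (use Seq.prems in \<open>auto simp: nth_append\<close>)
  have **: "(tm_step (tm_of k P) ^^ t') (cfg (p + csize a) s') = cfg e s''"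
  proof (rule Seq.IH(2))
    show "\<forall>i<csize b. code P 0 (csize P) ! (p + csize a + i) = code b (p + csize a) e ! i"
    proof (intro allI impI)
      fix i assume "i < csize b"
      with Seq.prems(1)[rule_format, of "csize a + i"]
      show "code P 0 (csize P) ! (p + csize a + i) = code b (p + csize a) e ! i"
        by (simp add: nth_append add.assoc)
    qed
  qed (use Seq.prems in auto)
  have "(tm_step (tm_of k P) ^^ (t' + t)) (cfg p s) = cfg e s''"
    unfolding funpow_add o_apply * ** ..
  then show ?case by (simp add: add.commute)
next
  case (WhileF Q s a)
  have "(code P 0 (csize P) ! p) (scan k s) = (e, map (\<lambda>j. (scan k s ! j, MoveStay)) [0..<k])"
    using WhileF.prems(1)[rule_format, of 0] WhileF.hyps by simp
  then show ?case using WhileF.prems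
    by (simp add: tm_step_cfg[of p P k s e "\<lambda>j. (scan k s ! j, MoveStay)"] act_id)
next
  case (WhileT Q s a t s' t' s'')
  have "(code P 0 (csize P) ! p) (scan k s) = (Suc p, map (\<lambda>j. (scan k s ! j, MoveStay)) [0..<k])"
    using WhileT.prems(1)[rule_format, of 0] WhileT.hyps by simp
  then have 1: "tm_step (tm_of k P) (cfg p s) = cfg (Suc p) s" using WhileT.prems
    by (simp add: tm_step_cfg[of p P k s "Suc p" "\<lambda>j. (scan k s ! j, MoveStay)"] act_id)
  have 2: "(tm_step (tm_of k P) ^^ t) (cfg (Suc p) s) = cfg p s'"
  proof (rule WhileT.IH(1))
    show "\<forall>i<csize a. code P 0 (csize P) ! (Suc p + i) = code a (Suc p) p ! i"
      using WhileT.prems(1)[rule_format, of "Suc _"] by simp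
  qed (use WhileT.prems in auto)
  have 3: "(tm_step (tm_of k P) ^^ t') (cfg p s') = cfg e s''"
    by (rule WhileT.IH(2)) (use WhileT.prems in auto)
  have "(tm_step (tm_of k P) ^^ (t' + (t + 1))) (cfg p s) = cfg e s''"
    unfolding funpow_add o_apply funpow.simps(2) One_nat_def funpow_0 1 2 3 ..
  then show ?case by (simp add: algebra_simps)
qed

lemma tm_step_halted:
  "cfg_state c = tm_states M \<Longrightarrow> (tm_step M ^^ t) c = c"
  by (induction t) (auto simp: tm_step_def)

lemma exec_computes:
  assumes "exec k a (\<lambda>j. tape_of (if j < length xs then xs ! j else []), \<lambda>_. 0) t s'" "t \<le> T"
    and "\<And>i. i \<le> length y \<Longrightarrow> fst s' (length xs) (int i) = tape_of y (int i)"
  shows "computes_within (tm_of k a) xs y T"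
proof -
  have "(tm_step (tm_of k a) ^^ t) (start_config xs) = cfg (csize a) s'"
    using exec_tm[OF assms(1), of a 0 "csize a"] by (simp add: start_config_def cfg_def)
  moreover have "(tm_step (tm_of k a) ^^ T) (start_config xs) =
    (tm_step (tm_of k a) ^^ (T - t)) ((tm_step (tm_of k a) ^^ t) (start_config xs))"
    using assms(2) by (metis funpow_add o_apply le_add_diff_inverse2)
  ultimately have "(tm_step (tm_of k a) ^^ T) (start_config xs) = cfg (csize a) s'"
    by (simp add: tm_step_halted cfg_def tm_of_def)
  then show ?thesis
    using assms(3) by (simp add: computes_within_def cfg_def tm_of_def)
qed

definition runs :: "nat \<Rightarrow> cmd \<Rightarrow> tapes \<Rightarrow> nat \<Rightarrow> tapes \<Rightarrow> bool" where
  "runs k a s B s' \<longleftrightarrow> (\<exists>t\<le>B. exec k a s t s')"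

lemma runs_mono: "runs k a s B s' \<Longrightarrow> B \<le> B' \<Longrightarrow> runs k a s B' s'"
  unfolding runs_def using le_trans by blast

lemma runs_Seq: "runs k a s B s' \<Longrightarrow> runs k b s' B' s'' \<Longrightarrow> runs k (a ;; b) s (B + B') s''"
  unfolding runs_def by (meson exec.Seq add_mono)

lemma runs_While:
  assumes "\<And>i. i < N \<Longrightarrow> P (scan k (\<sigma> i))" "\<not> P (scan k (\<sigma> N))"
    and "\<And>i. i < N \<Longrightarrow> runs k a (\<sigma> i) B (\<sigma> (Suc i))"
  shows "runs k (While P a) (\<sigma> 0) (N * (B + 1) + 1) (\<sigma> N)"
  using assms
proof (induction N arbitrary: \<sigma>)
  case 0
  then have "exec k (While P a) (\<sigma> 0) 1 (\<sigma> 0)" by (intro exec.WhileF)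
  then show ?case unfolding runs_def by (intro exI[of _ 1]) simp
next
  case (Suc N)
  have "runs k (While P a) (\<sigma> (Suc 0)) (N * (B + 1) + 1) (\<sigma> (Suc N))"
    using Suc.IH[of "\<lambda>i. \<sigma> (Suc i)"] Suc.prems by simp
  then obtain t' where t': "t' \<le> N * (B + 1) + 1" "exec k (While P a) (\<sigma> (Suc 0)) t' (\<sigma> (Suc N))"
    by (auto simp: runs_def)
  obtain t where t: "t \<le> B" "exec k a (\<sigma> 0) t (\<sigma> (Suc 0))"
    using Suc.prems(3)[of 0] by (auto simp: runs_def)
  have "exec k (While P a) (\<sigma> 0) (1 + t + t') (\<sigma> (Suc N))"
    by (rule exec.WhileT) (use Suc.prems(1)[of 0] t t' in auto)
  moreover have "1 + t + t' \<le> Suc N * (B + 1) + 1" using t(1) t'(1) by simp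
  ultimately show ?case unfolding runs_def by blast
qed

section \<open>Counters\<close>

text \<open>
  The head position of a tape that carries a mark in cell 0 and is blank otherwise serves as a
  counter: the counter is zero iff the scanned cell is not blank.
\<close>

definition moves :: "(nat list \<Rightarrow> nat \<Rightarrow> move) \<Rightarrow> cmd" where
  "moves m = Do (\<lambda>ss j. (ss ! j, m ss j))"

lemma wf_moves [simp]: "wf_cmd (moves m)"
  unfolding moves_def by (auto simp: subset_iff)

lemma runs_moves:
  assumes "\<And>j. h' j = (if j < k then h j + displacement (m (scan k (c, h)) j) else h j)"
    and "1 \<le> B"
  shows "runs k (moves m) (c, h) B (c, h')"
proof -
  have "act k ((\<lambda>ss j. (ss ! j, m ss j)) (scan k (c, h))) (c, h) = (c, h')"
    using assms by (auto simp: act_def fun_eq_iff)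
  with exec.Do[of k "\<lambda>ss j. (ss ! j, m ss j)" "(c, h)"] have "exec k (moves m) (c, h) 1 (c, h')"
    by (simp add: moves_def)
  with assms(2) show ?thesis unfolding runs_def by blast
qed

definition shift :: "nat set \<Rightarrow> nat set \<Rightarrow> nat \<Rightarrow> move" where
  "shift L R j = (if j \<in> L then MoveLeft else if j \<in> R then MoveRight else MoveStay)"

text \<open>Reading a counter in unary destroys it, so its value is poured into several places at
  once: one copy is the result, another serves to pour the value back or to bring the head of an
  input tape home.\<close>

definition drain :: "nat \<Rightarrow> nat set \<Rightarrow> nat set \<Rightarrow> cmd" where
  "drain r L R = While (\<lambda>ss. ss ! r = 0) (moves (\<lambda>_. shift (insert r L) R))"

lemma wf_drain [simp]: "wf_cmd (drain r L R)"
  by (simp add: drain_def)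

definition counters :: "nat \<Rightarrow> nat \<Rightarrow> (nat \<Rightarrow> int \<Rightarrow> nat) \<Rightarrow> bool" where
  "counters n k c \<longleftrightarrow> (\<forall>j i. n < j \<longrightarrow> j < k \<longrightarrow> c j i = (if i = 0 then 1 else 0))"

lemma runs_drain:
  assumes "counters n k c" "n < r" "r < k" "h r = int v" "r \<notin> R"
    and "\<And>j. h' j = (if j = r then 0 else if j < k then h j + int v * displacement (shift L R j) else h j)"
  shows "runs k (drain r L R) (c, h) (2 * v + 1) (c, h')"
proof -
  define \<sigma> where "\<sigma> i = (c, \<lambda>j. if j < k then h j + int i * displacement (shift (insert r L) R j) else h j)" for i
  have "runs k (drain r L R) (\<sigma> 0) (v * (1 + 1) + 1) (\<sigma> v)"
    unfolding drain_def
  proof (rule runs_While)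
    fix i assume "i < v"
    then show "scan k (\<sigma> i) ! r = 0"
      using assms by (auto simp: \<sigma>_def counters_def shift_def)
    show "runs k (moves (\<lambda>_. shift (insert r L) R)) (\<sigma> i) 1 (\<sigma> (Suc i))"
      unfolding \<sigma>_def by (rule runs_moves) (auto simp: algebra_simps)
  next
    show "\<not> scan k (\<sigma> v) ! r = 0"
      using assms by (auto simp: \<sigma>_def counters_def shift_def)
  qed
  moreover have "\<sigma> 0 = (c, h)" by (auto simp: \<sigma>_def)
  moreover have "\<sigma> v = (c, h')" using assms by (auto simp: \<sigma>_def shift_def fun_eq_iff)
  moreover have "v * (1 + 1) + 1 = 2 * v + 1" by simp
  ultimately show ?thesis by (simp only:)
qed

section \<open>Bounded arithmetic expressions\<close>

text \<open>
  Expressions over input words and a de Bruijn environment of numbers; \<open>ESum a b\<close> binds the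
  summation index. All values are polynomially bounded, so the machines can compute in unary.
\<close>

datatype ex =
  EVar nat | EConst nat | ELen nat | EBit nat ex | EAdd ex ex | ESub ex ex | ESum ex ex

fun eval :: "bool list list \<Rightarrow> nat list \<Rightarrow> ex \<Rightarrow> nat" where
  "eval xs vs (EVar i) = (if i < length vs then vs ! i else 0)"
| "eval xs vs (EConst c) = c"
| "eval xs vs (ELen w) = (if w < length xs then length (xs ! w) else 0)"
| "eval xs vs (EBit w a) = (if w < length xs \<and> eval xs vs a < length (xs ! w) \<and> xs ! w ! eval xs vs a
     then 1 else 0)"
| "eval xs vs (EAdd a b) = eval xs vs a + eval xs vs b"
| "eval xs vs (ESub a b) = eval xs vs a - eval xs vs b"
| "eval xs vs (ESum a b) = (\<Sum>i<eval xs vs a. eval xs (i # vs) b)"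

fun need :: "ex \<Rightarrow> nat" where
  "need (EVar i) = 2"
| "need (EConst c) = 1"
| "need (ELen w) = 2"
| "need (EBit w a) = max 3 (1 + need a)"
| "need (EAdd a b) = max 2 (max (need a) (1 + need b))"
| "need (ESub a b) = max 2 (max (need a) (1 + need b))"
| "need (ESum a b) = max 4 (max (1 + need a) (3 + need b))"

definition skip :: cmd where "skip = moves (\<lambda>_ _. MoveStay)"

fun incs :: "nat \<Rightarrow> nat \<Rightarrow> cmd" where
  "incs r 0 = skip"
| "incs r (Suc m) = moves (\<lambda>_. shift {} {r}) ;; incs r m"

text \<open>
  \<open>ev n env r e\<close> adds nothing but the value of \<open>e\<close> to the zero counter \<open>r\<close>; the counters from
  \<open>r + 1\<close> on are scratch space, and \<open>env\<close> lists the counters of the variables.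
\<close>

fun ev :: "nat \<Rightarrow> nat list \<Rightarrow> nat \<Rightarrow> ex \<Rightarrow> cmd" where
  "ev n env r (EVar i) = (if i < length env
     then drain (env ! i) {} {r, r + 1} ;; drain (r + 1) {} {env ! i} else skip)"
| "ev n env r (EConst c) = incs r c"
| "ev n env r (ELen w) = (if w < n
     then While (\<lambda>ss. ss ! w \<noteq> 0) (moves (\<lambda>_. shift {} {w, r, r + 1})) ;; drain (r + 1) {w} {}
     else skip)"
| "ev n env r (EBit w a) = (if w < n
     then ev n env (r + 1) a ;; drain (r + 1) {} {w, r + 2} ;;
       moves (\<lambda>ss j. if j = r \<and> ss ! w = 2 then MoveRight else MoveStay) ;;
       drain (r + 2) {w} {}
     else skip)"
| "ev n env r (EAdd a b) = ev n env r a ;; ev n env (r + 1) b ;; drain (r + 1) {} {r}"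
| "ev n env r (ESub a b) = ev n env r a ;; ev n env (r + 1) b ;;
     While (\<lambda>ss. ss ! (r + 1) = 0)
       (moves (\<lambda>ss. shift (if ss ! r = 0 then {r, r + 1} else {r + 1}) {}))"
| "ev n env r (ESum a b) = ev n env (r + 1) a ;;
     While (\<lambda>ss. ss ! (r + 1) = 0)
       (ev n ((r + 2) # env) (r + 3) b ;; drain (r + 3) {} {r} ;;
        moves (\<lambda>_. shift {r + 1} {r + 2})) ;;
     drain (r + 2) {} {}"

lemma wf_skip [simp]: "wf_cmd skip"
  by (simp add: skip_def)

lemma wf_incs [simp]: "wf_cmd (incs r m)"
  by (induction m) auto

lemma wf_ev [simp]: "wf_cmd (ev n env r e)"
  by (induction e arbitrary: env r) auto

section \<open>Polynomial bounds on values and running times of expressions\<close>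

lemma poly_nat_mono: "x \<le> y \<Longrightarrow> poly p x \<le> poly p y" for x y :: nat
  by (induction p) (auto intro!: add_mono mult_mono)

definition small :: "nat \<Rightarrow> bool list list \<Rightarrow> nat list \<Rightarrow> bool" where
  "small s xs vs \<longleftrightarrow> (\<forall>x\<in>set xs. length x \<le> s) \<and> (\<forall>v\<in>set vs. v \<le> s)"

text \<open>A sum has polynomially many summands, each of them polynomial. Its index lies below the
  value of \<open>a\<close>, so the summand is measured with size \<open>s + poly p s\<close> in
  place of \<open>s\<close>.\<close>

lemma eval_bound: "\<exists>p. \<forall>xs vs s. small s xs vs \<longrightarrow> eval xs vs e \<le> poly p s"
proof (induction e)
  case (EVar i)
  show ?case by (rule exI[of _ "[:0, 1:]"]) (auto simp: small_def)
next
  case (EConst c)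
  show ?case by (rule exI[of _ "[:c:]"]) auto
next
  case (ELen w)
  show ?case by (rule exI[of _ "[:0, 1:]"]) (auto simp: small_def)
next
  case (EBit w e)
  show ?case by (rule exI[of _ "[:1:]"]) auto
next
  case (EAdd a b)
  then obtain p q where
    "\<forall>xs vs s. small s xs vs \<longrightarrow> eval xs vs a \<le> poly p s"
    "\<forall>xs vs s. small s xs vs \<longrightarrow> eval xs vs b \<le> poly q s" by blast
  then show ?case by (intro exI[of _ "p + q"]) (auto intro!: add_mono)
next
  case (ESub a b)
  then obtain p where "\<forall>xs vs s. small s xs vs \<longrightarrow> eval xs vs a \<le> poly p s" by blast
  then show ?case by (intro exI[of _ p]) (auto intro: le_trans[OF diff_le_self])
next
  case (ESum a b)
  then obtain p q where
    p: "\<And>xs vs s. small s xs vs \<Longrightarrow> eval xs vs a \<le> poly p s" and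
    q: "\<And>xs vs s. small s xs vs \<Longrightarrow> eval xs vs b \<le> poly q s" by blast
  show ?case
  proof (intro exI[of _ "p * pcompose q ([:0, 1:] + p)"] allI impI)
    fix xs vs and s :: nat assume s: "small s xs vs"
    have "eval xs (i # vs) b \<le> poly q (s + poly p s)" if "i < eval xs vs a" for i
      by (rule q) (use s p[OF s] that in \<open>force simp: small_def\<close>)
    then have "eval xs vs (ESum a b) \<le> eval xs vs a * poly q (s + poly p s)"
      using sum_bounded_above[of "{..<eval xs vs a}" "\<lambda>i. eval xs (i # vs) b"] by simp
    also have "\<dots> \<le> poly p s * poly q (s + poly p s)" using p[OF s] by simp
    finally show "eval xs vs (ESum a b) \<le> poly (p * pcompose q ([:0, 1:] + p)) s"
      by (simp add: poly_pcompose)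
  qed
qed

text \<open>From \<open>r\<close> on all counters are zero, and the input heads are home. As
  \<open>ev\<close> changes only the head of tape \<open>r\<close>, the condition holds again for a
  larger \<open>r\<close>, and scratch counters can be reused. The output tape \<open>n\<close> is
  left free.\<close>

definition ready :: "nat \<Rightarrow> nat \<Rightarrow> bool list list \<Rightarrow> nat list \<Rightarrow> nat list \<Rightarrow> nat \<Rightarrow> tapes \<Rightarrow> bool" where
  "ready k n xs env vs r s \<longleftrightarrow>
     counters n k (fst s) \<and> length xs = n \<and> n < r \<and>
     (\<forall>w<n. fst s w = tape_of (xs ! w) \<and> snd s w = 0) \<and>
     length env = length vs \<and>
     (\<forall>i<length vs. n < env ! i \<and> env ! i < r \<and> snd s (env ! i) = int (vs ! i)) \<and>
     (\<forall>j. r \<le> j \<longrightarrow> j < k \<longrightarrow> snd s j = 0)"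

lemma runs_incs:
  assumes "r < k"
  shows "runs k (incs r m) (c, h) (m + 1) (c, h(r := h r + int m))"
proof (induction m arbitrary: h)
  case 0
  show ?case by (auto simp: skip_def intro!: runs_moves)
next
  case (Suc m)
  have "(h(r := h r + 1))(r := (h(r := h r + 1)) r + int m) = h(r := h r + int (Suc m))" by auto
  then have "runs k (incs r m) (c, h(r := h r + 1)) (m + 1) (c, h(r := h r + int (Suc m)))"
    using Suc.IH[of "h(r := h r + 1)"] by (simp only:)
  then have "runs k (incs r (Suc m)) (c, h) (1 + (m + 1)) (c, h(r := h r + int (Suc m)))"
    unfolding incs.simps
    by (intro runs_Seq[where s' = "(c, h(r := h r + 1))"] runs_moves)
      (use assms in \<open>auto simp: shift_def\<close>)
  then show ?case by (rule runs_mono) simp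
qed


lemma ready_up:
  assumes "ready k n xs env vs r (c, h)" "r \<le> r'" "\<And>j. j < r \<Longrightarrow> h' j = h j"
    "\<And>j. r' \<le> j \<Longrightarrow> j < k \<Longrightarrow> h' j = 0"
  shows "ready k n xs env vs r' (c, h')"
  using assms unfolding ready_def by (auto intro: less_le_trans)

lemma tape_of_nth:
  "tape_of x (int i) = (if i < length x then if x ! i then 2 else 1 else 0)"
  by (auto simp: tape_of_def)

text \<open>The polynomial comes before \<open>k\<close>, \<open>env\<close> and \<open>r\<close>,
  so that one bound serves every placement of the counters and every iteration of a loop.\<close>

definition ev_time :: "nat \<Rightarrow> ex \<Rightarrow> nat poly \<Rightarrow> bool" where
  "ev_time n e p \<longleftrightarrow> (\<forall>k xs env vs r c h s.
     ready k n xs env vs r (c, h) \<longrightarrow> small s xs vs \<longrightarrow> r + need e \<le> k \<longrightarrow>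
     runs k (ev n env r e) (c, h) (poly p s) (c, h(r := int (eval xs vs e))))"

lemma ev_timeI:
  assumes "\<And>k xs env vs r c h s. ready k n xs env vs r (c, h) \<Longrightarrow> small s xs vs \<Longrightarrow> r + need e \<le> k \<Longrightarrow>
    runs k (ev n env r e) (c, h) (poly p s) (c, h(r := int (eval xs vs e)))"
  shows "ev_time n e p"
  unfolding ev_time_def using assms by blast

lemma ev_timeD:
  "ev_time n e p \<Longrightarrow> ready k n xs env vs r (c, h) \<Longrightarrow> small s xs vs \<Longrightarrow> r + need e \<le> k \<Longrightarrow>
   runs k (ev n env r e) (c, h) (poly p s) (c, h(r := int (eval xs vs e)))"
  unfolding ev_time_def by blast

lemma ev_time_V: "ev_time n (EVar i) [:2, 4:]"
proof (rule ev_timeI)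
  fix k xs env vs r c h and s :: nat
  assume rd: "ready k n xs env vs r (c, h)" and s: "small s xs vs" and k: "r + need (EVar i) \<le> k"
  show "runs k (ev n env r (EVar i)) (c, h) (poly [:2, 4:] s) (c, h(r := int (eval xs vs (EVar i))))"
  proof (cases "i < length env")
    case True
    define v where "v = vs ! i"
    have e: "n < env ! i" "env ! i < r" "h (env ! i) = int v" "counters n k c" "h r = 0"
      "h (Suc r) = 0" "n < r"
      using rd True k by (auto simp: ready_def v_def)
    have 1: "runs k (drain (env ! i) {} {r, r + 1}) (c, h) (2 * v + 1)
      (c, h(env ! i := 0, r := int v, r + 1 := int v))"
      by (rule runs_drain) (use e k in \<open>auto simp: shift_def\<close>)
    have 2: "runs k (drain (r + 1) {} {env ! i}) (c, h(env ! i := 0, r := int v, r + 1 := int v))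
      (2 * v + 1) (c, h(r := int v))"
      by (rule runs_drain) (use e k in \<open>auto simp: shift_def\<close>)
    have "runs k (ev n env r (EVar i)) (c, h) ((2 * v + 1) + (2 * v + 1)) (c, h(r := int v))"
      using runs_Seq[OF 1 2] True by (simp only: ev.simps if_True)
    moreover have "v \<le> s" using s True rd by (auto simp: small_def v_def ready_def)
    ultimately show ?thesis using True rd
      by (auto elim!: runs_mono simp: v_def ready_def)
  next
    case False
    have "h(r := 0) = h" using rd k by (auto simp: ready_def)
    with False show ?thesis using rd
      by (auto simp: skip_def ready_def intro!: runs_mono[OF runs_moves])
  qed
qed

lemma ev_time_C: "ev_time n (EConst v) [:v + 1:]"
proof (rule ev_timeI)
  fix k xs env vs r c h and s :: nat
  assume rd: "ready k n xs env vs r (c, h)" and k: "r + need (EConst v) \<le> k"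
  then have "h r = 0" by (auto simp: ready_def)
  then show "runs k (ev n env r (EConst v)) (c, h) (poly [:v + 1:] s) (c, h(r := int (eval xs vs (EConst v))))"
    using runs_incs[of r k v c h] k by simp
qed

lemma ev_time_Len: "ev_time n (ELen w) [:2, 4:]"
proof (rule ev_timeI)
  fix k xs env vs r c h and s :: nat
  assume rd: "ready k n xs env vs r (c, h)" and s: "small s xs vs" and k: "r + need (ELen w) \<le> k"
  show "runs k (ev n env r (ELen w)) (c, h) (poly [:2, 4:] s) (c, h(r := int (eval xs vs (ELen w))))"
  proof (cases "w < n")
    case True
    define v where "v = length (xs ! w)"
    have e: "counters n k c" "h r = 0" "h (Suc r) = 0" "n < r" "h w = 0" "c w = tape_of (xs ! w)"
      using rd True k by (auto simp: ready_def v_def)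
    define \<sigma> where "\<sigma> i = (c, h(w := int i, r := int i, r + 1 := int i))" for i
    have 1: "runs k (While (\<lambda>ss. ss ! w \<noteq> 0) (moves (\<lambda>_. shift {} {w, r, r + 1}))) (\<sigma> 0)
      (v * (1 + 1) + 1) (\<sigma> v)"
    proof (rule runs_While)
      show "runs k (moves (\<lambda>_. shift {} {w, r, r + 1})) (\<sigma> i) 1 (\<sigma> (Suc i))" for i
        unfolding \<sigma>_def using e True k by (auto intro!: runs_moves simp: shift_def)
    qed (use e True k in \<open>auto simp: \<sigma>_def tape_of_nth v_def tape_of_nth[of _ 0, simplified]\<close>)
    have 2: "\<sigma> 0 = (c, h)" using e by (auto simp: \<sigma>_def)
    have 3: "runs k (drain (r + 1) {w} {}) (\<sigma> v) (2 * v + 1) (c, h(r := int v))"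
      unfolding \<sigma>_def by (rule runs_drain) (use e k True in \<open>auto simp: shift_def\<close>)
    have "runs k (ev n env r (ELen w)) (c, h) ((v * (1 + 1) + 1) + (2 * v + 1)) (c, h(r := int v))"
      using runs_Seq[OF 1[unfolded 2] 3] True by (simp only: ev.simps if_True)
    moreover have "v \<le> s" using s True rd by (auto simp: small_def v_def ready_def)
    ultimately show ?thesis using True rd
      by (auto elim!: runs_mono simp: v_def ready_def)
  next
    case False
    have "h(r := 0) = h" using rd k by (auto simp: ready_def)
    with False show ?thesis using rd
      by (auto simp: skip_def ready_def intro!: runs_mono[OF runs_moves])
  qed
qed

lemma ev_time_Bit:
  assumes pa: "ev_time n a pa" and va: "\<And>xs vs s. small s xs vs \<Longrightarrow> eval xs vs a \<le> poly va s"
  shows "ev_time n (EBit w a)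
    (pa + [:4:] * va + [:3:])"
proof (rule ev_timeI)
  fix k xs env vs r c h and s :: nat
  assume rd: "ready k n xs env vs r (c, h)" and s: "small s xs vs" and k: "r + need (EBit w a) \<le> k"
  show "runs k (ev n env r (EBit w a)) (c, h) (poly (pa + [:4:] * va + [:3:]) s)
    (c, h(r := int (eval xs vs (EBit w a))))"
  proof (cases "w < n")
    case True
    define v where "v = eval xs vs a"
    define b where "b = int (eval xs vs (EBit w a))"
    have e: "counters n k c" "h r = 0" "h (Suc r) = 0" "h (Suc (Suc r)) = 0" "n < r" "h w = 0"
      "c w = tape_of (xs ! w)" "length xs = n"
      using rd True k by (auto simp: ready_def v_def)
    have 1: "runs k (ev n env (r + 1) a) (c, h) (poly pa s) (c, h(r + 1 := int v))"
      unfolding v_def by (rule ev_timeD[OF pa ready_up[OF rd] s]) (use rd k in \<open>auto simp: ready_def\<close>)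
    have 2: "runs k (drain (r + 1) {} {w, r + 2}) (c, h(r + 1 := int v)) (2 * v + 1)
      (c, h(w := int v, r + 2 := int v))"
      by (rule runs_drain) (use e k True in \<open>auto simp: shift_def\<close>)
    have 3: "runs k (moves (\<lambda>ss j. if j = r \<and> ss ! w = 2 then MoveRight else MoveStay))
       (c, h(w := int v, r + 2 := int v)) 1 (c, h(w := int v, r + 2 := int v, r := b))"
      by (rule runs_moves) (use e k True in \<open>auto simp: b_def tape_of_nth v_def\<close>)
    have 4: "runs k (drain (r + 2) {w} {}) (c, h(w := int v, r + 2 := int v, r := b))
       (2 * v + 1) (c, h(r := b))"
      by (rule runs_drain) (use e k True in \<open>auto simp: shift_def\<close>)
    have "runs k (ev n env r (EBit w a)) (c, h)
      (poly pa s + ((2 * v + 1) + (1 + (2 * v + 1)))) (c, h(r := b))"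
      using runs_Seq[OF 1 runs_Seq[OF 2 runs_Seq[OF 3 4]]] True by (simp only: ev.simps if_True)
    moreover have "v \<le> poly va s" unfolding v_def using va[OF s] .
    ultimately show ?thesis unfolding b_def
      by (auto elim!: runs_mono)
  next
    case False
    have "h(r := 0) = h" using rd k by (auto simp: ready_def)
    with False show ?thesis using rd
      by (auto simp: skip_def ready_def intro!: runs_mono[OF runs_moves])
  qed
qed

lemma ev_time_Add:
  assumes pa: "ev_time n a pa" and pb: "ev_time n b pb"
    and vb: "\<And>xs vs s. small s xs vs \<Longrightarrow> eval xs vs b \<le> poly vb s"
  shows "ev_time n (EAdd a b)
    (pa + pb + [:2:] * vb + [:1:])"
proof (rule ev_timeI)
  fix k xs env vs r c h and s :: nat
  assume rd: "ready k n xs env vs r (c, h)" and s: "small s xs vs" and k: "r + need (EAdd a b) \<le> k"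
  define x y where "x = eval xs vs a" and "y = eval xs vs b"
  have e: "counters n k c" "h (Suc r) = 0" "n < r"
    using rd k by (auto simp: ready_def)
  have 1: "runs k (ev n env r a) (c, h) (poly pa s) (c, h(r := int x))"
    unfolding x_def by (rule ev_timeD[OF pa rd s]) (use k in auto)
  have 2: "runs k (ev n env (r + 1) b) (c, h(r := int x)) (poly pb s) (c, h(r := int x, r + 1 := int y))"
    unfolding y_def by (rule ev_timeD[OF pb ready_up[OF rd] s]) (use rd k in \<open>auto simp: ready_def\<close>)
  have 3: "runs k (drain (r + 1) {} {r}) (c, h(r := int x, r + 1 := int y)) (2 * y + 1)
    (c, h(r := int (x + y)))"
    by (rule runs_drain) (use e k in \<open>auto simp: shift_def\<close>)
  have "runs k (ev n env r (EAdd a b)) (c, h) (poly pa s + (poly pb s + (2 * y + 1)))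
    (c, h(r := int (x + y)))"
    unfolding ev.simps by (rule runs_Seq[OF 1 runs_Seq[OF 2 3]])
  moreover have "y \<le> poly vb s" unfolding y_def using vb[OF s] .
  ultimately show "runs k (ev n env r (EAdd a b)) (c, h) (poly (pa + pb + [:2:] * vb + [:1:]) s)
    (c, h(r := int (eval xs vs (EAdd a b))))"
    unfolding x_def y_def by (auto elim!: runs_mono)
qed

lemma ev_time_Sub:
  assumes pa: "ev_time n a pa" and pb: "ev_time n b pb"
    and vb: "\<And>xs vs s. small s xs vs \<Longrightarrow> eval xs vs b \<le> poly vb s"
  shows "ev_time n (ESub a b)
    (pa + pb + [:2:] * vb + [:1:])"
proof (rule ev_timeI)
  fix k xs env vs r c h and s :: nat
  assume rd: "ready k n xs env vs r (c, h)" and s: "small s xs vs" and k: "r + need (ESub a b) \<le> k"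
  define x y where "x = eval xs vs a" and "y = eval xs vs b"
  have e: "counters n k c" "h (Suc r) = 0" "n < r"
    using rd k by (auto simp: ready_def)
  have 1: "runs k (ev n env r a) (c, h) (poly pa s) (c, h(r := int x))"
    unfolding x_def by (rule ev_timeD[OF pa rd s]) (use k in auto)
  have 2: "runs k (ev n env (r + 1) b) (c, h(r := int x)) (poly pb s) (c, h(r := int x, r + 1 := int y))"
    unfolding y_def by (rule ev_timeD[OF pb ready_up[OF rd] s]) (use rd k in \<open>auto simp: ready_def\<close>)
  define \<sigma> where "\<sigma> i = (c, h(r := int (x - i), r + 1 := int y - int i))" for i
  let ?m = "\<lambda>ss. shift (if ss ! r = 0 then {r, r + 1} else {r + 1}) {}"
  have 3: "runs k (While (\<lambda>ss. ss ! (r + 1) = 0) (moves ?m)) (\<sigma> 0) (y * (1 + 1) + 1) (\<sigma> y)"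
  proof (rule runs_While)
    show "runs k (moves ?m) (\<sigma> i) 1 (\<sigma> (Suc i))" for i
      unfolding \<sigma>_def by (rule runs_moves) (use e k in \<open>auto simp: shift_def counters_def\<close>)
  qed (use e k in \<open>auto simp: \<sigma>_def counters_def\<close>)
  have 4: "\<sigma> 0 = (c, h(r := int x, r + 1 := int y))" by (simp add: \<sigma>_def)
  have 5: "\<sigma> y = (c, h(r := int (x - y)))" using e by (auto simp: \<sigma>_def fun_eq_iff)
  have "runs k (ev n env r (ESub a b)) (c, h) (poly pa s + (poly pb s + (y * (1 + 1) + 1)))
    (c, h(r := int (x - y)))"
    unfolding ev.simps by (rule runs_Seq[OF 1 runs_Seq[OF 2 3[unfolded 4 5]]])
  moreover have "y \<le> poly vb s" unfolding y_def using vb[OF s] .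
  ultimately show "runs k (ev n env r (ESub a b)) (c, h) (poly (pa + pb + [:2:] * vb + [:1:]) s)
    (c, h(r := int (eval xs vs (ESub a b))))"
    unfolding x_def y_def by (auto elim!: runs_mono)
qed

text \<open>Counter \<open>r + 1\<close> holds the iterations left and \<open>r + 2\<close> the
  index that the body sees. The index is at most the value of \<open>a\<close>, whence the composed
  polynomials in the bound for one round.\<close>

lemma ev_time_Sum:
  assumes pa: "ev_time n a pa" and pb: "ev_time n b pb"
    and va: "\<And>xs vs s. small s xs vs \<Longrightarrow> eval xs vs a \<le> poly va s"
    and vb: "\<And>xs vs s. small s xs vs \<Longrightarrow> eval xs vs b \<le> poly vb s"
  shows "ev_time n (ESum a b)
    (pa + va * ((pcompose pb ([:0, 1:] + va) + [:2:] * pcompose vb ([:0, 1:] + va) + [:3:]) + [:2:]) + [:2:] * va + [:3:])"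
proof (rule ev_timeI)
  let ?q = "[:0, 1:] + va"
  let ?B = "pcompose pb ?q + [:2:] * pcompose vb ?q + [:3:]"
  fix k xs env vs r c h and s :: nat
  assume rd: "ready k n xs env vs r (c, h)" and s: "small s xs vs" and k: "r + need (ESum a b) \<le> k"
  define N where "N = eval xs vs a"
  define f where "f i = eval xs (i # vs) b" for i
  have N: "N \<le> poly va s" unfolding N_def using va[OF s] .
  have e: "counters n k c" "h r = 0" "h (Suc r) = 0" "h (Suc (Suc r)) = 0" "h (r + 3) = 0" "n < r"
    using rd k by (auto simp: ready_def)
  have 1: "runs k (ev n env (r + 1) a) (c, h) (poly pa s) (c, h(r + 1 := int N))"
    unfolding N_def by (rule ev_timeD[OF pa ready_up[OF rd] s]) (use rd k in \<open>auto simp: ready_def\<close>)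
  define \<sigma> where "\<sigma> i = (c, h(r := int (\<Sum>j<i. f j), r + 1 := int N - int i, r + 2 := int i))" for i
  let ?body = "ev n ((r + 2) # env) (r + 3) b ;; drain (r + 3) {} {r} ;; moves (\<lambda>_. shift {r + 1} {r + 2})"
  have 2: "runs k (While (\<lambda>ss. ss ! (r + 1) = 0) ?body) (\<sigma> 0) (N * (poly ?B s + 1) + 1) (\<sigma> N)"
  proof (rule runs_While)
    fix i assume i: "i < N"
    show "scan k (\<sigma> i) ! (r + 1) = 0"
      using i e k by (auto simp: \<sigma>_def counters_def)
    have s': "small (s + poly va s) xs (i # vs)"
      using s N i by (force simp: small_def)
    have b1: "runs k (ev n ((r + 2) # env) (r + 3) b) (\<sigma> i) (poly pb (s + poly va s))
      (c, (snd (\<sigma> i))(r + 3 := int (f i)))"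
      unfolding f_def \<sigma>_def snd_conv
    proof (rule ev_timeD[OF pb _ s'])
      show "ready k n xs ((r + 2) # env) (i # vs) (r + 3)
         (c, h(r := int (\<Sum>j<i. eval xs (j # vs) b), r + 1 := int N - int i, r + 2 := int i))"
        unfolding ready_def
      proof (intro conjI allI impI)
        fix l assume "l < length (i # vs)"
        then show "n < ((r + 2) # env) ! l" "((r + 2) # env) ! l < r + 3"
          "snd (c, h(r := int (\<Sum>j<i. eval xs (j # vs) b), r + 1 := int N - int i, r + 2 := int i))
            (((r + 2) # env) ! l) = int ((i # vs) ! l)"
          using rd by (cases l; force simp: ready_def)+
      qed (use rd in \<open>auto simp: ready_def\<close>)
    qed (use k in auto)
    have b2: "runs k (drain (r + 3) {} {r}) (c, (snd (\<sigma> i))(r + 3 := int (f i))) (2 * f i + 1)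
      (c, (snd (\<sigma> i))(r := int (\<Sum>j<Suc i. f j)))"
      by (rule runs_drain) (use e k in \<open>auto simp: shift_def \<sigma>_def\<close>)
    have b3: "runs k (moves (\<lambda>_. shift {r + 1} {r + 2})) (c, (snd (\<sigma> i))(r := int (\<Sum>j<Suc i. f j))) 1 (\<sigma> (Suc i))"
      unfolding \<sigma>_def by (rule runs_moves) (use e k in \<open>auto simp: shift_def \<sigma>_def\<close>)
    have "runs k ?body (\<sigma> i) (poly pb (s + poly va s) + ((2 * f i + 1) + 1)) (\<sigma> (Suc i))"
      by (rule runs_Seq[OF b1 runs_Seq[OF b2 b3]])
    moreover have "f i \<le> poly vb (s + poly va s)"
      unfolding f_def by (rule vb[OF s'])
    ultimately show "runs k ?body (\<sigma> i) (poly ?B s) (\<sigma> (Suc i))"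
      by (auto elim!: runs_mono simp: poly_pcompose)
  next
    show "\<not> scan k (\<sigma> N) ! (r + 1) = 0"
      using e k by (auto simp: \<sigma>_def counters_def)
  qed
  have 3: "\<sigma> 0 = (c, h(r + 1 := int N))" using e by (auto simp: \<sigma>_def fun_eq_iff)
  have 4: "runs k (drain (r + 2) {} {}) (\<sigma> N) (2 * N + 1) (c, h(r := int (\<Sum>j<N. f j)))"
    unfolding \<sigma>_def by (rule runs_drain) (use e k in \<open>auto simp: shift_def\<close>)
  have "runs k (ev n env r (ESum a b)) (c, h)
    (poly pa s + ((N * (poly ?B s + 1) + 1) + (2 * N + 1))) (c, h(r := int (\<Sum>j<N. f j)))"
    unfolding ev.simps by (intro runs_Seq[OF 1] runs_Seq[OF 2[unfolded 3]] 4)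
  moreover have "N * (poly ?B s + 1) \<le> poly va s * (poly ?B s + 2)"
    using N by (intro mult_mono) auto
  ultimately show "runs k (ev n env r (ESum a b)) (c, h)
    (poly (pa + va * (?B + [:2:]) + [:2:] * va + [:3:]) s)
    (c, h(r := int (eval xs vs (ESum a b))))"
    unfolding N_def f_def using N[unfolded N_def] by (auto elim!: runs_mono)
qed

lemma ev_time: "\<exists>p. ev_time n e p"
proof (induction e)
  case (EBit w a)
  then show ?case using ev_time_Bit eval_bound[of a] by meson
next
  case (EAdd a b)
  then show ?case using ev_time_Add eval_bound[of b] by meson
next
  case (ESub a b)
  then show ?case using ev_time_Sub eval_bound[of b] by meson
next
  case (ESum a b)
  then show ?case using ev_time_Sum eval_bound[of a] eval_bound[of b] by meson
qed (use ev_time_V ev_time_C ev_time_Len in blast)+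

section \<open>Writing a word bit by bit\<close>

definition compute :: "nat \<Rightarrow> ex \<Rightarrow> ex \<Rightarrow> cmd" where
  "compute n l b =
     Do (\<lambda>ss j. (if n < j then 1 else ss ! j, MoveStay)) ;;
     ev n [] (n + 1) l ;;
     While (\<lambda>ss. ss ! (n + 1) = 0)
       (ev n [n + 2] (n + 3) b ;;
        Do (\<lambda>ss j. if j = n then (if ss ! (n + 3) = 0 then 2 else 1, MoveRight) else (ss ! j, MoveStay)) ;;
        drain (n + 3) {} {} ;;
        moves (\<lambda>_. shift {n + 1} {n + 2}))"

lemma wf_compute [simp]: "wf_cmd (compute n l b)"
  by (auto simp: compute_def subset_iff)

lemma runs_Do: "act k (f (scan k s)) s = s' \<Longrightarrow> 1 \<le> B \<Longrightarrow> runs k (Do f) s B s'"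
  unfolding runs_def using exec.Do by blast

theorem poly_time_ex:
  "poly_time_function n (\<lambda>xs. map (\<lambda>i. eval xs [i] b \<noteq> 0) [0..<eval xs [] l])"
proof -
  obtain pl pb where pl: "ev_time n l pl" and pb: "ev_time n b pb"
    using ev_time by meson
  obtain vl where vl: "\<And>xs vs s. small s xs vs \<Longrightarrow> eval xs vs l \<le> poly vl s"
    using eval_bound by blast
  obtain vb where vb: "\<And>xs vs s. small s xs vs \<Longrightarrow> eval xs vs b \<le> poly vb s"
    using eval_bound by blast
  define k where "k = n + 4 + need l + need b"
  have k: "n + 3 < k" "n + 1 + need l \<le> k" "n + 3 + need b \<le> k"
    by (auto simp: k_def)
  let ?q = "[:0, 1:] + vl"
  let ?B = "pcompose pb ?q + [:2:] * pcompose vb ?q + [:3:]"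
  let ?T = "[:2:] + pl + vl * (?B + [:1:])"
  show ?thesis
    unfolding poly_time_function_def
  proof (intro exI[of _ "tm_of k (compute n l b)"] exI[of _ ?T] conjI allI impI)
    show "turing_machine (tm_of k (compute n l b))" by (simp add: turing_machine_tm_of)
    show "n < tm_tapes (tm_of k (compute n l b))" using k by (simp add: tm_of_def)
    fix xs :: "bool list list" assume xs: "length xs = n"
    define s where "s = (\<Sum>x\<leftarrow>xs. length x)"
    define L where "L = eval xs [] l"
    define f where "f i = eval xs [i] b" for i
    define c0 where "c0 = (\<lambda>j. tape_of (if j < length xs then xs ! j else []))"
    define c1 where "c1 = (\<lambda>j. if n < j \<and> j < k then (c0 j)(0 := 1) else c0 j)"
    define out :: "nat \<Rightarrow> int \<Rightarrow> nat" where
      "out i = (\<lambda>p. if 0 \<le> p \<and> p < int i then (if f (nat p) \<noteq> 0 then 2 else 1) else 0)" for i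
    define h where "h i = ((\<lambda>_. 0)(n := int i, n + 1 := int L - int i, n + 2 := int i))" for i
    define \<sigma> where "\<sigma> i = (c1(n := out i), h i)" for i
    have s: "small s xs []"
      by (auto simp: small_def s_def member_le_sum_list)
    have L: "L \<le> poly vl s" unfolding L_def by (rule vl[OF s])
    have cnt: "counters n k (c1(n := out i))" for i
      by (auto simp: counters_def c1_def c0_def tape_of_def xs)
    have inp: "(c1(n := out i)) w = tape_of (xs ! w)" if "w < n" for i w
      using that by (auto simp: c1_def c0_def xs)
    have out0: "c1(n := out 0) = c1"
      by (auto simp: fun_eq_iff c1_def c0_def xs out_def tape_of_def)
    have 1: "runs k (Do (\<lambda>ss j. (if n < j then 1 else ss ! j, MoveStay))) (c0, \<lambda>_. 0) 1
      (c1(n := out 0), \<lambda>_. 0)"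
      unfolding out0 by (rule runs_Do) (auto simp: act_def c1_def fun_eq_iff)
    have "runs k (ev n [] (n + 1) l) (c1(n := out 0), \<lambda>_. 0) (poly pl s)
      (c1(n := out 0), (\<lambda>_. 0)(n + 1 := int L))"
      unfolding L_def
      by (rule ev_timeD[OF pl _ s]) (use cnt[of 0] inp[of _ 0] xs k in \<open>auto simp: ready_def\<close>)
    moreover have "(c1(n := out 0), (\<lambda>_. 0)(n + 1 := int L)) = \<sigma> 0"
      by (auto simp: \<sigma>_def h_def fun_eq_iff)
    ultimately have 2: "runs k (ev n [] (n + 1) l) (c1(n := out 0), \<lambda>_. 0) (poly pl s) (\<sigma> 0)"
      by (simp only:)
    let ?write = "\<lambda>ss j. if j = n then (if ss ! (n + 3) = 0 then 2 else 1, MoveRight) else (ss ! j, MoveStay)"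
    let ?body = "ev n [n + 2] (n + 3) b ;; Do ?write ;; drain (n + 3) {} {} ;;
      moves (\<lambda>_. shift {n + 1} {n + 2})"
    have 3: "runs k (While (\<lambda>ss. ss ! (n + 1) = 0) ?body) (\<sigma> 0) (L * (poly ?B s + 1) + 1) (\<sigma> L)"
    proof (rule runs_While)
      fix i assume i: "i < L"
      have "(c1(n := out i)) (n + 1) (h i (n + 1)) = 0"
        using cnt[of i] i k by (simp add: counters_def h_def)
      then show "scan k (\<sigma> i) ! (n + 1) = 0"
        using k by (simp add: \<sigma>_def)
      have s': "small (s + poly vl s) xs [i]"
        using s L i by (force simp: small_def)
      have b1: "runs k (ev n [n + 2] (n + 3) b) (\<sigma> i) (poly pb (s + poly vl s))
        (c1(n := out i), (h i)(n + 3 := int (f i)))"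
        unfolding f_def \<sigma>_def
        by (rule ev_timeD[OF pb _ s']) (use cnt[of i] inp[of _ i] xs k in \<open>auto simp: ready_def h_def\<close>)
      \<comment> \<open>A nonzero counter stands on a blank. This is why \<open>compute\<close>
        writes symbol 2, the bit 1, when it scans 0 on tape \<open>n + 3\<close>.\<close>
      have z: "(c1(n := out i)) (n + 3) (int (f i)) = (if f i = 0 then 1 else 0)"
        using cnt[of i] k by (simp add: counters_def)
      have b2: "runs k (Do ?write) (c1(n := out i), (h i)(n + 3 := int (f i))) 1
        (c1(n := out (Suc i)), (h i)(n := int (Suc i), n + 3 := int (f i)))"
      proof (rule runs_Do)
        let ?ss = "scan k (c1(n := out i), (h i)(n + 3 := int (f i)))"
        have "?ss ! (n + 3) = (if f i = 0 then 1 else 0)"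
          using z k by simp
        then show "act k (?write ?ss) (c1(n := out i), (h i)(n + 3 := int (f i))) =
          (c1(n := out (Suc i)), (h i)(n := int (Suc i), n + 3 := int (f i)))"
          using k by (auto simp: act_def fun_eq_iff h_def out_def)
      qed simp
      have b3: "runs k (drain (n + 3) {} {})
        (c1(n := out (Suc i)), (h i)(n := int (Suc i), n + 3 := int (f i))) (2 * f i + 1)
        (c1(n := out (Suc i)), (h i)(n := int (Suc i)))"
        by (rule runs_drain[OF cnt]) (use k in \<open>auto simp: shift_def h_def\<close>)
      have b4: "runs k (moves (\<lambda>_. shift {n + 1} {n + 2}))
        (c1(n := out (Suc i)), (h i)(n := int (Suc i))) 1 (\<sigma> (Suc i))"
        unfolding \<sigma>_def by (rule runs_moves) (use k in \<open>auto simp: shift_def h_def\<close>)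
      have "f i \<le> poly vb (s + poly vl s)"
        unfolding f_def by (rule vb[OF s'])
      then have "poly pb (s + poly vl s) + (1 + (2 * f i + 1 + 1)) \<le> poly ?B s"
        by (simp add: poly_pcompose)
      with runs_Seq[OF b1 runs_Seq[OF b2 runs_Seq[OF b3 b4]]]
      show "runs k ?body (\<sigma> i) (poly ?B s) (\<sigma> (Suc i))" by (rule runs_mono)
    next
      have "(c1(n := out L)) (n + 1) (h L (n + 1)) \<noteq> 0"
        using cnt[of L] k by (simp add: counters_def h_def)
      then show "\<not> scan k (\<sigma> L) ! (n + 1) = 0"
        using k by (simp add: \<sigma>_def)
    qed
    have "runs k (compute n l b) (c0, \<lambda>_. 0) (1 + (poly pl s + (L * (poly ?B s + 1) + 1))) (\<sigma> L)"
      unfolding compute_def by (rule runs_Seq[OF 1 runs_Seq[OF 2 3]])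
    then obtain t where t: "t \<le> 1 + (poly pl s + (L * (poly ?B s + 1) + 1))"
      "exec k (compute n l b) (c0, \<lambda>_. 0) t (\<sigma> L)"
      unfolding runs_def by blast
    note t(1)
    also have "1 + (poly pl s + (L * (poly ?B s + 1) + 1)) \<le>
      1 + (poly pl s + (poly vl s * (poly ?B s + 1) + 1))"
      using L by (intro add_mono mult_mono order_refl) auto
    also have "\<dots> = poly ?T s" by simp
    finally have "t \<le> poly ?T s" .
    then show "computes_within (tm_of k (compute n l b)) xs (map (\<lambda>i. eval xs [i] b \<noteq> 0) [0..<eval xs [] l])
      (poly ?T (\<Sum>x\<leftarrow>xs. length x))"
      unfolding s_def
      by (rule exec_computes[OF t(2)[unfolded c0_def]])
        (auto simp: \<sigma>_def xs out_def tape_of_def f_def L_def)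
  qed
qed

section \<open>Definable functions\<close>

type_synonym env = "bool list list \<times> nat list"

text \<open>Functions of the environment replace the syntax of expressions: the introduction rules
  follow the shape of a HOL term, so that definitions need not be translated into \<open>ex\<close>
  by hand.\<close>

definition dfn :: "(env \<Rightarrow> nat) \<Rightarrow> bool" where
  "dfn f \<longleftrightarrow> (\<exists>e. \<forall>xs vs. eval xs vs e = f (xs, vs))"

definition dfnp :: "(env \<Rightarrow> bool) \<Rightarrow> bool" where
  "dfnp P \<longleftrightarrow> dfn (\<lambda>E. of_bool (P E))"

definition wd :: "nat \<Rightarrow> env \<Rightarrow> bool list" where
  "wd w E = (if w < length (fst E) then fst E ! w else [])"

text \<open>The value 0 for an empty environment agrees with what \<open>eval\<close> assigns to an
  unbound variable. A bound variable appears in the rules as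
  \<open>g (tle E) (hde E)\<close>.\<close>

definition hde :: "env \<Rightarrow> nat" where
  "hde E = (if snd E = [] then 0 else hd (snd E))"

definition tle :: "env \<Rightarrow> env" where
  "tle E = (fst E, tl (snd E))"

fun lift :: "nat \<Rightarrow> ex \<Rightarrow> ex" where
  "lift d (EVar i) = (if i < d then EVar i else EVar (Suc i))"
| "lift d (EConst c) = EConst c"
| "lift d (ELen w) = ELen w"
| "lift d (EBit w a) = EBit w (lift d a)"
| "lift d (EAdd a b) = EAdd (lift d a) (lift d b)"
| "lift d (ESub a b) = ESub (lift d a) (lift d b)"
| "lift d (ESum a b) = ESum (lift d a) (lift (Suc d) b)"

lemma eval_lift: "eval xs (us @ y # vs) (lift (length us) e) = eval xs (us @ vs) e"
proof (induction e arbitrary: us)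
  case (ESum a b)
  have "eval xs (i # us @ y # vs) (lift (Suc (length us)) b) = eval xs (i # us @ vs) b" for i
    using ESum.IH(2)[of "i # us"] by simp
  with ESum.IH(1) show ?case by simp
qed (auto simp: nth_append Suc_diff_le)

lemma wd_tle [simp]: "wd w (tle E) = wd w E"
  by (simp add: wd_def tle_def)

text \<open>Covers the empty environment, from which \<open>tle\<close> removes nothing: shifted
  variables stay out of range and still evaluate to 0.\<close>

lemma eval_lift_end: "eval xs us (lift (length us) e) = eval xs us e"
proof (induction e arbitrary: us)
  case (ESum a b)
  have "eval xs (i # us) (lift (Suc (length us)) b) = eval xs (i # us) b" for i
    using ESum.IH(2)[of "i # us"] by simp
  with ESum.IH(1) show ?case by simp
qed auto

named_theorems dfn_intros

lemma dfn_tle: assumes "dfn f" shows "dfn (\<lambda>E. f (tle E))"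
proof -
  obtain e where e: "\<And>xs vs. eval xs vs e = f (xs, vs)" using assms dfn_def by auto
  show ?thesis unfolding dfn_def
  proof (intro exI[of _ "lift 0 e"] allI)
    fix xs vs show "eval xs vs (lift 0 e) = f (tle (xs, vs))"
      using eval_lift[of xs "[]" _ _ e] eval_lift_end[of xs "[]" e]
      by (cases vs) (auto simp: tle_def e)
  qed
qed

lemma dfn_hde: "dfn hde"
  unfolding dfn_def by (rule exI[of _ "EVar 0"]) (auto simp: hde_def hd_conv_nth)

lemmas dfn_hde_tle [dfn_intros] =
  dfn_hde dfn_tle[OF dfn_hde] dfn_tle[OF dfn_tle[OF dfn_hde]]
  dfn_tle[OF dfn_tle[OF dfn_tle[OF dfn_hde]]]
  dfn_tle[OF dfn_tle[OF dfn_tle[OF dfn_tle[OF dfn_hde]]]]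
  dfn_tle[OF dfn_tle[OF dfn_tle[OF dfn_tle[OF dfn_tle[OF dfn_hde]]]]]

lemma dfn_const [dfn_intros]: "dfn (\<lambda>_. c)"
  unfolding dfn_def by (rule exI[of _ "EConst c"]) auto

lemma dfn_length [dfn_intros]: "dfn (\<lambda>E. length (wd w E))"
  unfolding dfn_def by (rule exI[of _ "ELen w"]) (auto simp: wd_def)

lemma dfn_add [dfn_intros]: assumes "dfn f" "dfn g" shows "dfn (\<lambda>E. f E + g E)"
proof -
  from assms obtain a b where "\<forall>xs vs. eval xs vs a = f (xs, vs)" "\<forall>xs vs. eval xs vs b = g (xs, vs)"
    by (auto simp: dfn_def)
  then show ?thesis unfolding dfn_def by (intro exI[of _ "EAdd a b"]) auto
qed

lemma dfn_sub [dfn_intros]: assumes "dfn f" "dfn g" shows "dfn (\<lambda>E. f E - g E)"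
proof -
  from assms obtain a b where "\<forall>xs vs. eval xs vs a = f (xs, vs)" "\<forall>xs vs. eval xs vs b = g (xs, vs)"
    by (auto simp: dfn_def)
  then show ?thesis unfolding dfn_def by (intro exI[of _ "ESub a b"]) auto
qed

lemma dfn_sum [dfn_intros]:
  assumes "dfn f" "dfn (\<lambda>E. g (tle E) (hde E))"
  shows "dfn (\<lambda>E. \<Sum>i<f E. g E i)"
proof -
  from assms obtain a b where a: "\<And>xs vs. eval xs vs a = f (xs, vs)"
    and b: "\<And>xs vs. eval xs vs b = g (tle (xs, vs)) (hde (xs, vs))"
    by (auto simp: dfn_def)
  show ?thesis unfolding dfn_def
    by (intro exI[of _ "ESum a b"] allI) (auto simp: a b tle_def hde_def)
qed

lemma dfn_Suc [dfn_intros]: "dfn f \<Longrightarrow> dfn (\<lambda>E. Suc (f E))"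
  using dfn_add[of f "\<lambda>_. 1"] dfn_const by simp

lemma dfn_mult [dfn_intros]: assumes "dfn f" "dfn g" shows "dfn (\<lambda>E. f E * g E)"
  using dfn_sum[OF assms(1), of "\<lambda>E _. g E"] dfn_tle[OF assms(2)] by simp

definition bit_at :: "bool list \<Rightarrow> nat \<Rightarrow> bool" where
  "bit_at x i \<longleftrightarrow> i < length x \<and> x ! i"

lemma dfnp_bit [dfn_intros]: assumes "dfn f" shows "dfnp (\<lambda>E. bit_at (wd w E) (f E))"
proof -
  from assms obtain a where "\<forall>xs vs. eval xs vs a = f (xs, vs)"
    by (auto simp: dfn_def)
  then show ?thesis unfolding dfnp_def dfn_def
    by (intro exI[of _ "EBit w a"]) (auto simp: wd_def bit_at_def)
qed

lemma dfnpI: assumes "dfn f" "\<And>E. f E = of_bool (P E)" shows "dfnp P"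
proof -
  have "f = (\<lambda>E. of_bool (P E))" using assms(2) by auto
  with assms(1) show ?thesis by (simp add: dfnp_def)
qed

lemma dfn_of_bool [dfn_intros]: "dfnp P \<Longrightarrow> dfn (\<lambda>E. of_bool (P E))"
  by (simp add: dfnp_def)

lemma dfnp_not [dfn_intros]: "dfnp P \<Longrightarrow> dfnp (\<lambda>E. \<not> P E)"
  by (rule dfnpI[of "\<lambda>E. 1 - of_bool (P E)"]) (auto intro!: dfn_intros)

lemma dfnp_conj [dfn_intros]: "dfnp P \<Longrightarrow> dfnp Q \<Longrightarrow> dfnp (\<lambda>E. P E \<and> Q E)"
  by (rule dfnpI[of "\<lambda>E. of_bool (P E) * of_bool (Q E)"]) (auto intro!: dfn_intros)

lemma dfnp_disj [dfn_intros]: "dfnp P \<Longrightarrow> dfnp Q \<Longrightarrow> dfnp (\<lambda>E. P E \<or> Q E)"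
  using dfnp_not[OF dfnp_conj[OF dfnp_not dfnp_not], of P Q] by simp

lemma dfnp_imp [dfn_intros]: "dfnp P \<Longrightarrow> dfnp Q \<Longrightarrow> dfnp (\<lambda>E. P E \<longrightarrow> Q E)"
  unfolding imp_conv_disj by (intro dfn_intros)

lemma dfnp_le [dfn_intros]: "dfn f \<Longrightarrow> dfn g \<Longrightarrow> dfnp (\<lambda>E. f E \<le> g E)"
  by (rule dfnpI[of "\<lambda>E. 1 - (f E - g E)"]) (auto intro!: dfn_intros)

lemma dfnp_less [dfn_intros]: "dfn f \<Longrightarrow> dfn g \<Longrightarrow> dfnp (\<lambda>E. f E < g E)"
  using dfnp_le[OF dfn_Suc, of f g] by (simp add: Suc_le_eq)

lemma dfnp_eq [dfn_intros]: "dfn f \<Longrightarrow> dfn g \<Longrightarrow> dfnp (\<lambda>E. f E = g E)"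
  using dfnp_conj[OF dfnp_le dfnp_le, of f g g f] by (simp add: eq_iff)

lemma dfnp_const [dfn_intros]: "dfnp (\<lambda>_. P)"
  unfolding dfnp_def by (rule dfn_const)

lemma dfnp_iff [dfn_intros]: "dfnp P \<Longrightarrow> dfnp Q \<Longrightarrow> dfnp (\<lambda>E. P E \<longleftrightarrow> Q E)"
  using dfnp_conj[OF dfnp_imp dfnp_imp, of P Q Q P] by (simp add: iff_conv_conj_imp)

lemma dfn_if [dfn_intros]:
  assumes "dfnp P" "dfn f" "dfn g" shows "dfn (\<lambda>E. if P E then f E else g E)"
proof -
  have "dfn (\<lambda>E. of_bool (P E) * f E + of_bool (\<not> P E) * g E)"
    by (intro dfn_intros assms)
  moreover have "of_bool (P E) * f E + of_bool (\<not> P E) * g E = (if P E then f E else g E)" for E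
    by simp
  ultimately show ?thesis by (simp only:)
qed

lemma dfnp_if [dfn_intros]:
  "dfnp P \<Longrightarrow> dfnp Q \<Longrightarrow> dfnp R \<Longrightarrow> dfnp (\<lambda>E. if P E then Q E else R E)"
  unfolding if_bool_eq_conj by (intro dfn_intros)

lemma dfnp_bex [dfn_intros]:
  assumes "dfn f" "dfnp (\<lambda>E. P (tle E) (hde E))"
  shows "dfnp (\<lambda>E. \<exists>i<f E. P E i)"
proof -
  have "dfnp (\<lambda>E. 0 < (\<Sum>i<f E. of_bool (P E i) :: nat))"
    using assms by (intro dfn_intros)
  moreover have "(0 < (\<Sum>i<f E. of_bool (P E i) :: nat)) = (\<exists>i<f E. P E i)" for E
    by (auto simp: zero_less_iff_neq_zero)
  ultimately show ?thesis by simp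
qed

lemma dfnp_ball [dfn_intros]:
  assumes "dfn f" "dfnp (\<lambda>E. P (tle E) (hde E))"
  shows "dfnp (\<lambda>E. \<forall>i<f E. P E i)"
  using dfnp_not[OF dfnp_bex[OF assms(1) dfnp_not[OF assms(2)]]] by simp

lemma dfn_tle2: "dfn f \<Longrightarrow> dfn (\<lambda>E. f (tle (tle E)))"
  by (rule dfn_tle[OF dfn_tle])

lemma count_eq: "(\<Sum>i<n. of_bool (P i)) = card {i. i < n \<and> P i}" for n :: nat
  by (simp add: of_bool_def sum.If_cases lessThan_def Collect_conj_eq)

text \<open>The quotient counts the positive multiples of \<open>b\<close> up to \<open>a\<close>;
  the test \<open>0 < b\<close> accounts for division by zero giving 0.\<close>

lemma nat_div_eq_sum: "a div b = (\<Sum>q<a. of_bool (0 < b \<and> Suc q * b \<le> a))" for a b :: nat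
proof (cases "b = 0")
  case False
  have "(\<Sum>q<a. of_bool (0 < b \<and> Suc q * b \<le> a)) = card {q. q < a \<and> Suc q * b \<le> a}"
    using False by (simp add: count_eq del: sum_of_bool_eq)
  also have "{q. q < a \<and> Suc q * b \<le> a} = {..<a div b}"
  proof -
    have "q < a" if "q < a div b" for q
      using that by (metis div_le_dividend less_le_trans)
    moreover have "Suc q * b \<le> a \<longleftrightarrow> q < a div b" for q
      using False less_eq_div_iff_mult_less_eq[of b "Suc q" a] by (simp add: Suc_le_eq)
    ultimately show ?thesis by blast
  qed
  finally show ?thesis by simp
qed auto

lemma dfn_div [dfn_intros]: assumes "dfn f" "dfn g" shows "dfn (\<lambda>E. f E div g E)"
  unfolding nat_div_eq_sum
  by (intro dfn_intros dfn_tle[OF assms(1)] dfn_tle[OF assms(2)] assms)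

lemma dfn_mod [dfn_intros]: assumes "dfn f" "dfn g" shows "dfn (\<lambda>E. f E mod g E)"
  unfolding modulo_nat_def by (intro dfn_intros assms)

lemma dfnp_odd [dfn_intros]: assumes "dfn f" shows "dfnp (\<lambda>E. odd (f E))"
  unfolding odd_iff_mod_2_eq_one by (intro dfn_intros assms)

lemma dfn_poly [dfn_intros]: assumes "dfn f" shows "dfn (\<lambda>E. poly p (f E))"
proof (induction p)
  case (pCons a p)
  then show ?case unfolding poly_pCons by (intro dfn_intros assms)
qed (simp add: dfn_const)

text \<open>Functions about which nothing is known enter as finite tables, that is, as nested
  conditionals. The transition function of a machine becomes definable in this way.\<close>

lemma dfn_table:
  assumes "dfn f" shows "dfn (\<lambda>E. if f E < N then F (f E) else 0)"
proof (induction N)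
  case (Suc N)
  have "dfn (\<lambda>E. if f E = N then F N else if f E < N then F (f E) else 0)"
    by (intro dfn_intros Suc assms)
  moreover have "(if x = N then F N else if x < N then F x else 0) = (if x < Suc N then F x else 0)" for x
    by auto
  ultimately show ?case by simp
qed (simp add: dfn_const)

theorem poly_time_dfn:
  assumes "dfn f" "dfnp (\<lambda>E. P (tle E) (hde E))"
  shows "poly_time_function n (\<lambda>xs. map (P (xs, [])) [0..<f (xs, [])])"
proof -
  from assms obtain a b where a: "\<And>xs vs. eval xs vs a = f (xs, vs)"
    and b: "\<And>xs vs. eval xs vs b = of_bool (P (tle (xs, vs)) (hde (xs, vs)))"
    by (auto simp: dfn_def dfnp_def)
  show ?thesis
    using poly_time_ex[of n b a] by (simp add: a b tle_def hde_def cong: map_cong)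
qed

section \<open>Consecutive ones by keys with ties\<close>

definition c1p :: "nat \<Rightarrow> nat \<Rightarrow> (nat \<Rightarrow> nat \<Rightarrow> bool) \<Rightarrow> bool" where
  "c1p R C P \<longleftrightarrow> (\<exists>\<pi>. \<pi> permutes {..<C} \<and>
     (\<forall>i<R. \<exists>a b. {j. j < C \<and> P i (\<pi> j)} = {a..<b}))"

lemma SC1P_c1p:
  "SC1P A \<longleftrightarrow> c1p (dim_row A) (dim_col A) (\<lambda>i j. A $$ (i, j)) \<and>
              c1p (dim_col A) (dim_row A) (\<lambda>j i. A $$ (i, j))"
  by (simp add: SC1P_def C1P_rows_def C1P_cols_def c1p_def)

text \<open>The inverse permutation yields the position of each column as its key. Interval ends are
  kept at most \<open>C\<close>, with \<open>0..<0\<close> for an empty row, so that certificates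
  store small numbers only.\<close>

lemma c1p_keysD:
  assumes "c1p R C P"
  shows "\<exists>p a b. inj_on p {..<C} \<and> (\<forall>j<C. p j < C) \<and> (\<forall>i<R. a i \<le> C \<and> b i \<le> C) \<and>
    (\<forall>i<R. \<forall>j<C. P i j \<longleftrightarrow> a i \<le> p j \<and> p j < b i)"
proof -
  from assms obtain \<pi> where \<pi>: "\<pi> permutes {..<C}"
    and ex: "\<And>i. i < R \<Longrightarrow> \<exists>a b. {j. j < C \<and> P i (\<pi> j)} = {a..<b}"
    unfolding c1p_def by blast
  have "\<exists>a b. a \<le> C \<and> b \<le> C \<and> {j. j < C \<and> P i (\<pi> j)} = {a..<b}" if i: "i < R" for i
  proof -
    from ex[OF i] obtain a b where ab: "{j. j < C \<and> P i (\<pi> j)} = {a..<b}" by blast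
    show ?thesis
    proof (cases "a < b")
      case True
      then have "b - 1 \<in> {j. j < C \<and> P i (\<pi> j)}" unfolding ab by auto
      with True have "a \<le> C" "b \<le> C" by auto
      with ab show ?thesis by blast
    next
      case False
      with ab have "{j. j < C \<and> P i (\<pi> j)} = {0..<0}" by auto
      then show ?thesis by blast
    qed
  qed
  then obtain a b where ab: "\<And>i. i < R \<Longrightarrow> a i \<le> C \<and> b i \<le> C \<and> {j. j < C \<and> P i (\<pi> j)} = {a i..<b i}"
    by metis
  have inv: "inv_into UNIV \<pi> permutes {..<C}" by (rule permutes_inv[OF \<pi>])
  show ?thesis
  proof (rule exI[of _ "inv_into UNIV \<pi>"], rule exI[of _ a], rule exI[of _ b], intro conjI allI impI)
    show "inj_on (inv_into UNIV \<pi>) {..<C}" using inv by (rule permutes_inj_on)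
    show "inv_into UNIV \<pi> j < C" if "j < C" for j using permutes_in_image[OF inv, of j] that by simp
    show "a i \<le> C" "b i \<le> C" if "i < R" for i using ab[OF that] by blast+
    show "P i j \<longleftrightarrow> a i \<le> inv_into UNIV \<pi> j \<and> inv_into UNIV \<pi> j < b i" if "i < R" "j < C" for i j
    proof -
      have "inv_into UNIV \<pi> j < C" using permutes_in_image[OF inv, of j] that by simp
      moreover have "\<pi> (inv_into UNIV \<pi> j) = j" using permutes_inverses(1)[OF \<pi>] .
      ultimately have "P i j \<longleftrightarrow> inv_into UNIV \<pi> j \<in> {j. j < C \<and> P i (\<pi> j)}" by simp
      then show ?thesis using ab[OF that(1)] by auto
    qed
  qed
qed

text \<open>After sorting the columns by key, keys are monotone in the position, with ties side by
  side; hence the columns with keys in an interval are consecutive.\<close>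

lemma c1p_keysI:
  fixes p :: "nat \<Rightarrow> nat"
  assumes P: "\<And>i j. i < R \<Longrightarrow> j < C \<Longrightarrow> P i j \<longleftrightarrow> a i \<le> p j \<and> p j < b i"
  shows "c1p R C P"
proof -
  define l where "l = sort_key p [0..<C]"
  have l: "length l = C" "distinct l" "set l = {..<C}" "sorted (map p l)"
    by (auto simp: l_def)
  define \<pi> where "\<pi> j = (if j < C then l ! j else j)" for j
  have bij: "bij_betw (\<lambda>j. l ! j) {..<C} {..<C}"
    by (rule bij_betw_nth[OF l(2)]) (simp_all add: l)
  have "bij_betw \<pi> {..<C} {..<C}"
    using bij by (rule bij_betw_cong[THEN iffD1, rotated]) (simp add: \<pi>_def)
  then have perm: "\<pi> permutes {..<C}"
    by (rule bij_imp_permutes) (simp add: \<pi>_def)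
  have mono: "p (\<pi> j) \<le> p (\<pi> j')" if "j \<le> j'" "j' < C" for j j'
    using sorted_nth_mono[OF l(4), of j j'] that l(1) by (simp add: \<pi>_def)
  have "\<exists>x y. {j. j < C \<and> P i (\<pi> j)} = {x..<y}" if i: "i < R" for i
  proof -
    define S where "S = {j. j < C \<and> P i (\<pi> j)}"
    have S: "S = {j. j < C \<and> a i \<le> p (\<pi> j) \<and> p (\<pi> j) < b i}"
      using P[OF i] permutes_in_image[OF perm] by (auto simp: S_def)
    have fin: "finite S" unfolding S_def by simp
    show ?thesis
    proof (cases "S = {}")
      case True
      then have "S = {0..<0}" by simp
      then show ?thesis unfolding S_def by blast
    next
      case False
      have "S = {Min S..<Suc (Max S)}"
      proof (rule Set.set_eqI)
        fix j show "j \<in> S \<longleftrightarrow> j \<in> {Min S..<Suc (Max S)}"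
        proof
          assume "j \<in> {Min S..<Suc (Max S)}"
          then have j: "Min S \<le> j" "j \<le> Max S" by auto
          have "Min S \<in> S" "Max S \<in> S" using fin False by auto
          then have "Max S < C" "a i \<le> p (\<pi> (Min S))" "p (\<pi> (Max S)) < b i" by (auto simp: S)
          with j mono[OF j(1)] mono[OF j(2)] show "j \<in> S" by (auto simp: S intro: le_less_trans le_trans)
        qed (use fin in \<open>auto simp: less_Suc_eq_le\<close>)
      qed
      then show ?thesis unfolding S_def by blast
    qed
  qed
  with perm show ?thesis unfolding c1p_def by blast
qed

section \<open>From satisfiability to editing\<close>

lemma sum_pairs: "(\<Sum>l<2 * n. f l) = (\<Sum>v<n. f (2 * v) + f (2 * v + 1))" for f :: "nat \<Rightarrow> nat"
  by (induction n) (auto simp: algebra_simps)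

text \<open>
  A CNF formula with variables \<open>v < n\<close> and clauses \<open>c < m\<close>; literal number \<open>2 v\<close> is the variable
  \<open>v\<close> and \<open>2 v + 1\<close> is its negation.
\<close>

definition satisfiable :: "nat \<Rightarrow> nat \<Rightarrow> (nat \<Rightarrow> nat \<Rightarrow> bool) \<Rightarrow> bool" where
  "satisfiable n m lit \<longleftrightarrow>
     (\<exists>\<alpha>. \<forall>c<m. \<exists>v<n. lit (2 * v) c \<and> \<alpha> v \<or> lit (2 * v + 1) c \<and> \<not> \<alpha> v)"

definition occs :: "nat \<Rightarrow> nat \<Rightarrow> (nat \<Rightarrow> nat \<Rightarrow> bool) \<Rightarrow> nat" where
  "occs n m lit = (\<Sum>l<2 * n. \<Sum>c<m. of_bool (lit l c))"

text \<open>More than the \<open>2 * n * m\<close> possible occurrences of literals, so that one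
  unit of weight outweighs all savings on clauses together.\<close>

definition wgt :: "nat \<Rightarrow> nat \<Rightarrow> nat" where
  "wgt n m = 2 * n * m + 1"

definition budget :: "nat \<Rightarrow> nat \<Rightarrow> (nat \<Rightarrow> nat \<Rightarrow> bool) \<Rightarrow> nat" where
  "budget n m lit = n * wgt n m + occs n m lit - m"

text \<open>
  The columns \<open>r * rod + x\<close> with \<open>x < rod\<close> form rod number \<open>r\<close>: its head \<open>x < 2 wgt\<close>, its tail, which
  is too long to be flipped, and the last column. Rod \<open>3 v\<close> belongs to the variable \<open>v\<close> and rod
  \<open>3 v + 1 + s\<close> to the literal \<open>2 v + s\<close>. The remaining columns are the clauses. The first
  \<open>2 n\<close> nr are the literals, all other nr come in so many copies that one of them is not edited.
\<close>

definition body :: "nat \<Rightarrow> nat \<Rightarrow> (nat \<Rightarrow> nat \<Rightarrow> bool) \<Rightarrow> nat" where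
  "body n m lit = 2 * wgt n m + Suc (budget n m lit)"

definition rod :: "nat \<Rightarrow> nat \<Rightarrow> (nat \<Rightarrow> nat \<Rightarrow> bool) \<Rightarrow> nat" where
  "rod n m lit = Suc (body n m lit)"

definition ncols :: "nat \<Rightarrow> nat \<Rightarrow> (nat \<Rightarrow> nat \<Rightarrow> bool) \<Rightarrow> nat" where
  "ncols n m lit = 3 * n * rod n m lit + m"

definition nrows :: "nat \<Rightarrow> nat \<Rightarrow> (nat \<Rightarrow> nat \<Rightarrow> bool) \<Rightarrow> nat" where
  "nrows n m lit = 2 * n + 6 * n * Suc (budget n m lit)"

text \<open>Below the literals, class \<open>(i - 2 * n) div Suc (budget n m lit)\<close> is
  \<open>2 * r\<close> for the rows on head and tail of rod \<open>r\<close>, and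
  \<open>2 * r + 1\<close> for those on its tail and end. Their overlap in the tail fixes the order
  of the three pieces.\<close>

definition entry :: "nat \<Rightarrow> nat \<Rightarrow> (nat \<Rightarrow> nat \<Rightarrow> bool) \<Rightarrow> nat \<Rightarrow> nat \<Rightarrow> bool" where
  "entry n m lit i j =
     (if j < 3 * n * rod n m lit then
        if i < 2 * n then
          j div rod n m lit = 3 * (i div 2) \<and> j mod rod n m lit < 2 * wgt n m \<or>
          j div rod n m lit = 3 * (i div 2) + 1 + i mod 2 \<and> j mod rod n m lit < wgt n m
        else
          j div rod n m lit = (i - 2 * n) div Suc (budget n m lit) div 2 \<and>
          (if even ((i - 2 * n) div Suc (budget n m lit)) then j mod rod n m lit < body n m lit
           else 2 * wgt n m \<le> j mod rod n m lit)
      else i < 2 * n \<and> lit i (j - 3 * n * rod n m lit))"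

definition sat_mat :: "nat \<Rightarrow> nat \<Rightarrow> (nat \<Rightarrow> nat \<Rightarrow> bool) \<Rightarrow> bool mat" where
  "sat_mat n m lit = mat (nrows n m lit) (ncols n m lit) (\<lambda>(i, j). entry n m lit i j)"

locale cnf =
  fixes n m :: nat and lit :: "nat \<Rightarrow> nat \<Rightarrow> bool"
  assumes n_pos: "0 < n"
    and no_taut: "\<And>v c. \<not> (lit (2 * v) c \<and> lit (2 * v + 1) c)"
begin

abbreviation "w \<equiv> wgt n m"
abbreviation "K \<equiv> budget n m lit"
abbreviation "T \<equiv> body n m lit"
abbreviation "N \<equiv> rod n m lit"
abbreviation "nc \<equiv> ncols n m lit"
abbreviation "nr \<equiv> nrows n m lit"
abbreviation "ent \<equiv> entry n m lit"

definition rc :: "nat \<Rightarrow> nat \<Rightarrow> nat" where "rc r x = r * N + x"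
definition cc :: "nat \<Rightarrow> nat" where "cc c = 3 * n * N + c"

lemma w_pos: "0 < w" by (simp add: wgt_def)

lemma T_eq: "T = 2 * w + Suc K" by (simp add: body_def)

lemma N_eq: "N = Suc T" by (simp add: rod_def)

lemma rc_less: assumes "r < 3 * n" "x < N" shows "rc r x < 3 * n * N"
proof -
  have "rc r x < Suc r * N" using assms by (simp add: rc_def)
  also have "\<dots> \<le> 3 * n * N" using assms by (intro mult_right_mono) auto
  finally show ?thesis .
qed

lemma rc_less': "r < 3 * n \<Longrightarrow> x < N \<Longrightarrow> rc r x < nc"
  using rc_less[of r x] by (simp add: ncols_def)

lemma rc_div [simp]: "x < N \<Longrightarrow> rc r x div N = r"
  by (simp add: rc_def)

lemma rc_mod [simp]: "x < N \<Longrightarrow> rc r x mod N = x"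
  by (simp add: rc_def)

lemma rc_inj: "x < N \<Longrightarrow> y < N \<Longrightarrow> rc r x = rc s y \<longleftrightarrow> r = s \<and> x = y"
  by (metis rc_div rc_mod)

lemma cc_less: "c < m \<Longrightarrow> cc c < nc"
  by (simp add: cc_def ncols_def)

lemma rc_neq_cc: "r < 3 * n \<Longrightarrow> x < N \<Longrightarrow> rc r x \<noteq> cc c"
  using rc_less[of r x] by (simp add: cc_def)

lemma entry_lit_rc:
  "l < 2 * n \<Longrightarrow> r < 3 * n \<Longrightarrow> x < N \<Longrightarrow>
   ent l (rc r x) \<longleftrightarrow> r = 3 * (l div 2) \<and> x < 2 * w \<or> r = 3 * (l div 2) + 1 + l mod 2 \<and> x < w"
  using rc_less[of r x] by (simp add: entry_def)

lemma entry_lit_cc: "l < 2 * n \<Longrightarrow> ent l (cc c) \<longleftrightarrow> lit l c"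
  by (simp add: entry_def cc_def)

lemma occs_bound: "occs n m lit < w"
proof -
  have "occs n m lit \<le> (\<Sum>l<2 * n. \<Sum>c<m. 1)"
    unfolding occs_def by (intro sum_mono) auto
  then show ?thesis by (simp add: wgt_def)
qed

lemma m_le: "m \<le> n * w"
proof -
  have "m \<le> n * m" using n_pos by simp
  also have "\<dots> \<le> w" by (simp add: wgt_def)
  also have "\<dots> \<le> n * w" using n_pos by simp
  finally show ?thesis .
qed

lemma K_less: "K < (n + 1) * w"
  using occs_bound by (simp add: budget_def)

lemma occs_pairs: "occs n m lit = (\<Sum>v<n. card {c. c < m \<and> lit (2 * v) c} + card {c. c < m \<and> lit (2 * v + 1) c})"
  unfolding occs_def sum_pairs count_eq ..

end

section \<open>Rigidity of the rods in an edited matrix\<close>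

locale edited_cnf = cnf +
  fixes F :: "(nat \<times> nat) set" and p :: "nat \<Rightarrow> nat" and X :: "nat \<Rightarrow> nat \<Rightarrow> bool"
  assumes F_fin: "finite F" and F_card: "card F \<le> K"
    and p_inj: "inj_on p {..<nc}"
    and X_eq: "\<And>i j. i < nr \<Longrightarrow> j < nc \<Longrightarrow> X i j \<longleftrightarrow> (ent i j \<longleftrightarrow> (i, j) \<notin> F)"
    and X_conv: "\<And>i j1 j2 j3. i < nr \<Longrightarrow> j1 < nc \<Longrightarrow> j2 < nc \<Longrightarrow>
      j3 < nc \<Longrightarrow> X i j1 \<Longrightarrow> X i j3 \<Longrightarrow> p j1 < p j2 \<Longrightarrow> p j2 < p j3 \<Longrightarrow> X i j2"
begin

lemma p_neq: "i < nc \<Longrightarrow> j < nc \<Longrightarrow> i \<noteq> j \<Longrightarrow> p i \<noteq> p j"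
  using p_inj by (auto simp: inj_on_def)

lemma lit_row: "l < 2 * n \<Longrightarrow> l < nr"
  by (simp add: nrows_def)

definition hard :: "nat \<Rightarrow> bool \<Rightarrow> nat \<Rightarrow> bool" where
  "hard r h j \<longleftrightarrow> (\<exists>x<N. j = rc r x \<and> (if h then 2 * w \<le> x else x < T))"

text \<open>At most \<open>K\<close> entries are edited and the row has \<open>K + 1\<close> copies,
  so some copy is untouched; convexity of the edited rows thus holds for the original set of
  columns.\<close>

lemma hard_conv:
  assumes r: "r < 3 * n" and j: "hard r h j1" "hard r h j3" "j2 < nc" "p j1 < p j2" "p j2 < p j3"
  shows "hard r h j2"
proof -
  define e where "e = 2 * r + of_bool h"
  define row where "row y = 2 * n + e * Suc K + y" for y
  have e: "e div 2 = r" "even e \<longleftrightarrow> \<not> h" "e < 6 * n" using r by (auto simp: e_def)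
  have row: "row y < nr" "2 * n \<le> row y" "(row y - 2 * n) div Suc K = e" if "y \<le> K" for y
  proof -
    have "e * Suc K + y < Suc e * Suc K" using that by simp
    also have "\<dots> \<le> 6 * n * Suc K" using e(3) by (intro mult_right_mono) auto
    finally show "row y < nr" by (simp add: row_def nrows_def)
    show "2 * n \<le> row y" by (simp add: row_def)
    have "row y - 2 * n = y + e * Suc K" by (simp add: row_def)
    also have "\<dots> div Suc K = e + y div Suc K" by (rule div_mult_self1) simp
    also have "\<dots> = e" using that by simp
    finally show "(row y - 2 * n) div Suc K = e" .
  qed
  have "\<exists>y\<le>K. \<forall>j. (row y, j) \<notin> F"
  proof (rule ccontr)
    assume "\<not> ?thesis"
    then obtain g where g: "\<And>y. y \<le> K \<Longrightarrow> (row y, g y) \<in> F" by metis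
    have "card ((\<lambda>y. (row y, g y)) ` {..K}) = card {..K}"
      by (rule card_image) (auto simp: inj_on_def row_def)
    moreover have "card ((\<lambda>y. (row y, g y)) ` {..K}) \<le> card F"
      by (rule card_mono) (use F_fin g in auto)
    ultimately show False using F_card by simp
  qed
  then obtain y where y: "y \<le> K" "\<And>j. (row y, j) \<notin> F" by blast
  have X: "X (row y) j \<longleftrightarrow> hard r h j" if "j < nc" for j
  proof -
    have "X (row y) j \<longleftrightarrow> ent (row y) j" using X_eq[OF row(1)[OF y(1)] that] y(2) by simp
    also have "\<dots> \<longleftrightarrow> j < 3 * n * N \<and> j div N = r \<and> (if h then 2 * w \<le> j mod N else j mod N < T)"
      using row[OF y(1)] e by (simp add: entry_def)
    also have "\<dots> \<longleftrightarrow> hard r h j"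
    proof
      assume *: "j < 3 * n * N \<and> j div N = r \<and> (if h then 2 * w \<le> j mod N else j mod N < T)"
      have "j = rc r (j mod N)" using * unfolding rc_def by (metis div_mult_mod_eq)
      then show "hard r h j" unfolding hard_def using * by (intro exI[of _ "j mod N"]) (auto simp: N_eq)
    next
      assume "hard r h j"
      then show "j < 3 * n * N \<and> j div N = r \<and> (if h then 2 * w \<le> j mod N else j mod N < T)"
        using rc_less[OF r] unfolding hard_def by (auto split: if_splits)
    qed
    finally show ?thesis .
  qed
  have b: "hard r h j \<Longrightarrow> j < nc" for j
    using rc_less'[OF r] by (auto simp: hard_def)
  show ?thesis
    using X_conv[OF row(1)[OF y(1)] b[OF j(1)] j(3) b[OF j(2)]] X j b by blast
qed

text \<open>The first tail column stands for the whole rod, because it lies in both kinds of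
  repeated rows and so shares one with every column of the rod.\<close>

definition pos :: "nat \<Rightarrow> nat" where "pos r = p (rc r (2 * w))"

definition outside :: "nat \<Rightarrow> nat \<Rightarrow> bool" where
  "outside r y \<longleftrightarrow> y < nc \<and> (\<forall>x<N. y \<noteq> rc r x)"

lemma outside_rc: "r < 3 * n \<Longrightarrow> r \<noteq> r' \<Longrightarrow> x < N \<Longrightarrow> outside r' (rc r x)"
  by (auto simp: outside_def rc_less' rc_inj)

lemma outside_cc: "r < 3 * n \<Longrightarrow> c < m \<Longrightarrow> outside r (cc c)"
  by (metis rc_neq_cc cc_less outside_def)

lemma tail_N: "2 * w < N" "2 * w < T" by (auto simp: N_eq T_eq)

text \<open>An outside column between the first tail column and \<open>rc r x\<close> would belong
  to the convex set of a repeated row that contains these two.\<close>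

lemma side:
  assumes r: "r < 3 * n" and y: "outside r y" and x: "x < N"
  shows "p y < pos r \<Longrightarrow> p y < p (rc r x)" "pos r < p y \<Longrightarrow> p (rc r x) < p y"
proof -
  have ne: "p (rc r x) \<noteq> p y" using y x r rc_less' by (intro p_neq) (auto simp: outside_def)
  have t: "hard r h (rc r (2 * w))" for h using tail_N unfolding hard_def by (intro exI[of _ "2 * w"]) auto
  define h where "h \<longleftrightarrow> \<not> x < T"
  have h: "hard r h (rc r x)"
    unfolding hard_def using x by (intro exI[of _ x]) (auto simp: N_eq T_eq h_def)
  have nh: "\<not> hard r h y" using y by (auto simp: outside_def hard_def)
  have yc: "y < nc" using y by (simp add: outside_def)
  show "p y < p (rc r x)" if "p y < pos r"
    using hard_conv[OF r h t yc] nh ne that unfolding pos_def by linarith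
  show "p (rc r x) < p y" if "pos r < p y"
    using hard_conv[OF r t h yc] nh ne that unfolding pos_def by linarith
qed

lemma pos_outside: "r < 3 * n \<Longrightarrow> outside r y \<Longrightarrow> p y \<noteq> pos r"
  unfolding pos_def using rc_less'[of r "2 * w"] tail_N by (intro p_neq) (auto simp: outside_def)

text \<open>Let the end column lie on one side of the first tail column. A head column cannot lie
  beyond the end, since the row on head and tail would then contain the end; nor between a tail
  column and the end, since the row on tail and end would then contain the head. So it lies on the
  other side of the tail.\<close>

lemma orientation:
  assumes r: "r < 3 * n"
  shows "(\<forall>x<2 * w. \<forall>t. 2 * w \<le> t \<longrightarrow> t < T \<longrightarrow> p (rc r x) < p (rc r t)) \<or>
    (\<forall>x<2 * w. \<forall>t. 2 * w \<le> t \<longrightarrow> t < T \<longrightarrow> p (rc r t) < p (rc r x))"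
proof -
  let ?s = "rc r T"
  have s: "hard r True ?s" "\<not> hard r False ?s" "?s < nc"
    using r tail_N rc_inj rc_less'[OF r] by (auto simp: hard_def N_eq intro!: exI[of _ T])
  have ord: "\<And>i j. i < nc \<Longrightarrow> j < nc \<Longrightarrow> i \<noteq> j \<Longrightarrow> p i < p j \<or> p j < p i"
    using p_neq by (meson nat_neq_iff)
  have head: "hard r False (rc r x)" "\<not> hard r True (rc r x)" "rc r x < nc" if "x < 2 * w" for x
    using that r tail_N rc_inj[of x] rc_less'[OF r] by (auto simp: hard_def N_eq intro!: exI[of _ x])
  have tail: "hard r True (rc r t)" "hard r False (rc r t)" "rc r t < nc" if "2 * w \<le> t" "t < T" for t
    using that r tail_N rc_less'[OF r] by (auto simp: hard_def N_eq intro!: exI[of _ t])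
  let ?t0 = "rc r (2 * w)"
  have t0: "hard r False ?t0" "?t0 < nc" using tail[of "2 * w"] tail_N by auto
  have "p ?t0 \<noteq> p ?s" using t0 s by (intro p_neq) auto
  then consider "p ?t0 < p ?s" | "p ?s < p ?t0" by linarith
  then show ?thesis
  proof cases
    case 1
    have "p (rc r x) < p (rc r t)" if x: "x < 2 * w" and t: "2 * w \<le> t" "t < T" for x t
    proof -
      have "\<not> p ?s < p (rc r x)"
        using hard_conv[OF r t0(1) head(1)[OF x] s(3) 1] s(2) by blast
      then have "p (rc r x) < p ?s" using ord[OF head(3)[OF x] s(3)] head[OF x] s by metis
      then have "\<not> p (rc r t) < p (rc r x)"
        using hard_conv[OF r tail(1)[OF t] s(1) head(3)[OF x]] head(2)[OF x] by blast
      then show ?thesis using ord[OF head(3)[OF x] tail(3)[OF t]] head[OF x] tail[OF t] by metis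
    qed
    then show ?thesis by blast
  next
    case 2
    have "p (rc r t) < p (rc r x)" if x: "x < 2 * w" and t: "2 * w \<le> t" "t < T" for x t
    proof -
      have "\<not> p (rc r x) < p ?s"
        using hard_conv[OF r head(1)[OF x] t0(1) s(3) _ 2] s(2) by blast
      then have "p ?s < p (rc r x)" using ord[OF head(3)[OF x] s(3)] head[OF x] s by metis
      then have "\<not> p (rc r x) < p (rc r t)"
        using hard_conv[OF r s(1) tail(1)[OF t] head(3)[OF x]] head(2)[OF x] by blast
      then show ?thesis using ord[OF head(3)[OF x] tail(3)[OF t]] head[OF x] tail[OF t] by metis
    qed
    then show ?thesis by blast
  qed
qed

text \<open>A literal row originally has zeros on all tails, so covering the \<open>K + 1\<close>
  columns of one would take more than \<open>K\<close> flips.\<close>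

lemma no_tail:
  assumes l: "l < 2 * n" and r: "r < 3 * n"
  shows "\<exists>t. 2 * w \<le> t \<and> t < T \<and> \<not> X l (rc r t)"
proof (rule ccontr)
  assume "\<not> ?thesis"
  then have *: "(l, rc r t) \<in> F" if "2 * w \<le> t" "t < T" for t
    using that X_eq[OF lit_row[OF l] rc_less'[OF r, of t]] entry_lit_rc[OF l r, of t]
    by (auto simp: N_eq)
  have "card ((\<lambda>t. (l, rc r t)) ` {2 * w..<T}) = card {2 * w..<T}"
    by (rule card_image) (auto simp: inj_on_def rc_def)
  moreover have "card ((\<lambda>t. (l, rc r t)) ` {2 * w..<T}) \<le> card F"
    by (rule card_mono) (use F_fin * in auto)
  ultimately show False using F_card by (simp add: T_eq)
qed

lemma no_cross_tail:
  assumes "l < 2 * n" "r < 3 * n" "y < nc" "y' < nc" "X l y" "X l y'"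
    and "\<And>t. 2 * w \<le> t \<Longrightarrow> t < T \<Longrightarrow> p y < p (rc r t)" "\<And>t. 2 * w \<le> t \<Longrightarrow> t < T \<Longrightarrow> p (rc r t) < p y'"
  shows False
proof -
  obtain t where t: "2 * w \<le> t" "t < T" "\<not> X l (rc r t)" using no_tail[OF assms(1,2)] by blast
  have "X l (rc r t)"
    by (rule X_conv[OF lit_row[OF assms(1)] assms(3) _ assms(4-6)])
      (use assms(7,8)[OF t(1,2)] rc_less'[OF assms(2), of t] t in \<open>auto simp: N_eq\<close>)
  with t(3) show False ..
qed

lemma no_cross:
  assumes "l < 2 * n" "r < 3 * n" "outside r y" "outside r y'" "X l y" "X l y'"
  shows "\<not> (p y < pos r \<and> pos r < p y')"
  using no_cross_tail[OF assms(1,2) _ _ assms(5,6)] side[OF assms(2,3)] side[OF assms(2,4)] assms(3,4)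
  by (auto simp: outside_def N_eq)

end

section \<open>Joining rows and the clauses they reach\<close>

context edited_cnf
begin

definition meets :: "nat \<Rightarrow> nat \<Rightarrow> bool" where
  "meets l r \<longleftrightarrow> (\<exists>x<2 * w. X l (rc r x))"

definition connected :: "nat \<Rightarrow> nat \<Rightarrow> bool" where
  "connected v s \<longleftrightarrow> meets (2 * v + s) (3 * v) \<and> meets (2 * v + s) (3 * v + 1 + s)"

definition region :: "nat \<Rightarrow> nat \<Rightarrow> nat \<Rightarrow> bool" where
  "region v s c \<longleftrightarrow> c < m \<and>
     (pos (3 * v) < p (cc c) \<and> p (cc c) < pos (3 * v + 1 + s) \<or>
      pos (3 * v + 1 + s) < p (cc c) \<and> p (cc c) < pos (3 * v))"

lemma head_N: "x < 2 * w \<Longrightarrow> x < N"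
  using tail_N by simp

lemma pos_neq: "r < 3 * n \<Longrightarrow> r' < 3 * n \<Longrightarrow> r \<noteq> r' \<Longrightarrow> pos r \<noteq> pos r'"
  using pos_outside[of r' "rc r (2 * w)"] outside_rc[of r r' "2 * w"] tail_N by (simp add: pos_def)

lemma pos_rod:
  assumes "r < 3 * n" "outside r y" "x < N"
  shows "p y < p (rc r x) \<longleftrightarrow> p y < pos r" "p (rc r x) < p y \<longleftrightarrow> pos r < p y"
  using side[OF assms] pos_outside[OF assms(1,2)] by (metis not_less_iff_gr_or_eq)+

lemma pos_rods:
  assumes "r < 3 * n" "r' < 3 * n" "r \<noteq> r'" "x < N"
  shows "p (rc r x) < pos r' \<longleftrightarrow> pos r < pos r'" "pos r' < p (rc r x) \<longleftrightarrow> pos r' < pos r"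
proof -
  have o: "outside r (rc r' (2 * w))" using assms outside_rc tail_N by auto
  show "p (rc r x) < pos r' \<longleftrightarrow> pos r < pos r'" "pos r' < p (rc r x) \<longleftrightarrow> pos r' < pos r"
    using pos_rod[OF assms(1) o assms(4)] by (auto simp: pos_def)
qed

lemma no_rod_between:
  assumes l: "l < 2 * n" and r: "r1 < 3 * n" "r2 < 3 * n" "r < 3 * n" "r \<noteq> r1" "r \<noteq> r2"
    and X: "meets l r1" "meets l r2"
  shows "\<not> (pos r1 < pos r \<and> pos r < pos r2)"
proof
  assume *: "pos r1 < pos r \<and> pos r < pos r2"
  obtain x1 x2 where x: "x1 < 2 * w" "X l (rc r1 x1)" "x2 < 2 * w" "X l (rc r2 x2)"
    using X by (auto simp: meets_def)
  have "outside r (rc r1 x1)" "outside r (rc r2 x2)"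
    using x r head_N by (auto intro!: outside_rc)
  from no_cross[OF l r(3) this x(2,4)] pos_rods[OF r(1,3) r(4)[symmetric] head_N[OF x(1)]]
    pos_rods[OF r(2,3) r(5)[symmetric] head_N[OF x(3)]] * show False by simp
qed

lemma no_rod_clause:
  assumes l: "l < 2 * n" and r: "r1 < 3 * n" "r < 3 * n" "r \<noteq> r1" and c: "c < m"
    and X: "meets l r1" "X l (cc c)"
  shows "\<not> (pos r1 < pos r \<and> pos r < p (cc c))" "\<not> (p (cc c) < pos r \<and> pos r < pos r1)"
proof -
  obtain x1 where x: "x1 < 2 * w" "X l (rc r1 x1)"
    using X by (auto simp: meets_def)
  have o: "outside r (rc r1 x1)" "outside r (cc c)"
    using x r c head_N by (auto intro!: outside_rc outside_cc)
  show "\<not> (pos r1 < pos r \<and> pos r < p (cc c))"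
    using no_cross[OF l r(2) o x(2) X(2)] pos_rods[OF r(1,2) r(3)[symmetric] head_N[OF x(1)]] by simp
  show "\<not> (p (cc c) < pos r \<and> pos r < pos r1)"
    using no_cross[OF l r(2) o(2,1) X(2) x(2)] pos_rods[OF r(1,2) r(3)[symmetric] head_N[OF x(1)]] by simp
qed

definition tail_right :: "nat \<Rightarrow> bool" where
  "tail_right r \<longleftrightarrow> (\<forall>x<2 * w. \<forall>t. 2 * w \<le> t \<longrightarrow> t < T \<longrightarrow> p (rc r x) < p (rc r t))"

text \<open>A one on the side of the tail, together with a one in the head, would make the row cover
  the tail. So all rows that meet a rod leave it on the same side, the one its head faces.\<close>

lemma exit_side:
  assumes l: "l < 2 * n" and r: "r < 3 * n" and y: "outside r y" "X l y" and X: "meets l r"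
  shows "pos r < p y \<longleftrightarrow> \<not> tail_right r"
proof -
  obtain x where x: "x < 2 * w" "X l (rc r x)" using X by (auto simp: meets_def)
  note b = rc_less'[OF r head_N[OF x(1)]] y(1)[unfolded outside_def, THEN conjunct1]
  have tN: "t < N" if "t < T" for t using that by (simp add: N_eq)
  have 1: "\<not> tail_right r" if "pos r < p y"
    using no_cross_tail[OF l r b x(2) y(2)] pos_rod[OF r y(1)] tN that x(1)
    unfolding tail_right_def by blast
  have 2: "tail_right r" if "p y < pos r"
    using no_cross_tail[OF l r b(2,1) y(2) x(2)] pos_rod[OF r y(1)] tN that x(1) orientation[OF r]
    unfolding tail_right_def by blast
  show ?thesis using 1 2 pos_outside[OF r y(1)] by linarith
qed

lemma exit_side_rod:
  assumes "l < 2 * n" "r < 3 * n" "r' < 3 * n" "r \<noteq> r'" "meets l r" "meets l r'"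
  shows "pos r < pos r' \<longleftrightarrow> \<not> tail_right r"
proof -
  obtain x where x: "x < 2 * w" "X l (rc r' x)" using assms(6) by (auto simp: meets_def)
  show ?thesis
    using exit_side[OF assms(1,2) outside_rc[OF assms(3) assms(4)[symmetric] head_N[OF x(1)]] x(2) assms(5)]
      pos_rods[OF assms(3,2) assms(4)[symmetric] head_N[OF x(1)]] by simp
qed

lemma var_bounds:
  assumes "v < n" "s < 2"
  shows "2 * v + s < 2 * n" "3 * v < 3 * n" "3 * v + 1 + s < 3 * n"
  using assms by auto

text \<open>Both literal rows leave the rod of the variable on the side of its head, so both literal
  rods lie there; the row that reaches the farther one would cover the tail of the nearer.\<close>

lemma connected_unique:
  assumes v: "v < n" and c: "connected v 0" "connected v 1"
  shows False
proof -
  have b: "2 * v < 2 * n" "2 * v + 1 < 2 * n" "3 * v < 3 * n" "3 * v + 1 < 3 * n" "3 * v + 2 < 3 * n"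
    using v by auto
  have c0: "meets (2 * v) (3 * v)" "meets (2 * v) (3 * v + 1)"
    and c1: "meets (2 * v + 1) (3 * v)" "meets (2 * v + 1) (3 * v + 2)"
    using c by (auto simp: connected_def)
  have "pos (3 * v) < pos (3 * v + 1) \<longleftrightarrow> pos (3 * v) < pos (3 * v + 2)"
    using exit_side_rod[OF b(1,3,4) _ c0] exit_side_rod[OF b(2,3,5) _ c1] by simp
  moreover have "pos (3 * v) \<noteq> pos (3 * v + 1)" "pos (3 * v) \<noteq> pos (3 * v + 2)"
    "pos (3 * v + 1) \<noteq> pos (3 * v + 2)"
    using b by (intro pos_neq; simp)+
  moreover note no_rod_between[OF b(1,3,4,5) _ _ c0] no_rod_between[OF b(1,4,3,5) _ _ c0(2,1)]
    no_rod_between[OF b(2,3,5,4) _ _ c1] no_rod_between[OF b(2,5,3,4) _ _ c1(2,1)]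
  ultimately show False by simp linarith
qed

text \<open>Convexity gives all clauses between the joined rods. A one beyond either rod would leave
  this rod between two ones of the row, which would then cover its tail.\<close>

lemma region_conn:
  assumes v: "v < n" "s < 2" and con: "connected v s" and c: "c < m"
  shows "X (2 * v + s) (cc c) \<longleftrightarrow> region v s c"
proof -
  note b = var_bounds[OF v]
  have con': "meets (2 * v + s) (3 * v)" "meets (2 * v + s) (3 * v + 1 + s)"
    using con by (auto simp: connected_def)
  have ne: "p (cc c) \<noteq> pos (3 * v)" "p (cc c) \<noteq> pos (3 * v + 1 + s)"
    using b c by (intro pos_outside outside_cc; simp)+
  have "pos (3 * v) \<noteq> pos (3 * v + 1 + s)" using b by (intro pos_neq) auto
  moreover have "region v s c" if x: "X (2 * v + s) (cc c)"
  proof -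
    have d: "3 * v \<noteq> 3 * v + 1 + s" "3 * v + 1 + s \<noteq> 3 * v" by auto
    show ?thesis
      using no_rod_clause[OF b(1,2,3) d(2) c con'(1) x] no_rod_clause[OF b(1,3,2) d(1) c con'(2) x] ne
        \<open>pos (3 * v) \<noteq> pos (3 * v + 1 + s)\<close> c
      unfolding region_def by linarith
  qed
  moreover have "X (2 * v + s) (cc c)" if "region v s c"
  proof -
    obtain x1 x2 where x: "x1 < 2 * w" "X (2 * v + s) (rc (3 * v) x1)"
      "x2 < 2 * w" "X (2 * v + s) (rc (3 * v + 1 + s) x2)"
      using con' by (auto simp: meets_def)
    note o = pos_rod[OF b(2) outside_cc[OF b(2) c] head_N[OF x(1)]]
      pos_rod[OF b(3) outside_cc[OF b(3) c] head_N[OF x(3)]]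
    note r = lit_row[OF b(1)] rc_less'[OF b(2) head_N[OF x(1)]] rc_less'[OF b(3) head_N[OF x(3)]] cc_less[OF c]
    show ?thesis
      using that o X_conv[OF r(1,2,4,3) x(2,4)] X_conv[OF r(1,3,4,2) x(4,2)]
      unfolding region_def by blast
  qed
  ultimately show ?thesis by blast
qed

text \<open>The row leaves rod \<open>3 * v\<close> on the side of its head, as the joining row
  does, and it cannot pass the rod of the joined literal; so its clauses stay between the
  two.\<close>

lemma region_other:
  assumes v: "v < n" "s < 2" "s' < 2" and con: "connected v s" and c: "c < m"
    and o: "meets (2 * v + s') (3 * v)" "X (2 * v + s') (cc c)"
  shows "region v s c"
proof -
  note b = var_bounds[OF v(1,2)] and b' = var_bounds(1)[OF v(1,3)]
  have con': "meets (2 * v + s) (3 * v)" "meets (2 * v + s) (3 * v + 1 + s)"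
    using con by (auto simp: connected_def)
  have d: "3 * v \<noteq> 3 * v + 1 + s" "3 * v + 1 + s \<noteq> 3 * v" by auto
  have "pos (3 * v) < pos (3 * v + 1 + s) \<longleftrightarrow> pos (3 * v) < p (cc c)"
    using exit_side_rod[OF b d(1) con'] exit_side[OF b' b(2) outside_cc[OF b(2) c] o(2,1)] by simp
  moreover have "p (cc c) \<noteq> pos (3 * v)" "p (cc c) \<noteq> pos (3 * v + 1 + s)"
    using b c by (intro pos_outside outside_cc; simp)+
  moreover have "pos (3 * v) \<noteq> pos (3 * v + 1 + s)" using b by (intro pos_neq) auto
  moreover note no_rod_clause[OF b' b(2,3) d(2) c o]
  ultimately show ?thesis using c unfolding region_def by linarith
qed

text \<open>No rod of one pair lies between the joined rods of the other, and two intervals with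
  different ends, neither containing an end of the other, have no common clause.\<close>

lemma region_disjoint:
  assumes v: "v < n" "s < 2" "v' < n" "s' < 2" "v \<noteq> v'"
    and con: "connected v s" "connected v' s'" and c: "region v s c" "region v' s' c"
  shows False
proof -
  note b = var_bounds[OF v(1,2)] and b' = var_bounds[OF v(3,4)]
  define a1 a2 b1 b2 where d: "a1 = 3 * v" "a2 = 3 * v + 1 + s" "b1 = 3 * v'" "b2 = 3 * v' + 1 + s'"
  note bb = b[folded d] b'[folded d]
  have ne: "a1 \<noteq> a2" "b1 \<noteq> b2" "a1 \<noteq> b1" "a1 \<noteq> b2" "a2 \<noteq> b1" "a2 \<noteq> b2"
  proof -
    have "a1 div 3 = v" "a2 div 3 = v" "b1 div 3 = v'" "b2 div 3 = v'"
      using v(2,4) by (auto simp: d less_2_cases_iff)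
    then show "a1 \<noteq> b1" "a1 \<noteq> b2" "a2 \<noteq> b1" "a2 \<noteq> b2" using v(5) by auto
  qed (auto simp: d)
  have m1: "meets (2 * v + s) a1" "meets (2 * v + s) a2" and m2: "meets (2 * v' + s') b1" "meets (2 * v' + s') b2"
    using con by (auto simp: connected_def d)
  note pn = pos_neq[OF bb(2,5) ne(3)] pos_neq[OF bb(2,6) ne(4)] pos_neq[OF bb(3,5) ne(5)] pos_neq[OF bb(3,6) ne(6)]
  have r1: "pos a1 < p (cc c) \<and> p (cc c) < pos a2 \<or> pos a2 < p (cc c) \<and> p (cc c) < pos a1"
    and r2: "pos b1 < p (cc c) \<and> p (cc c) < pos b2 \<or> pos b2 < p (cc c) \<and> p (cc c) < pos b1"
    using c by (auto simp: region_def d)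
  note ne' = ne[symmetric]
  \<comment> \<open>Of two intervals with a common point, the larger of the left ends lies inside
    the other interval unless the left ends agree.\<close>
  have cross: "\<not> (x1 < c \<and> c < x2)" if "y1 < c \<and> c < y2" "x1 \<noteq> y1"
    "\<not> (x1 < y1 \<and> y1 < x2)" "\<not> (y1 < x1 \<and> x1 < y2)" for x1 x2 y1 y2 c :: nat
    using that by linarith
  note n1 = no_rod_between[OF bb(1,2,3,5) ne'(3,5) m1] no_rod_between[OF bb(1,2,3,6) ne'(4,6) m1]
    no_rod_between[OF bb(1,3,2,5) ne'(5,3) m1(2,1)] no_rod_between[OF bb(1,3,2,6) ne'(6,4) m1(2,1)]
  note n2 = no_rod_between[OF bb(4,5,6,2) ne(3,4) m2] no_rod_between[OF bb(4,5,6,3) ne(5,6) m2]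
    no_rod_between[OF bb(4,6,5,2) ne(4,3) m2(2,1)] no_rod_between[OF bb(4,6,5,3) ne(6,5) m2(2,1)]
  show False
    using r2
  proof
    assume b: "pos b1 < p (cc c) \<and> p (cc c) < pos b2"
    show False using r1 cross[OF b pn(1) n1(1) n2(1)] cross[OF b pn(3) n1(3) n2(2)] by blast
  next
    assume b: "pos b2 < p (cc c) \<and> p (cc c) < pos b1"
    show False using r1 cross[OF b pn(2) n1(2) n2(3)] cross[OF b pn(4) n1(4) n2(4)] by blast
  qed
qed

section \<open>Counting the edits of the literal rows\<close>

definition rod_cost :: "nat \<Rightarrow> nat" where
  "rod_cost l = card {j. j < 3 * n * N \<and> (l, j) \<in> F}"

definition clause_cost :: "nat \<Rightarrow> nat" where
  "clause_cost l = card {c. c < m \<and> (l, cc c) \<in> F}"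

lemma cost_le: "(\<Sum>l<2 * n. rod_cost l + clause_cost l) \<le> K"
proof -
  let ?A = "\<lambda>l. (\<lambda>j. (l, j)) ` {j. j < 3 * n * N \<and> (l, j) \<in> F}"
  let ?B = "\<lambda>l. (\<lambda>c. (l, cc c)) ` {c. c < m \<and> (l, cc c) \<in> F}"
  have "rod_cost l + clause_cost l = card (?A l \<union> ?B l)" for l
  proof -
    have "card (?A l) = rod_cost l" "card (?B l) = clause_cost l"
      unfolding rod_cost_def clause_cost_def by (auto intro!: card_image simp: inj_on_def cc_def)
    moreover have "?A l \<inter> ?B l = {}" by (auto simp: cc_def)
    ultimately show ?thesis by (subst card_Un_disjoint) auto
  qed
  then have "(\<Sum>l<2 * n. rod_cost l + clause_cost l) = (\<Sum>l<2 * n. card (?A l \<union> ?B l))" by simp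
  also have "\<dots> = card (\<Union>l<2 * n. ?A l \<union> ?B l)"
    by (rule card_UN_disjoint[symmetric]) auto
  also have "\<dots> \<le> card F"
    by (rule card_mono[OF F_fin]) auto
  finally show ?thesis using F_card by simp
qed

lemma rod_cost_ge:
  assumes l: "l < 2 * n" and r: "r < 3 * n" and k: "k \<le> 2 * w"
    and e: "\<And>x. x < k \<Longrightarrow> ent l (rc r x)" and nm: "\<not> meets l r"
  shows "k \<le> rod_cost l"
proof -
  have "(l, rc r x) \<in> F" if "x < k" for x
  proof -
    have x: "x < 2 * w" using that k by simp
    then have "\<not> X l (rc r x)" using nm by (auto simp: meets_def)
    then show ?thesis using X_eq[OF lit_row[OF l] rc_less'[OF r head_N[OF x]]] e[OF that] by simp
  qed
  then have "rc r ` {..<k} \<subseteq> {j. j < 3 * n * N \<and> (l, j) \<in> F}"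
    using k rc_less[OF r] head_N by auto
  then have "card (rc r ` {..<k}) \<le> rod_cost l"
    unfolding rod_cost_def by (intro card_mono) auto
  moreover have "card (rc r ` {..<k}) = k"
    by (subst card_image) (auto simp: inj_on_def rc_def)
  ultimately show ?thesis by simp
qed

lemma rod_cost_A:
  assumes "v < n" "s < 2" "\<not> meets (2 * v + s) (3 * v)"
  shows "2 * w \<le> rod_cost (2 * v + s)"
  by (rule rod_cost_ge[OF _ _ _ _ assms(3)]) (use assms head_N in \<open>auto simp: entry_lit_rc\<close>)

lemma rod_cost_B:
  assumes "v < n" "s < 2" "\<not> connected v s"
  shows "w \<le> rod_cost (2 * v + s)"
proof (cases "meets (2 * v + s) (3 * v)")
  case True
  then have "\<not> meets (2 * v + s) (3 * v + 1 + s)" using assms by (simp add: connected_def)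
  then show ?thesis
    by (intro rod_cost_ge[of _ "3 * v + 1 + s"]) (use assms head_N in \<open>auto simp: entry_lit_rc\<close>)
next
  case False
  then show ?thesis using rod_cost_A[OF assms(1,2)] by simp
qed

lemma rod_cost_pair: assumes "v < n" shows "w \<le> rod_cost (2 * v) + rod_cost (2 * v + 1)"
  using connected_unique[OF assms] rod_cost_B[of v 0] rod_cost_B[of v 1] assms by fastforce

text \<open>Every other variable pays at least \<open>w\<close>, so paying \<open>2 * w\<close> for
  \<open>v\<close> would bring the total to \<open>(n + 1) * w\<close>, which is more than the
  budget.\<close>

lemma rod_cost_tight:
  assumes v: "v < n" shows "rod_cost (2 * v) + rod_cost (2 * v + 1) < 2 * w"
proof (rule ccontr)
  assume "\<not> ?thesis"
  then have "2 * w + (\<Sum>u\<in>{..<n} - {v}. w) \<le>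
    rod_cost (2 * v) + rod_cost (2 * v + 1) + (\<Sum>u\<in>{..<n} - {v}. rod_cost (2 * u) + rod_cost (2 * u + 1))"
    by (intro add_mono sum_mono rod_cost_pair) auto
  also have "\<dots> = (\<Sum>u<n. rod_cost (2 * u) + rod_cost (2 * u + 1))"
    using v by (subst sum.remove[of "{..<n}" v]) auto
  also have "\<dots> = (\<Sum>l<2 * n. rod_cost l)" by (simp add: sum_pairs)
  also have "\<dots> \<le> (\<Sum>l<2 * n. rod_cost l + clause_cost l)" by (intro sum_mono) auto
  also have "\<dots> \<le> K" by (rule cost_le)
  finally have "2 * w + (n - 1) * w \<le> K" using v by simp
  moreover have "2 * w + (n - 1) * w = (n + 1) * w" using n_pos by (cases n) auto
  ultimately show False using K_less by simp
qed

text \<open>Two unjoined literals cost \<open>w\<close> each, and a single row that gives up the rod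
  of the variable costs \<open>2 * w\<close>; \<open>rod_cost_tight\<close> excludes both.\<close>

lemma tight_literal:
  assumes v: "v < n"
  shows "\<exists>s<2. connected v s \<and> meets (2 * v + (1 - s)) (3 * v)"
proof -
  note t = rod_cost_tight[OF v]
  have "connected v 0 \<or> connected v 1"
    using rod_cost_B[OF v, of 0] rod_cost_B[OF v, of 1] t by fastforce
  moreover have "meets (2 * v + s) (3 * v)" if "s < 2" for s
  proof (rule ccontr)
    assume "\<not> ?thesis"
    from rod_cost_A[OF v that this] t that show False
      by (cases s) (auto simp: less_Suc_eq numeral_2_eq_2)
  qed
  ultimately show ?thesis by (metis diff_le_self less_2_cases_iff le_less_trans zero_less_numeral one_less_numeral_iff semiring_norm(76))
qed

text \<open>The joining row has its clause ones exactly on the region and pays for each region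
  clause that it lacked. The clause ones of the other row lie in the region too, and an original one
  kept there is no clause of the joining literal, so the flip saved is among those paid for. What
  remains as a gain are the region clauses of the joining literal.\<close>

lemma clause_cost_pair:
  assumes v: "v < n" and s: "s < 2" and con: "connected v s" and o: "meets (2 * v + (1 - s)) (3 * v)"
  shows "card {c. c < m \<and> lit (2 * v) c} + card {c. c < m \<and> lit (2 * v + 1) c} \<le>
    clause_cost (2 * v) + clause_cost (2 * v + 1) + card {c. region v s c \<and> lit (2 * v + s) c}"
proof -
  define l l' where l: "l = 2 * v + s" "l' = 2 * v + (1 - s)"
  have s': "1 - s < 2" by simp
  have sw: "f (2 * v) + f (2 * v + 1) = f l + f l'" for f :: "nat \<Rightarrow> nat"
    using s unfolding l by (auto simp: less_Suc_eq numeral_2_eq_2)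
  have ll: "l < 2 * n" "l' < 2 * n" using v s by (auto simp: l)
  have dis: "\<not> (lit l c \<and> lit l' c)" for c
    using no_taut[of v c] s unfolding l by (auto simp: less_Suc_eq numeral_2_eq_2)
  define C C' R I where C: "C = {c. c < m \<and> lit l c}" "C' = {c. c < m \<and> lit l' c}"
    "R = {c. region v s c}" "I = {c. c < m \<and> X l' (cc c)}"
  have Fx: "(k, cc c) \<in> F \<longleftrightarrow> (lit k c \<longleftrightarrow> \<not> X k (cc c))" if "k < 2 * n" "c < m" for k c
    using X_eq[OF lit_row[OF that(1)] cc_less[OF that(2)]] entry_lit_cc[OF that(1)] by auto
  have rl: "X l (cc c) \<longleftrightarrow> c \<in> R" if "c < m" for c
    using region_conn[OF v s con that] unfolding l C by simp
  have IR: "I \<subseteq> R" using region_other[OF v s s' con _ o] unfolding l C by auto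
  have Rm: "R \<subseteq> {..<m}" by (auto simp: C region_def)
  have cl: "clause_cost l = card ((C - R) \<union> (R - C))"
    unfolding clause_cost_def by (rule arg_cong[where f = card]) (use Fx[OF ll(1)] rl Rm in \<open>auto simp: C(1)\<close>)
  have cl': "clause_cost l' = card ((C' - I) \<union> (I - C'))"
    unfolding clause_cost_def by (rule arg_cong[where f = card]) (use Fx[OF ll(2)] in \<open>auto simp: C(2,4)\<close>)
  have fin: "finite C" "finite C'" "finite R" "finite I"
    using finite_subset[OF Rm] finite_subset[OF IR] by (auto simp: C(1,2))
  have "card C = card (C - R) + card (R \<inter> C)"
    using fin card_Un_disjoint[of "C - R" "R \<inter> C"] by (auto simp: Un_Diff_Int Int_commute intro: arg_cong[where f = card])
  moreover have "card C' = card (C' - I) + card (I \<inter> C')"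
    using fin card_Un_disjoint[of "C' - I" "I \<inter> C'"] by (auto simp: Un_Diff_Int Int_commute intro: arg_cong[where f = card])
  moreover have "card (I \<inter> C') \<le> card (R - C)"
    by (rule card_mono) (use fin IR dis in \<open>auto simp: C(1,2)\<close>)
  moreover have "card ((C - R) \<union> (R - C)) = card (C - R) + card (R - C)"
    using fin by (intro card_Un_disjoint) auto
  moreover have "card (C' - I) \<le> card ((C' - I) \<union> (I - C'))"
    by (rule card_mono) (use fin in auto)
  ultimately have "card C + card C' \<le> clause_cost l + clause_cost l' + card (R \<inter> C)"
    unfolding cl cl' by linarith
  moreover have "R \<inter> C = {c. region v s c \<and> lit (2 * v + s) c}"
    using Rm unfolding C l by auto
  ultimately show ?thesis
    using sw[of clause_cost] sw[of "\<lambda>k. card {c. c < m \<and> lit k c}"] by (simp add: C(1,2))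
qed

text \<open>Added over all variables, the cost bounds exceed the budget unless the sets
  \<open>G v\<close> have at least \<open>m\<close> elements in total. As disjoint subsets of the
  \<open>m\<close> clauses they then cover all of them, and a clause in \<open>G v\<close> contains
  the literal that joins for \<open>v\<close>.\<close>

theorem edited_satisfiable: "satisfiable n m lit"
proof -
  obtain \<tau> where \<tau>: "\<And>v. v < n \<Longrightarrow> \<tau> v < 2 \<and> connected v (\<tau> v) \<and> meets (2 * v + (1 - \<tau> v)) (3 * v)"
    using tight_literal by metis
  define G where "G v = {c. region v (\<tau> v) c \<and> lit (2 * v + \<tau> v) c}" for v
  have Gm: "G v \<subseteq> {..<m}" for v by (auto simp: G_def region_def)
  have "n * w + occs n m lit \<le> (\<Sum>v<n. rod_cost (2 * v) + rod_cost (2 * v + 1)) +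
    (\<Sum>v<n. clause_cost (2 * v) + clause_cost (2 * v + 1) + card (G v))"
  proof (rule add_mono)
    have "(\<Sum>v<n. w) \<le> (\<Sum>v<n. rod_cost (2 * v) + rod_cost (2 * v + 1))"
      by (intro sum_mono rod_cost_pair) auto
    then show "n * w \<le> (\<Sum>v<n. rod_cost (2 * v) + rod_cost (2 * v + 1))" by simp
    show "occs n m lit \<le> (\<Sum>v<n. clause_cost (2 * v) + clause_cost (2 * v + 1) + card (G v))"
      unfolding occs_pairs G_def using \<tau> by (intro sum_mono clause_cost_pair) auto
  qed
  also have "\<dots> = (\<Sum>l<2 * n. rod_cost l + clause_cost l) + (\<Sum>v<n. card (G v))"
    by (simp add: sum_pairs sum.distrib)
  \<comment> \<open>The subtraction in \<open>budget\<close> does not truncate, by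
    \<open>m_le\<close>.\<close>
  finally have "m \<le> (\<Sum>v<n. card (G v))"
    using cost_le m_le unfolding budget_def by linarith
  also have "\<dots> = card (\<Union>v<n. G v)"
  proof (rule card_UN_disjoint[symmetric])
    show "\<forall>v\<in>{..<n}. finite (G v)" using finite_subset[OF Gm] by auto
    show "\<forall>v\<in>{..<n}. \<forall>u\<in>{..<n}. v \<noteq> u \<longrightarrow> G v \<inter> G u = {}"
      using region_disjoint \<tau> unfolding G_def by blast
  qed simp
  finally have "(\<Union>v<n. G v) = {..<m}"
    using Gm by (intro card_seteq) auto
  then have ex: "\<exists>v<n. lit (2 * v + \<tau> v) c" if "c < m" for c
    using that by (auto simp: G_def)
  show ?thesis unfolding satisfiable_def
  proof (intro exI[of _ "\<lambda>v. \<tau> v = 0"] allI impI)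
    fix c assume "c < m"
    from ex[OF this] obtain v where v: "v < n" "lit (2 * v + \<tau> v) c" by blast
    moreover have "\<tau> v = 0 \<or> \<tau> v = 1" using \<tau>[OF v(1)] by auto
    ultimately show "\<exists>v<n. lit (2 * v) c \<and> \<tau> v = 0 \<or> lit (2 * v + 1) c \<and> \<tau> v \<noteq> 0" by auto
  qed
qed

end

section \<open>Editing the matrix of a satisfiable formula\<close>

lemma block_interval:
  fixes x y k lo hi :: nat
  assumes "k < 12" "hi \<le> 12"
  shows "12 * x + lo \<le> 12 * y + k \<and> 12 * y + k < 12 * x + hi \<longleftrightarrow> y = x \<and> lo \<le> k \<and> k < hi"
proof (cases "y = x")
  case False
  then consider "y < x" | "x < y" by linarith
  then show ?thesis by cases (use assms in linarith)+
qed simp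

text \<open>
  The rods and clauses that belong to a variable form a block of columns with keys 0 to 10, ordered
  as follows: the rod of the variable, the clauses it satisfies, the rod of its true literal (all
  facing each other), the rod of its false literal. The nr form blocks likewise.
\<close>

locale satisfied_cnf = cnf +
  fixes \<alpha> :: "nat \<Rightarrow> bool" and \<sigma> :: "nat \<Rightarrow> nat"
  assumes \<sigma>: "\<And>c. c < m \<Longrightarrow> \<sigma> c < n \<and> lit (2 * \<sigma> c + (if \<alpha> (\<sigma> c) then 0 else 1)) c"
begin

definition \<tau> :: "nat \<Rightarrow> nat" where "\<tau> v = (if \<alpha> v then 0 else 1)"

text \<open>Here \<open>d\<close> numbers the rods of a block, 0 for the variable and
  \<open>1 + t\<close> for its true literal. Key 3 is left to the clauses. The rod of the variable
  is mirrored, from its end at 0 to its head at 2; the head of the true literal is split at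
  \<open>w\<close>, where the literal row stops.\<close>

definition rod_key :: "nat \<Rightarrow> nat \<Rightarrow> nat \<Rightarrow> nat" where
  "rod_key t d x =
     (if d = 0 then if x < 2 * w then 2 else if x < T then 1 else 0
      else if d = 1 + t then if x < w then 4 else if x < 2 * w then 5 else if x < T then 6 else 7
      else if x < 2 * w then 8 else if x < T then 9 else 10)"

text \<open>Intervals refer to row keys: in a block, 0 and 1 are the repeated rows on the rod of the
  variable, 2 the false and 3 the true literal, 4 and 5 the repeated rows on the rod of the true
  literal, 6 and 7 those on the rod of the false one.\<close>

definition rod_low :: "nat \<Rightarrow> nat \<Rightarrow> nat \<Rightarrow> nat" where
  "rod_low t d x =
     (if d = 0 then if x < 2 * w then 1 else 0
      else if d = 1 + t then if x < w then 3 else if x < T then 4 else 5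
      else if x < T then 6 else 7)"

definition rod_high :: "nat \<Rightarrow> nat \<Rightarrow> nat \<Rightarrow> nat" where
  "rod_high t d x =
     (if d = 0 then if x < 2 * w then 4 else if x < T then 2 else 1
      else if d = 1 + t then if x < 2 * w then 5 else 6
      else if x < 2 * w then 7 else 8)"

definition hard_key :: "nat \<Rightarrow> nat \<Rightarrow> nat \<Rightarrow> nat" where
  "hard_key t d e =
     (if d = 0 then if even e then 1 else 0
      else if d = 1 + t then if even e then 4 else 5 else if even e then 6 else 7)"

definition hard_low :: "nat \<Rightarrow> nat \<Rightarrow> nat \<Rightarrow> nat" where
  "hard_low t d e =
     (if d = 0 then if even e then 1 else 0
      else if d = 1 + t then if even e then 4 else 6 else if even e then 8 else 9)"

definition hard_high :: "nat \<Rightarrow> nat \<Rightarrow> nat \<Rightarrow> nat" where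
  "hard_high t d e =
     (if d = 0 then if even e then 3 else 2
      else if d = 1 + t then if even e then 7 else 8 else if even e then 10 else 11)"

definition col_block :: "nat \<Rightarrow> nat" where
  "col_block j = (if j < 3 * n * N then j div N div 3 else \<sigma> (j - 3 * n * N))"

definition col_key :: "nat \<Rightarrow> nat" where
  "col_key j = (if j < 3 * n * N then rod_key (\<tau> (col_block j)) (j div N mod 3) (j mod N) else 3)"

definition col_low :: "nat \<Rightarrow> nat" where
  "col_low j = (if j < 3 * n * N then rod_low (\<tau> (col_block j)) (j div N mod 3) (j mod N) else 3)"

definition col_high :: "nat \<Rightarrow> nat" where
  "col_high j = (if j < 3 * n * N then rod_high (\<tau> (col_block j)) (j div N mod 3) (j mod N) else 4)"

definition cls :: "nat \<Rightarrow> nat" where "cls i = (i - 2 * n) div Suc K"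

definition row_block :: "nat \<Rightarrow> nat" where
  "row_block i = (if i < 2 * n then i div 2 else cls i div 2 div 3)"

definition row_key :: "nat \<Rightarrow> nat" where
  "row_key i = (if i < 2 * n then if i mod 2 = \<tau> (i div 2) then 3 else 2
     else hard_key (\<tau> (row_block i)) (cls i div 2 mod 3) (cls i))"

definition row_low :: "nat \<Rightarrow> nat" where
  "row_low i = (if i < 2 * n then 2 else hard_low (\<tau> (row_block i)) (cls i div 2 mod 3) (cls i))"

definition row_high :: "nat \<Rightarrow> nat" where
  "row_high i = (if i < 2 * n then if i mod 2 = \<tau> (i div 2) then 5 else 3
     else hard_high (\<tau> (row_block i)) (cls i div 2 mod 3) (cls i))"

text \<open>The edited matrix, read off from the order of its columns. The order of its rows has to
  describe the very same matrix, which is \<open>Y_cols\<close>.\<close>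

definition Y :: "nat \<Rightarrow> nat \<Rightarrow> bool" where
  "Y i j \<longleftrightarrow> col_block j = row_block i \<and> row_low i \<le> col_key j \<and> col_key j < row_high i"

lemmas Y_defs = Y_def col_key_def col_low_def col_high_def row_key_def row_low_def row_high_def

lemma \<tau>_less: "\<tau> v < 2" by (simp add: \<tau>_def)

lemma wT: "w \<le> 2 * w" "2 * w < T" "w < T" using w_pos by (auto simp: T_eq)

lemma rod_hard:
  assumes "t < 2" "d < 3" "d' < 3"
  shows "hard_low t d' e \<le> rod_key t d x \<and> rod_key t d x < hard_high t d' e \<longleftrightarrow>
      d = d' \<and> (if even e then x < T else 2 * w \<le> x)"
    "rod_low t d x \<le> hard_key t d' e \<and> hard_key t d' e < rod_high t d x \<longleftrightarrow>
      d = d' \<and> (if even e then x < T else 2 * w \<le> x)"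
proof -
  have d: "d = 0 \<or> d = 1 + t \<or> d \<noteq> 0 \<and> d \<noteq> 1 + t \<and> d = 2 - t"
    "d' = 0 \<or> d' = 1 + t \<or> d' \<noteq> 0 \<and> d' \<noteq> 1 + t \<and> d' = 2 - t"
    using assms by auto
  show "hard_low t d' e \<le> rod_key t d x \<and> rod_key t d x < hard_high t d' e \<longleftrightarrow>
      d = d' \<and> (if even e then x < T else 2 * w \<le> x)"
    using d wT by (elim disjE conjE) (auto simp: hard_low_def rod_key_def hard_high_def)
  show "rod_low t d x \<le> hard_key t d' e \<and> hard_key t d' e < rod_high t d x \<longleftrightarrow>
      d = d' \<and> (if even e then x < T else 2 * w \<le> x)"
    using d wT by (elim disjE conjE) (auto simp: rod_low_def hard_key_def rod_high_def)
qed

lemma rod_lit: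
  "2 \<le> rod_key t d x \<and> rod_key t d x < 5 \<longleftrightarrow> d = 0 \<and> x < 2 * w \<or> d = 1 + t \<and> x < w"
  "2 \<le> rod_key t d x \<and> rod_key t d x < 3 \<longleftrightarrow> d = 0 \<and> x < 2 * w"
  "rod_low t d x \<le> 3 \<and> 3 < rod_high t d x \<longleftrightarrow> d = 0 \<and> x < 2 * w \<or> d = 1 + t \<and> x < w"
  "rod_low t d x \<le> 2 \<and> 2 < rod_high t d x \<longleftrightarrow> d = 0 \<and> x < 2 * w"
  using wT unfolding rod_key_def rod_low_def rod_high_def by auto

lemma clause_hard:
  "\<not> (hard_low t d e \<le> 3 \<and> 3 < hard_high t d e)" "\<not> (3 \<le> hard_key t d e \<and> hard_key t d e < 4)"
  unfolding hard_low_def hard_high_def hard_key_def by auto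

lemma Y_cols: "Y i j \<longleftrightarrow> row_block i = col_block j \<and> col_low j \<le> row_key i \<and> row_key i < col_high j"
proof (cases "col_block j = row_block i")
  case True
  show ?thesis
  proof (cases "j < 3 * n * N")
    case j: True
    show ?thesis
    proof (cases "i < 2 * n")
      case True
      with j \<open>col_block j = row_block i\<close> show ?thesis
        by (cases "i mod 2 = \<tau> (i div 2)")
          (simp_all add: Y_defs rod_lit)
    next
      case False
      then show ?thesis using j True rod_hard[OF \<tau>_less, of "j div N mod 3" "cls i div 2 mod 3"]
        by (simp add: Y_defs)
    qed
  next
    case j: False
    show ?thesis
    proof (cases "i < 2 * n")
      case True
      then show ?thesis using j
        by (auto simp add: Y_defs)
    next
      case False
      then show ?thesis using j True
        by (simp add: Y_defs clause_hard)
    qed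
  qed
qed (auto simp: Y_def)

lemma Y_hard:
  assumes i: "2 * n \<le> i"
  shows "Y i j \<longleftrightarrow> ent i j"
proof (cases "j < 3 * n * N")
  case True
  define r e x where "r = j div N" and "e = cls i" and "x = j mod N"
  have "r = e div 2 \<longleftrightarrow> r div 3 = e div 2 div 3 \<and> r mod 3 = e div 2 mod 3"
    by (metis div_mult_mod_eq)
  then have "ent i j \<longleftrightarrow>
    r div 3 = e div 2 div 3 \<and> r mod 3 = e div 2 mod 3 \<and> (if even e then x < T else 2 * w \<le> x)"
    using True i unfolding entry_def r_def[symmetric] cls_def[symmetric] e_def[symmetric] x_def[symmetric]
    by simp
  also have "\<dots> \<longleftrightarrow> r div 3 = e div 2 div 3 \<and>
    hard_low (\<tau> (e div 2 div 3)) (e div 2 mod 3) e \<le> rod_key (\<tau> (e div 2 div 3)) (r mod 3) x \<and>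
    rod_key (\<tau> (e div 2 div 3)) (r mod 3) x < hard_high (\<tau> (e div 2 div 3)) (e div 2 mod 3) e"
    by (subst rod_hard(1)) (simp_all add: \<tau>_less)
  also have "\<dots> \<longleftrightarrow> Y i j"
    using True i unfolding Y_defs col_block_def row_block_def
      r_def[symmetric] e_def[symmetric] x_def[symmetric] by (simp cong: conj_cong)
  finally show ?thesis ..
next
  case False
  then show ?thesis using i clause_hard(1)
    by (auto simp: Y_def entry_def col_key_def row_low_def row_high_def)
qed

lemma Y_lit:
  assumes i: "2 * v + s < 2 * n" "s < 2" and j: "j < nc" and d: "Y (2 * v + s) j \<noteq> ent (2 * v + s) j"
  shows "s = \<tau> v \<and> (\<exists>c<m. j = cc c \<and> lit (2 * v + s) c \<and> \<sigma> c \<noteq> v) \<or>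
    s = 1 - \<tau> v \<and> ((\<exists>x<w. j = rc (3 * v + 1 + s) x) \<or> (\<exists>c<m. j = cc c \<and> lit (2 * v + s) c))"
proof -
  have dm: "(2 * v + s) div 2 = v" "(2 * v + s) mod 2 = s" using i(2) by auto
  have st: "s = \<tau> v \<or> s \<noteq> \<tau> v \<and> s = 1 - \<tau> v" using i(2) \<tau>_less[of v] by (auto simp: less_2_cases_iff)
  show ?thesis
  proof (cases "j < 3 * n * N")
    case True
    define r x where rx: "r = j div N" "x = j mod N"
    have jr: "j = rc r x" unfolding rx rc_def by simp
    have *: "r div 3 = v \<and> r mod 3 = k \<longleftrightarrow> r = 3 * v + k" if "k < 3" for k
    proof
      show "r = 3 * v + k" if "r div 3 = v \<and> r mod 3 = k" using that by (metis mult_div_mod_eq)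
      show "r div 3 = v \<and> r mod 3 = k" if "r = 3 * v + k" using that \<open>k < 3\<close> by simp
    qed
    have e: "ent (2 * v + s) j \<longleftrightarrow> r = 3 * v \<and> x < 2 * w \<or> r = 3 * v + 1 + s \<and> x < w"
      using True i by (simp add: entry_def dm rx)
    show ?thesis
    proof (cases "s = \<tau> v")
      case s: True
      have "Y (2 * v + s) j \<longleftrightarrow> r div 3 = v \<and> (r mod 3 = 0 \<and> x < 2 * w \<or> r mod 3 = 1 + \<tau> v \<and> x < w)"
        using True i s rod_lit(1)[of "\<tau> v" "r mod 3" x]
        by (auto simp: Y_defs col_block_def row_block_def dm rx)
      then have "Y (2 * v + s) j \<longleftrightarrow> ent (2 * v + s) j"
        unfolding e using *[of 0] *[of "1 + \<tau> v"] \<tau>_less[of v] s by auto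
      with d show ?thesis by simp
    next
      case s: False
      have "Y (2 * v + s) j \<longleftrightarrow> r div 3 = v \<and> r mod 3 = 0 \<and> x < 2 * w"
        using True i s rod_lit(2)[of "\<tau> v" "r mod 3" x]
        by (auto simp: Y_defs col_block_def row_block_def dm rx)
      then have "Y (2 * v + s) j \<longleftrightarrow> r = 3 * v \<and> x < 2 * w"
        using *[of 0] by auto
      with d e have "r = 3 * v + 1 + s" "x < w" by auto
      with s st jr show ?thesis by blast
    qed
  next
    case False
    define c where "c = j - 3 * n * N"
    have c: "c < m" "j = cc c" using False j by (auto simp: c_def ncols_def cc_def)
    have e: "ent (2 * v + s) j \<longleftrightarrow> lit (2 * v + s) c"
      using i by (simp add: c(2) entry_lit_cc)
    have Y: "Y (2 * v + s) j \<longleftrightarrow> \<sigma> c = v \<and> s = \<tau> v"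
      using False i by (auto simp: Y_defs col_block_def row_block_def dm c_def)
    have "lit (2 * v + s) c" if "\<sigma> c = v" "s = \<tau> v"
      using \<sigma>[OF c(1)] that by (simp add: \<tau>_def)
    then have "if s = \<tau> v then lit (2 * v + s) c \<and> \<sigma> c \<noteq> v else lit (2 * v + s) c"
      using d unfolding e Y by auto
    with st c show ?thesis by (auto split: if_splits)
  qed
qed

definition F :: "(nat \<times> nat) set" where
  "F = {(i, j). i < nr \<and> j < nc \<and> Y i j \<noteq> ent i j}"

text \<open>The bill is drawn up per variable: \<open>G1\<close> are the clauses of the true literal
  that were assigned to other variables, \<open>G2\<close> is the own head of the false literal, and
  \<open>G3\<close> are all its clauses. The occurrences \<open>S v\<close> that survive add up to
  one per clause.\<close>

lemma card_F: "card F \<le> K"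
proof -
  define l l' where "l v = 2 * v + \<tau> v" and "l' v = 2 * v + (1 - \<tau> v)" for v
  define G1 where "G1 v = (\<lambda>c. (l v, cc c)) ` {c. c < m \<and> lit (l v) c \<and> \<sigma> c \<noteq> v}" for v
  define G2 where "G2 v = (\<lambda>x. (l' v, rc (3 * v + 1 + (1 - \<tau> v)) x)) ` {..<w}" for v
  define G3 where "G3 v = (\<lambda>c. (l' v, cc c)) ` {c. c < m \<and> lit (l' v) c}" for v
  have "F \<subseteq> (\<Union>v<n. G1 v \<union> G2 v \<union> G3 v)"
  proof (rule subsetI)
    fix z assume "z \<in> F"
    then obtain i j where z: "z = (i, j)" and ij: "i < nr" "j < nc" "Y i j \<noteq> ent i j"
      by (auto simp: F_def)
    have i: "i < 2 * n" using ij(3) Y_hard[of i j] by (meson not_less)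
    define v s where "v = i div 2" and "s = i mod 2"
    have vs: "i = 2 * v + s" "s < 2" "v < n" using i by (auto simp: v_def s_def)
    have "z \<in> G1 v \<union> G2 v \<union> G3 v"
      using Y_lit[OF i[unfolded vs(1)] vs(2) ij(2) ij(3)[unfolded vs(1)]]
      unfolding z vs(1) G1_def G2_def G3_def l_def l'_def by auto
    with vs(3) show "z \<in> (\<Union>v<n. G1 v \<union> G2 v \<union> G3 v)" by blast
  qed
  then have "card F \<le> card (\<Union>v<n. G1 v \<union> G2 v \<union> G3 v)"
    by (rule card_mono[rotated]) (auto simp: G1_def G2_def G3_def)
  also have "\<dots> \<le> (\<Sum>v<n. card (G1 v \<union> G2 v \<union> G3 v))"
    by (rule card_UN_le) simp
  finally have 1: "card F \<le> (\<Sum>v<n. card (G1 v \<union> G2 v \<union> G3 v))" .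
  define S where "S v = {c. c < m \<and> \<sigma> c = v}" for v
  have 2: "card (G1 v \<union> G2 v \<union> G3 v) + card (S v) \<le>
    w + (card {c. c < m \<and> lit (2 * v) c} + card {c. c < m \<and> lit (2 * v + 1) c})" for v
  proof -
    have "card (G1 v) \<le> card {c. c < m \<and> lit (l v) c \<and> \<sigma> c \<noteq> v}"
      unfolding G1_def by (rule card_image_le) simp
    moreover have "card (G2 v) \<le> w"
      unfolding G2_def using card_image_le[of "{..<w}"] by simp
    moreover have "card (G3 v) \<le> card {c. c < m \<and> lit (l' v) c}"
      unfolding G3_def by (rule card_image_le) simp
    moreover have "card {c. c < m \<and> lit (l v) c} = card {c. c < m \<and> lit (l v) c \<and> \<sigma> c \<noteq> v} + card (S v)"
    proof -
      have "lit (l v) c" if "c < m" "\<sigma> c = v" for c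
        using \<sigma>[OF that(1)] that(2) by (simp add: l_def \<tau>_def split: if_splits)
      then have "{c. c < m \<and> lit (l v) c} = {c. c < m \<and> lit (l v) c \<and> \<sigma> c \<noteq> v} \<union> S v"
        by (auto simp: S_def)
      then show ?thesis by (simp add: card_Un_disjoint S_def disjoint_iff)
    qed
    moreover have "card (G1 v \<union> G2 v \<union> G3 v) \<le> card (G1 v) + card (G2 v) + card (G3 v)"
      using card_Un_le[of "G1 v \<union> G2 v" "G3 v"] card_Un_le[of "G1 v" "G2 v"] by linarith
    moreover have "card {c. c < m \<and> lit (l v) c} + card {c. c < m \<and> lit (l' v) c} =
      card {c. c < m \<and> lit (2 * v) c} + card {c. c < m \<and> lit (2 * v + 1) c}"
      by (auto simp: l_def l'_def \<tau>_def)
    ultimately show ?thesis by linarith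
  qed
  have "(\<Sum>v<n. card (S v)) = card (\<Union>v<n. S v)"
    by (rule card_UN_disjoint[symmetric]) (auto simp: S_def)
  also have "(\<Union>v<n. S v) = {..<m}" using \<sigma> by (auto simp: S_def)
  finally have 3: "(\<Sum>v<n. card (S v)) = m" by simp
  have "(\<Sum>v<n. card (G1 v \<union> G2 v \<union> G3 v) + card (S v)) \<le>
    (\<Sum>v<n. w + (card {c. c < m \<and> lit (2 * v) c} + card {c. c < m \<and> lit (2 * v + 1) c}))"
    by (intro sum_mono 2)
  also have "\<dots> = n * w + occs n m lit"
    unfolding occs_pairs by (simp add: sum.distrib)
  finally have "(\<Sum>v<n. card (G1 v \<union> G2 v \<union> G3 v)) + m \<le> n * w + occs n m lit"
    by (simp add: sum.distrib 3)
  with 1 show ?thesis by (simp add: budget_def)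
qed

text \<open>With keys below 12 and interval ends up to 12, the numbers
  \<open>12 * block + key\<close> arrange the blocks one after another, and no interval reaches into
  another block.\<close>

lemma keys_bounded: "col_key j < 12" "col_high j \<le> 12" "row_key i < 12" "row_high i \<le> 12"
  by (auto simp: col_key_def col_high_def row_key_def row_high_def rod_key_def rod_high_def
    hard_key_def hard_high_def)

lemma flip_SC1P: "SC1P (flip F (sat_mat n m lit))"
proof -
  have Y: "flip F (sat_mat n m lit) $$ (i, j) \<longleftrightarrow> Y i j" if "i < nr" "j < nc" for i j
    using that by (auto simp: flip_def sat_mat_def F_def)
  have "c1p (nr) nc (\<lambda>i j. flip F (sat_mat n m lit) $$ (i, j))"
    by (rule c1p_keysI[where p = "\<lambda>j. 12 * col_block j + col_key j" and
          a = "\<lambda>i. 12 * row_block i + row_low i" and b = "\<lambda>i. 12 * row_block i + row_high i"])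
      (simp add: Y block_interval[OF keys_bounded(1,4)], simp add: Y_def)
  moreover have "c1p nc (nr) (\<lambda>j i. flip F (sat_mat n m lit) $$ (i, j))"
    by (rule c1p_keysI[where p = "\<lambda>i. 12 * row_block i + row_key i" and
          a = "\<lambda>j. 12 * col_block j + col_low j" and b = "\<lambda>j. 12 * col_block j + col_high j"])
      (simp add: Y block_interval[OF keys_bounded(3,2)], simp add: Y_cols)
  moreover have "dim_row (flip F (sat_mat n m lit)) = nr"
    "dim_col (flip F (sat_mat n m lit)) = nc"
    by (auto simp: flip_def sat_mat_def)
  ultimately show ?thesis unfolding SC1P_c1p by simp
qed

lemma in_editing: "(sat_mat n m lit, budget n m lit) \<in> SC1P_editing"
proof -
  have "F \<subseteq> {..<dim_row (sat_mat n m lit)} \<times> {..<dim_col (sat_mat n m lit)}"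
    by (auto simp: F_def sat_mat_def)
  with card_F flip_SC1P show ?thesis unfolding SC1P_editing_def by blast
qed

end

theorem sat_mat_editing:
  assumes "0 < n" "\<And>v c. \<not> (lit (2 * v) c \<and> lit (2 * v + 1) c)"
  shows "(sat_mat n m lit, budget n m lit) \<in> SC1P_editing \<longleftrightarrow> satisfiable n m lit"
proof
  assume "satisfiable n m lit"
  then obtain \<alpha> where "\<forall>c<m. \<exists>v<n. lit (2 * v) c \<and> \<alpha> v \<or> lit (2 * v + 1) c \<and> \<not> \<alpha> v"
    unfolding satisfiable_def by blast
  then have "\<forall>c<m. \<exists>v<n. lit (2 * v + (if \<alpha> v then 0 else 1)) c" by fastforce
  then obtain \<sigma> where "\<And>c. c < m \<Longrightarrow> \<sigma> c < n \<and> lit (2 * \<sigma> c + (if \<alpha> (\<sigma> c) then 0 else 1)) c"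
    by metis
  then interpret satisfied_cnf n m lit \<alpha> \<sigma>
    by unfold_locales (use assms in auto)
  show "(sat_mat n m lit, budget n m lit) \<in> SC1P_editing" by (rule in_editing)
next
  assume "(sat_mat n m lit, budget n m lit) \<in> SC1P_editing"
  then obtain F where F: "F \<subseteq> {..<nrows n m lit} \<times> {..<ncols n m lit}" "card F \<le> budget n m lit"
    "SC1P (flip F (sat_mat n m lit))"
    unfolding SC1P_editing_def by (auto simp: sat_mat_def)
  define B where "B = flip F (sat_mat n m lit)"
  have "c1p (nrows n m lit) (ncols n m lit) (\<lambda>i j. B $$ (i, j))"
    using F(3) unfolding SC1P_c1p B_def by (simp add: flip_def sat_mat_def)
  from c1p_keysD[OF this] obtain p a b :: "nat \<Rightarrow> nat" where p: "inj_on p {..<ncols n m lit}" and ab: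
    "\<And>i j. i < nrows n m lit \<Longrightarrow> j < ncols n m lit \<Longrightarrow> B $$ (i, j) \<longleftrightarrow> a i \<le> p j \<and> p j < b i"
    by blast
  interpret edited_cnf n m lit F p "\<lambda>i j. B $$ (i, j)"
  proof unfold_locales
    show "finite F" using F(1) by (rule finite_subset) simp
    show "B $$ (i, j) \<longleftrightarrow> (entry n m lit i j \<longleftrightarrow> (i, j) \<notin> F)"
      if "i < nrows n m lit" "j < ncols n m lit" for i j
      using that by (auto simp: B_def flip_def sat_mat_def)
    show "B $$ (i, j2)" if "i < nrows n m lit" "j1 < ncols n m lit" "j2 < ncols n m lit" "j3 < ncols n m lit"
      "B $$ (i, j1)" "B $$ (i, j3)" "p j1 < p j2" "p j2 < p j3" for i j1 j2 j3
      using that ab by auto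
  qed (use assms F p in auto)
  show "satisfiable n m lit" by (rule edited_satisfiable)
qed

section \<open>Turing machine runs as CNF formulas\<close>

lemma digit_sum:
  fixes a :: "nat \<Rightarrow> nat"
  assumes "\<And>i. i < n \<Longrightarrow> a i < b" "j < n"
  shows "(\<Sum>i<n. a i * b ^ i) div b ^ j mod b = a j"
  using assms
proof (induction n arbitrary: a j)
  case (Suc n)
  have b: "0 < b" using Suc.prems(1)[of 0] by simp
  have s: "(\<Sum>i<Suc n. a i * b ^ i) = a 0 + b * (\<Sum>i<n. a (Suc i) * b ^ i)"
    unfolding sum.lessThan_Suc_shift by (simp add: sum_distrib_left algebra_simps)
  show ?case
  proof (cases j)
    case 0
    then show ?thesis unfolding s using Suc.prems(1)[of 0] by simp
  next
    case (Suc j')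
    have "(a 0 + b * (\<Sum>i<n. a (Suc i) * b ^ i)) div b ^ j = (\<Sum>i<n. a (Suc i) * b ^ i) div b ^ j'"
      unfolding Suc power_Suc div_mult2_eq using Suc.prems(1)[of 0] b by simp
    then show ?thesis unfolding s using Suc.IH[of "\<lambda>i. a (Suc i)" j'] Suc.prems Suc by simp
  qed
qed simp

lemma sum_digits_less:
  fixes a :: "nat \<Rightarrow> nat"
  assumes "\<And>i. i < n \<Longrightarrow> a i < b"
  shows "(\<Sum>i<n. a i * b ^ i) < b ^ n"
  using assms
proof (induction n)
  case (Suc n)
  have "Suc (a n) * b ^ n \<le> b * b ^ n" using Suc.prems[of n] by (intro mult_right_mono) auto
  with Suc.IH Suc.prems show ?case by simp
qed simp

locale verifier =
  fixes M :: tm and p q :: "nat poly" and V :: "bool list \<Rightarrow> bool list \<Rightarrow> bool"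
  assumes tm: "turing_machine M" and tapes: "2 < tm_tapes M"
    and comp: "\<And>x u. computes_within M [x, u] [V x u] (poly p (length x + length u))"
begin

text \<open>
  The tapes are recorded relative to their heads, so that a move shifts a whole tape. Track \<open>j < k\<close>
  is tape \<open>j\<close>, track \<open>k\<close> carries the state at the head position, and track \<open>k + 1\<close> moves with the
  output tape and marks its cell 0. A number \<open>z\<close> codes the symbols at the head positions.
\<close>

definition k :: nat where "k = tm_tapes M"
definition J :: nat where "J = k + 2"
definition B :: nat where "B = tm_symbols M + tm_states M + 1"
definition Z :: nat where "Z = B ^ J"

definition dig :: "nat \<Rightarrow> nat \<Rightarrow> nat" where "dig z j = z div B ^ j mod B"

definition trans :: "nat \<Rightarrow> nat \<times> (nat \<times> move) list" where
  "trans z = tm_delta M (dig z k) (map (dig z) [0..<k])"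

text \<open>The reduction modulo \<open>B\<close> concerns numbers \<open>z\<close> that code no
  configuration, where \<open>tm_delta\<close> may return anything.\<close>

definition wr :: "nat \<Rightarrow> nat \<Rightarrow> nat" where
  "wr z j = (if dig z k < tm_states M
     then if j < k then fst (snd (trans z) ! j) else if j = k then fst (trans z) else dig z j
     else dig z j) mod B"

text \<open>Displacement plus one: 0, 1, 2 mean left, stay, right. The state track never moves, as
  the state is recorded at the head; the marker track moves with tape 2, from which the result is
  read.\<close>

definition mv :: "nat \<Rightarrow> nat \<Rightarrow> nat" where
  "mv z j = (if dig z k < tm_states M \<and> j \<noteq> k
     then nat (displacement (snd (snd (trans z) ! (if j < k then j else 2))) + 1) else 1)"

definition cell :: "config \<Rightarrow> nat \<Rightarrow> int \<Rightarrow> nat" where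
  "cell c j d = (if j < k then cfg_cells c j (cfg_heads c j + d)
     else if j = k then if d = 0 then cfg_state c else 0
     else of_bool (cfg_heads c 2 + d = 0))"

definition run :: "bool list \<Rightarrow> bool list \<Rightarrow> nat \<Rightarrow> config" where
  "run x u t = (tm_step M ^^ t) (start_config [x, u])"

definition valid :: "config \<Rightarrow> bool" where
  "valid c \<longleftrightarrow> cfg_state c \<le> tm_states M \<and> (\<forall>j<k. \<forall>i. cfg_cells c j i < tm_symbols M)"

lemma B_ge: "3 \<le> B" "0 < B" using tm by (auto simp: B_def turing_machine_def)

lemma J_pos: "0 < J" by (simp add: J_def)

lemma k_ge: "2 < k" using tapes by (simp add: k_def)

lemma mv_le: "mv z j \<le> 2"
  unfolding mv_def by (cases "snd (snd (trans z) ! (if j < k then j else 2))") auto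

lemma wr_less: "wr z j < B"
  using B_ge by (simp add: wr_def)

lemma cell_less:
  assumes "valid c" shows "cell c j d < B"
proof -
  have "cfg_cells c j i < B" if "j < k" for i
  proof -
    have "cfg_cells c j i < tm_symbols M" using assms that by (simp add: valid_def)
    then show ?thesis by (simp add: B_def)
  qed
  moreover have "cfg_state c < B" using assms by (simp add: valid_def B_def)
  ultimately show ?thesis using B_ge by (auto simp: cell_def)
qed

lemma delta:
  assumes "valid c" "cfg_state c < tm_states M" "tm_delta M (cfg_state c) (scanned M c) = (q', acts)"
  shows "q' \<le> tm_states M" "length acts = k" "\<And>j. j < k \<Longrightarrow> fst (acts ! j) < tm_symbols M"
proof -
  have "length (scanned M c) = tm_tapes M" "set (scanned M c) \<subseteq> {..<tm_symbols M}"
    using assms(1) by (auto simp: scanned_def valid_def k_def)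
  with tm assms(2,3) have *: "q' \<le> tm_states M" "length acts = k" "fst ` set acts \<subseteq> {..<tm_symbols M}"
    unfolding turing_machine_def k_def by (metis fst_conv snd_conv)+
  then show "q' \<le> tm_states M" "length acts = k" by blast+
  show "fst (acts ! j) < tm_symbols M" if "j < k" for j
    using that * by (metis image_subset_iff lessThan_iff nth_mem)
qed

lemma valid_step:
  assumes "valid c" shows "valid (tm_step M c)"
proof (cases "cfg_state c < tm_states M")
  case True
  obtain q' acts where d: "tm_delta M (cfg_state c) (scanned M c) = (q', acts)" by fastforce
  show ?thesis
    using assms delta[OF assms True d] True by (auto simp: tm_step_def d valid_def k_def)
qed (use assms in \<open>simp add: tm_step_def\<close>)

lemma valid_run: "valid (run x u t)"
proof (induction t)
  case 0
  have "3 \<le> tm_symbols M" using tm by (simp add: turing_machine_def)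
  then show ?case by (auto simp: run_def valid_def start_config_def tape_of_def)
qed (simp add: run_def valid_step)

lemma heads_run: "j < k \<Longrightarrow> \<bar>cfg_heads (run x u t) j\<bar> \<le> int t"
proof (induction t)
  case (Suc t)
  have d: "\<bar>displacement a\<bar> \<le> 1" for a by (cases a) auto
  have "\<bar>cfg_heads (tm_step M c) j\<bar> \<le> \<bar>cfg_heads c j\<bar> + 1" for c
    using d by (auto simp: tm_step_def split: prod.splits intro!: order_trans[OF abs_triangle_ineq])
  from this[of "run x u t"] Suc show ?case by (simp add: run_def)
qed (simp add: run_def start_config_def)

text \<open>What is at distance \<open>d\<close> after the move was at \<open>d\<close> plus the
  displacement before it, and only the cell at distance 0 was rewritten. A halted machine fits in
  with displacement 0 and unchanged symbols.\<close>

lemma cell_step: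
  assumes c: "valid c" and j: "j < J" and z: "\<And>j. j < J \<Longrightarrow> dig z j = cell c j 0"
  shows "cell (tm_step M c) j d =
    (if d + int (mv z j) - 1 = 0 then wr z j else cell c j (d + int (mv z j) - 1))"
proof -
  have st: "dig z k = cfg_state c" using z[of k] by (simp add: J_def cell_def)
  have mod: "cell c i e mod B = cell c i e" for i e using cell_less[OF c] by simp
  show ?thesis
  proof (cases "cfg_state c < tm_states M")
    case True
    have "map (dig z) [0..<k] = scanned M c"
      unfolding scanned_def k_def[symmetric] by (rule map_cong) (auto simp: z J_def cell_def)
    then have tr: "trans z = tm_delta M (cfg_state c) (scanned M c)"
      by (simp add: trans_def st)
    obtain q' acts where d: "tm_delta M (cfg_state c) (scanned M c) = (q', acts)" by fastforce
    note D = delta[OF c True d]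
    have mvd: "int (mv z i) - 1 = (if i = k then 0 else displacement (snd (acts ! (if i < k then i else 2))))" for i
      using True by (cases "snd (acts ! (if i < k then i else 2))") (auto simp: mv_def st tr d)
    have dm: "d + int (mv z j) - 1 = d + (if j = k then 0 else displacement (snd (acts ! (if j < k then j else 2))))"
      using mvd[of j] by linarith
    have wrd: "wr z j = (if j < k then fst (acts ! j) else if j = k then q' else cell c j 0)"
    proof -
      have "a mod B = a" if "a < tm_symbols M \<or> a \<le> tm_states M" for a
        using that by (intro mod_less) (auto simp: B_def)
      with True D j z[OF j] mod show ?thesis by (auto simp: wr_def st tr d)
    qed
    consider "j < k" | "j = k" | "j = k + 1" using j unfolding J_def by linarith
    then show ?thesis
    proof cases
      case 1
      then show ?thesis unfolding dm wrd using True
        by (auto simp: cell_def tm_step_def d k_def[symmetric] algebra_simps)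
    next
      case 2
      then show ?thesis unfolding dm wrd using True
        by (auto simp: cell_def tm_step_def d)
    next
      case 3
      then show ?thesis unfolding dm wrd using True k_ge
        by (auto simp: cell_def tm_step_def d k_def[symmetric] algebra_simps)
    qed
  next
    case False
    then have "mv z j = 1" "wr z j = cell c j 0"
      using z[OF j] mod by (auto simp: mv_def wr_def st)
    with False show ?thesis by (auto simp: tm_step_def)
  qed
qed

definition center :: "config \<Rightarrow> nat" where
  "center c = (\<Sum>j<J. cell c j 0 * B ^ j)"

lemma center:
  assumes "valid c"
  shows "center c < Z" "\<And>j. j < J \<Longrightarrow> dig (center c) j = cell c j 0"
  using cell_less[OF assms] unfolding center_def Z_def dig_def
  by (auto intro: sum_digits_less digit_sum)

definition guess :: "bool list \<Rightarrow> nat" where "guess x = poly q (length x)"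
definition time :: "bool list \<Rightarrow> nat" where "time x = poly p (length x + guess x)"
text \<open>Position of the heads in a window of \<open>width\<close> cells. One \<open>time\<close>
  makes up for the cell that is lost at each end of the window per step, the other for the distance
  of the output head from cell 0, and \<open>guess\<close> makes room for the certificate.\<close>

definition mid :: "bool list \<Rightarrow> nat" where "mid x = 2 * time x + guess x + 2"
abbreviation track :: "bool list \<Rightarrow> bool list \<Rightarrow> nat \<Rightarrow> nat \<Rightarrow> nat \<Rightarrow> nat" where
  "track x u t j i \<equiv> cell (run x u t) j (int i - int (mid x))"

definition width :: "bool list \<Rightarrow> nat" where "width x = 2 * mid x + 1"

text \<open>The propositional variable for symbol \<open>e\<close> on track \<open>j\<close> at
  window position \<open>i\<close> and time \<open>t\<close>, numbered in mixed radix.\<close>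

definition atom :: "bool list \<Rightarrow> nat \<Rightarrow> nat \<Rightarrow> nat \<Rightarrow> nat \<Rightarrow> nat" where
  "atom x t j i e = ((t * J + j) * width x + i) * B + e"

definition nvars :: "bool list \<Rightarrow> nat" where
  "nvars x = Suc (time x) * J * width x * B"

text \<open>Index \<open>i\<close> stands for window position \<open>i + 1\<close>: the border has
  no clauses, since the rule for a position refers to positions \<open>i\<close> to
  \<open>i + 2\<close>. Clauses that ignore some parameters simply occur repeatedly.\<close>

definition cl :: "bool list \<Rightarrow> nat \<Rightarrow> nat \<Rightarrow> nat \<Rightarrow> nat \<Rightarrow> nat \<Rightarrow> nat" where
  "cl x t j i z e = (((t * J + j) * (width x - 2) + i) * Z + z) * B + e"

definition nclauses :: "bool list \<Rightarrow> nat" where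
  "nclauses x = (time x + 2) * J * (width x - 2) * Z * B"

definition cE :: "nat \<Rightarrow> nat" where "cE c = c mod B"
definition cZ :: "nat \<Rightarrow> nat" where "cZ c = c div B mod Z"
definition cI :: "bool list \<Rightarrow> nat \<Rightarrow> nat" where "cI x c = c div B div Z mod (width x - 2)"
definition cJ :: "bool list \<Rightarrow> nat \<Rightarrow> nat" where "cJ x c = c div B div Z div (width x - 2) mod J"
definition cT :: "bool list \<Rightarrow> nat \<Rightarrow> nat" where "cT x c = c div B div Z div (width x - 2) div J"

text \<open>The start state 0 coincides with the filler of the state track, so that track starts as
  0 throughout. On track 1 the value 0 is imposed only outside \<open>guessed\<close>.\<close>

definition initial :: "bool list \<Rightarrow> nat \<Rightarrow> nat \<Rightarrow> nat" where
  "initial x j i = (if j = 0 then if mid x \<le> i \<and> i - mid x < length x then if bit_at x (i - mid x) then 2 else 1 else 0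
     else of_bool (j = k + 1 \<and> i = mid x))"

definition guessed :: "bool list \<Rightarrow> nat \<Rightarrow> nat \<Rightarrow> bool" where
  "guessed x j i \<longleftrightarrow> j = 1 \<and> mid x \<le> i \<and> i < mid x + guess x"

text \<open>
  The clauses with \<open>cT < time\<close> say how the track contents at time \<open>cT + 1\<close> follow from those at
  time \<open>cT\<close>, the clauses with \<open>cT = time\<close> describe the initial tracks, and those with
  \<open>cT = time + 1\<close> forbid the output 0.
\<close>

definition pos_lit :: "bool list \<Rightarrow> nat \<Rightarrow> nat \<Rightarrow> bool" where
  "pos_lit x v c \<longleftrightarrow>
     (if cT x c < time x then
        v = atom x (cT x c + 1) (cJ x c) (cI x c + 1)
          (if cI x c + mv (cZ c) (cJ x c) = mid x then wr (cZ c) (cJ x c) else cE c)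
      else if cT x c = time x then
        if guessed x (cJ x c) (cI x c + 1) then
          if cE c = 0 then v = atom x 0 1 (cI x c + 1) 0 \<or> v = atom x 0 1 (cI x c + 1) 1 \<or> v = atom x 0 1 (cI x c + 1) 2
          else v = atom x 0 1 (cI x c + 2) 0
        else v = atom x 0 (cJ x c) (cI x c + 1) (initial x (cJ x c) (cI x c + 1))
      else False)"

text \<open>The premises of a step are the symbol to be shifted and all symbols at the heads as
  coded by \<open>z\<close>. In the guessed part, a blank forces a blank to its right, so that the
  cells spell a word; only the clauses offering the symbols 0, 1, 2 there have several positive
  literals. Output 0 means symbol 1 at the marker of cell 0.\<close>

definition neg_lit :: "bool list \<Rightarrow> nat \<Rightarrow> nat \<Rightarrow> bool" where
  "neg_lit x v c \<longleftrightarrow>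
     (if cT x c < time x then
        v = atom x (cT x c) (cJ x c) (cI x c + mv (cZ c) (cJ x c)) (cE c) \<or>
        (\<exists>j<J. v = atom x (cT x c) j (mid x) (dig (cZ c) j))
      else if cT x c = time x then
        guessed x (cJ x c) (cI x c + 1) \<and> cE c \<noteq> 0 \<and> v = atom x 0 1 (cI x c + 1) 0
      else v = atom x (time x) (k + 1) (cI x c + 1) 1 \<or> v = atom x (time x) 2 (cI x c + 1) 1)"

definition lit :: "bool list \<Rightarrow> nat \<Rightarrow> nat \<Rightarrow> bool" where
  "lit x l c \<longleftrightarrow> (if even l then pos_lit x (l div 2) c else neg_lit x (l div 2) c)"

lemma width_ge: "3 < width x" "width x - 2 = 2 * mid x - 1" "0 < width x - 2"
  by (auto simp: width_def mid_def)

lemma Z_pos: "0 < Z" using B_ge by (simp add: Z_def)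

lemma cl_decode:
  assumes "j < J" "i < width x - 2" "z < Z" "e < B"
  shows "cE (cl x t j i z e) = e" "cZ (cl x t j i z e) = z" "cI x (cl x t j i z e) = i"
    "cJ x (cl x t j i z e) = j" "cT x (cl x t j i z e) = t"
  using assms by (auto simp: cl_def cE_def cZ_def cI_def cJ_def cT_def)

lemma mixed_radix_less:
  fixes a b c d :: nat assumes "a < b" "c < d" shows "a * d + c < b * d"
proof -
  have "a * d + c < Suc a * d" using assms by simp
  also have "\<dots> \<le> b * d" using assms by (intro mult_right_mono) auto
  finally show ?thesis .
qed

lemma cl_less:
  assumes "t < time x + 2" "j < J" "i < width x - 2" "z < Z" "e < B"
  shows "cl x t j i z e < nclauses x"
  unfolding cl_def nclauses_def by (intro mixed_radix_less assms)

lemma atom_less: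
  assumes "t \<le> time x" "j < J" "i < width x" "e < B"
  shows "atom x t j i e < nvars x"
  unfolding atom_def nvars_def by (intro mixed_radix_less assms) (use assms in simp)

lemma c_bounds: "cE c < B" "cZ c < Z" "cI x c < width x - 2" "cJ x c < J"
  using B_ge Z_pos width_ge(3)[of x] J_pos by (simp_all add: cE_def cZ_def cI_def cJ_def)

lemma cT_less: "c < nclauses x \<Longrightarrow> cT x c < time x + 2"
  unfolding cT_def nclauses_def by (intro less_mult_imp_div_less) (simp add: mult.assoc)

definition aE :: "nat \<Rightarrow> nat" where "aE v = v mod B"
definition aI :: "bool list \<Rightarrow> nat \<Rightarrow> nat" where "aI x v = v div B mod width x"
definition aJ :: "bool list \<Rightarrow> nat \<Rightarrow> nat" where "aJ x v = v div B div width x mod J"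
definition aT :: "bool list \<Rightarrow> nat \<Rightarrow> nat" where "aT x v = v div B div width x div J"

lemma atom_decode:
  assumes "j < J" "i < width x" "e < B"
  shows "aE (atom x t j i e) = e" "aI x (atom x t j i e) = i" "aJ x (atom x t j i e) = j"
    "aT x (atom x t j i e) = t"
  using assms by (auto simp: atom_def aE_def aI_def aJ_def aT_def)

lemma dig_less: "dig z j < B" using B_ge by (simp add: dig_def)

lemma initial_less: "initial x j i < B" using B_ge by (simp add: initial_def)

lemma cI_bounds: "cI x c + 1 < width x" "cI x c + 2 < width x" "cI x c + mv z j < width x"
  using c_bounds(3)[of x c] mv_le[of z j] by (auto simp: width_def)

lemma mid_less: "mid x < width x"
  by (simp add: width_def)

text \<open>Required by the matrix construction. Premise and conclusion differ in time for the step
  clauses and in position for the guessed cells.\<close>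

lemma lit_no_taut: "\<not> (lit x (2 * v) c \<and> lit x (2 * v + 1) c)"
proof
  assume *: "lit x (2 * v) c \<and> lit x (2 * v + 1) c"
  then have P: "pos_lit x v c" and N: "neg_lit x v c" by (auto simp: lit_def)
  note b = c_bounds(1)[of c] c_bounds(4)[of x c] cI_bounds[of x c] mid_less[of x] dig_less wr_less B_ge
  show False
  proof (cases "cT x c < time x")
    case True
    have "aT x v = cT x c + 1"
      using P True b by (auto simp: pos_lit_def atom_decode)
    moreover have "aT x v = cT x c"
      using N True b by (auto simp: neg_lit_def atom_decode)
    ultimately show False by simp
  next
    case False
    then have t: "cT x c = time x" using P by (auto simp: pos_lit_def split: if_splits)
    then have g: "guessed x (cJ x c) (cI x c + 1)" "cE c \<noteq> 0" "v = atom x 0 1 (cI x c + 1) 0"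
      using N by (auto simp: neg_lit_def)
    then have v: "v = atom x 0 1 (cI x c + 2) 0" using P t by (simp add: pos_lit_def)
    have J: "1 < J" using k_ge by (simp add: J_def)
    have "aI x v = cI x c + 2" unfolding v by (rule atom_decode(2)[OF J]) (use b in auto)
    moreover have "aI x v = cI x c + 1" unfolding g(3) by (rule atom_decode(2)[OF J]) (use b in auto)
    ultimately show False by simp
  qed
qed

lemma run_time:
  assumes "length u \<le> guess x"
  shows "cfg_cells (run x u (time x)) 2 0 = (if V x u then 2 else 1)"
proof -
  define t where "t = poly p (length x + length u)"
  have "t \<le> time x" unfolding t_def time_def using assms by (intro poly_nat_mono) simp
  have h: "cfg_state (run x u t) = tm_states M" and o: "cfg_cells (run x u t) 2 0 = tape_of [V x u] 0"
    using comp[of x u] by (auto simp: computes_within_def run_def t_def Let_def numeral_2_eq_2)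
  have "run x u (time x) = (tm_step M ^^ (time x - t)) (run x u t)"
    unfolding run_def using \<open>t \<le> time x\<close> by (metis funpow_add o_apply le_add_diff_inverse2)
  then have "run x u (time x) = run x u t" using h by (simp add: tm_step_halted)
  then show ?thesis using o by (simp add: tape_of_def)
qed

lemma run_Suc: "run x u (Suc t) = tm_step M (run x u t)"
  by (simp add: run_def)

lemma cell_run_0:
  assumes "j < J"
  shows "track x u 0 j i =
    (if j = 1 then tape_of u (int i - int (mid x)) else initial x j i)"
  using assms k_ge by (auto simp: run_def start_config_def cell_def initial_def tape_of_def bit_at_def nat_diff_distrib J_def)

text \<open>The assignment records the actual run on \<open>u\<close>, of which every clause is a
  true statement.\<close>

lemma accepted_satisfiable:
  assumes u: "length u \<le> guess x" "V x u"
  shows "satisfiable (nvars x) (nclauses x) (lit x)"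
  unfolding satisfiable_def
proof (rule exI, intro allI impI)
  define \<alpha> where "\<alpha> v \<longleftrightarrow> track x u (aT x v) (aJ x v) (aI x v) = aE v" for v
  fix c assume "c < nclauses x"
  note t2 = cT_less[OF this]
  have A: "\<alpha> (atom x t j i e) \<longleftrightarrow> track x u t j i = e"
    if "j < J" "i < width x" "e < B" for t j i e
    using that by (simp add: \<alpha>_def atom_decode)
  note b = c_bounds(1)[of c] c_bounds(4)[of x c] cI_bounds[of x c] mid_less[of x] dig_less wr_less B_ge initial_less
  have J: "k + 1 < J" "2 < J" "1 < J" using k_ge by (auto simp: J_def)
  define t j i z e where tj: "t = cT x c" "j = cJ x c" "i = cI x c" "z = cZ c" "e = cE c"
  note b = b[folded tj]
  have "\<exists>v<nvars x. pos_lit x v c \<and> \<alpha> v \<or> neg_lit x v c \<and> \<not> \<alpha> v"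
  proof (cases "t < time x")
    case True
    have N: "neg_lit x v c \<longleftrightarrow> v = atom x t j (i + mv z j) e \<or> (\<exists>j<J. v = atom x t j (mid x) (dig z j))"
      and P: "pos_lit x v c \<longleftrightarrow> v = atom x (t + 1) j (i + 1) (if i + mv z j = mid x then wr z j else e)" for v
      using True by (simp_all add: neg_lit_def pos_lit_def tj)
    \<comment> \<open>Either a premise of the clause fails in the run, or \<open>cell_step\<close>
      yields its conclusion.\<close>
    consider j' where "j' < J" "cell (run x u t) j' 0 \<noteq> dig z j'"
      | "track x u t j (i + mv z j) \<noteq> e"
      | "\<And>j'. j' < J \<Longrightarrow> dig z j' = cell (run x u t) j' 0"
        "track x u t j (i + mv z j) = e" by metis
    then show ?thesis
    proof cases
      case (1 j')
      then show ?thesis using True b N A[of j' "mid x" "dig z j'" t]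
        by (intro exI[of _ "atom x t j' (mid x) (dig z j')"]) (auto intro!: atom_less)
    next
      case 2
      then show ?thesis using True b N A[of j "i + mv z j" e t]
        by (intro exI[of _ "atom x t j (i + mv z j) e"]) (auto intro!: atom_less)
    next
      case 3
      have "track x u (t + 1) j (i + 1) =
        (if i + mv z j = mid x then wr z j else e)"
        using cell_step[OF valid_run[of x u t] b(2) 3(1), of "int (i + 1) - int (mid x)"] 3(2)
        by (auto simp: run_Suc algebra_simps)
      then show ?thesis
        using True b P A[of j "i + 1" "if i + mv z j = mid x then wr z j else e" "t + 1"]
        by (intro exI[of _ "atom x (t + 1) j (i + 1) (if i + mv z j = mid x then wr z j else e)"])
          (auto intro!: atom_less)
    qed
  next
    case False
    show ?thesis
    proof (cases "t = time x")
      case t: True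
      have c0: "track x u 0 j (i + 1) =
        (if j = 1 then tape_of u (int (i + 1) - int (mid x)) else initial x j (i + 1))"
        "track x u 0 1 (i + 2) = tape_of u (int (i + 2) - int (mid x))"
        using cell_run_0[OF b(2), of x u "i + 1"] cell_run_0[OF J(3), of x u "i + 2"] by simp_all
      show ?thesis
      proof (cases "guessed x j (i + 1)")
        case g: True
        then have j1: "j = 1" and im: "mid x \<le> i + 1" by (auto simp: guessed_def)
        define f where "f = tape_of u (int (i + 1) - int (mid x))"
        have f: "f = 0 \<or> f = 1 \<or> f = 2" by (auto simp: f_def tape_of_def)
        have A1: "\<alpha> (atom x 0 1 (i + 1) f)" using A[OF J(3), of "i + 1" f 0] c0(1) f b B_ge j1 by (auto simp: f_def)
        have lt: "atom x 0 1 (i + 1) f < nvars x" using b f B_ge J by (intro atom_less) auto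
        show ?thesis
        proof (cases "e = 0")
          case True
          then have "pos_lit x (atom x 0 1 (i + 1) f) c"
            using t g f by (auto simp: pos_lit_def tj)
          then show ?thesis using A1 lt by blast
        next
          case e: False
          have N: "neg_lit x (atom x 0 1 (i + 1) 0) c" and P: "pos_lit x (atom x 0 1 (i + 2) 0) c"
            using t g e by (auto simp: neg_lit_def pos_lit_def tj)
          have "atom x 0 1 (i + 1) 0 < nvars x" "atom x 0 1 (i + 2) 0 < nvars x"
            using b B_ge J by (auto intro!: atom_less)
          moreover have "\<not> \<alpha> (atom x 0 1 (i + 1) 0) \<or> \<alpha> (atom x 0 1 (i + 2) 0)"
            using A[OF J(3), of "i + 1" 0 0] A[OF J(3), of "i + 2" 0 0] c0 b B_ge j1 im
            by (auto simp: tape_of_def split: if_splits)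
          ultimately show ?thesis using N P by blast
        qed
      next
        case g: False
        have "track x u 0 j (i + 1) = initial x j (i + 1)"
        proof (cases "j = 1")
          case True
          then have "i + 1 < mid x \<or> mid x + length u \<le> i + 1"
            using g u(1) by (auto simp: guessed_def)
          then have "tape_of u (int (i + 1) - int (mid x)) = 0" by (auto simp: tape_of_def)
          then show ?thesis using c0(1) True k_ge by (simp add: initial_def)
        qed (use c0 in simp)
        then have "\<alpha> (atom x 0 j (i + 1) (initial x j (i + 1)))"
          using A[of j "i + 1" "initial x j (i + 1)" 0] b initial_less by simp
        moreover have "pos_lit x (atom x 0 j (i + 1) (initial x j (i + 1))) c"
          using t g by (simp add: pos_lit_def tj)
        moreover have "atom x 0 j (i + 1) (initial x j (i + 1)) < nvars x"
          using b initial_less by (intro atom_less) auto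
        ultimately show ?thesis by blast
      qed
    next
      case t: False
      have N: "neg_lit x v c \<longleftrightarrow> v = atom x (time x) (k + 1) (i + 1) 1 \<or> v = atom x (time x) 2 (i + 1) 1" for v
        using False t by (simp add: neg_lit_def tj)
      have lt: "atom x (time x) (k + 1) (i + 1) 1 < nvars x" "atom x (time x) 2 (i + 1) 1 < nvars x"
        using b J B_ge by (auto intro!: atom_less)
      have "\<not> (track x u (time x) (k + 1) (i + 1) = 1 \<and>
          track x u (time x) 2 (i + 1) = 1)"
        using run_time[OF u(1)] u(2) k_ge by (auto simp: cell_def)
      then have "\<not> \<alpha> (atom x (time x) (k + 1) (i + 1) 1) \<or> \<not> \<alpha> (atom x (time x) 2 (i + 1) 1)"
        using A[OF J(1), of "i + 1" 1 "time x"] A[OF J(2), of "i + 1" 1 "time x"] b B_ge by auto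
      with N lt show ?thesis by blast
    qed
  qed
  then show "\<exists>v<nvars x. lit x (2 * v) c \<and> \<alpha> v \<or> lit x (2 * v + 1) c \<and> \<not> \<alpha> v"
    by (auto simp: lit_def)
qed

text \<open>An assignment may put several symbols into one cell. It suffices that it contains one
  run: a word \<open>u\<close> is chosen from the guessed cells, and following the implications
  makes all atoms of the run on \<open>u\<close> true, so that the last clauses exclude output
  0.\<close>

lemma satisfiable_accepted:
  assumes "satisfiable (nvars x) (nclauses x) (lit x)"
  shows "\<exists>u. length u \<le> guess x \<and> V x u"
proof -
  from assms obtain \<alpha> where sat: "\<And>c. c < nclauses x \<Longrightarrow>
      (\<exists>v. pos_lit x v c \<and> \<alpha> v) \<or> (\<exists>v. neg_lit x v c \<and> \<not> \<alpha> v)"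
    unfolding satisfiable_def lit_def by auto blast
  have J: "k + 1 < J" "2 < J" "1 < J" using k_ge by (auto simp: J_def)
  let ?h = "mid x"
  define Q where "Q = guess x"
  have Qh: "Q < ?h" by (simp add: Q_def mid_def)
  have init: "\<alpha> (atom x 0 j (i + 1) (initial x j (i + 1)))"
    if "j < J" "i < width x - 2" "\<not> guessed x j (i + 1)" for j i
    using sat[OF cl_less[OF _ that(1,2) Z_pos B_ge(2), of "time x"]] that cl_decode[OF that(1,2) Z_pos B_ge(2), of "time x"]
    by (auto simp: pos_lit_def neg_lit_def)
  have g0: "\<alpha> (atom x 0 1 (i + 1) 0) \<or> \<alpha> (atom x 0 1 (i + 1) 1) \<or> \<alpha> (atom x 0 1 (i + 1) 2)"
    and g1: "\<alpha> (atom x 0 1 (i + 1) 0) \<Longrightarrow> \<alpha> (atom x 0 1 (i + 2) 0)"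
    if "i < width x - 2" "guessed x 1 (i + 1)" for i
  proof -
    have B1: "1 < B" using B_ge by simp
    show "\<alpha> (atom x 0 1 (i + 1) 0) \<or> \<alpha> (atom x 0 1 (i + 1) 1) \<or> \<alpha> (atom x 0 1 (i + 1) 2)"
      using sat[OF cl_less[OF _ J(3) that(1) Z_pos B_ge(2), of "time x"]] that cl_decode[OF J(3) that(1) Z_pos B_ge(2), of "time x"]
      by (auto simp: pos_lit_def neg_lit_def)
    show "\<alpha> (atom x 0 1 (i + 1) 0) \<Longrightarrow> \<alpha> (atom x 0 1 (i + 2) 0)"
      using sat[OF cl_less[OF _ J(3) that(1) Z_pos B1, of "time x"]] that cl_decode[OF J(3) that(1) Z_pos B1, of "time x"]
      by (auto simp: pos_lit_def neg_lit_def)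
  qed
  define a where "a d e \<longleftrightarrow> \<alpha> (atom x 0 1 (?h + d) e)" for d e
  have in_range: "?h + d - 1 < width x - 2" "?h + d - 1 + 1 = ?h + d" "?h + d - 1 + 2 = ?h + Suc d"
    if "d < ?h" for d
    using that by (auto simp: width_def mid_def)
  have a0: "a d 0 \<or> a d 1 \<or> a d 2" and a1: "a d 0 \<Longrightarrow> a (Suc d) 0" if "d < Q" for d
    using g0[OF in_range(1)[of d]] g1[OF in_range(1)[of d]] in_range(2,3)[of d] that Qh
    by (auto simp: a_def guessed_def Q_def)
  have a2: "a d 0" if "Q \<le> d" "d < ?h" for d
    using init[OF J(3) in_range(1)[of d]] in_range(2)[of d] that k_ge
    by (simp add: a_def guessed_def Q_def initial_def)
  \<comment> \<open>The word ends at the first guessed cell that may be blank, at the latest after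
    \<open>Q\<close> cells.\<close>
  define l where "l = (LEAST d. d = Q \<or> a d 0)"
  have l: "l = Q \<or> a l 0" "l \<le> Q"
    unfolding l_def by (rule LeastI[of _ Q]; simp) (rule Least_le; simp)
  have before: "\<not> a d 0" "d < Q" if "d < l" for d
    using not_less_Least[of d "\<lambda>d. d = Q \<or> a d 0"] that l(2) by (auto simp: l_def[symmetric])
  have after: "a (l + d) 0" if "l + d < ?h" for d
    using that
  proof (induction d)
    case 0
    then show ?case using l a2[of l] by auto
  next
    case (Suc d)
    then show ?case using a1[of "l + d"] a2[of "l + Suc d"] by (cases "l + d < Q") auto
  qed
  \<comment> \<open>Before \<open>l\<close> symbol 0 is excluded, so symbol 1 or 2 is available; if
    both are, bit 1 is taken.\<close>
  define u where "u = map (\<lambda>d. a d 2) [0..<l]"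
  have lu: "length u \<le> guess x" using l(2) by (simp add: u_def Q_def)
  have a_tape: "a d (tape_of u (int d))" if "d < ?h" for d
  proof (cases "d < l")
    case True
    then show ?thesis using before[OF True] a0[of d] by (auto simp: u_def tape_of_nth)
  next
    case False
    then show ?thesis using after[of "d - l"] that by (simp add: u_def tape_of_nth)
  qed
  \<comment> \<open>Each step shrinks the range by one cell at both ends, because a move may bring
    in a neighbour.\<close>
  have main: "\<alpha> (atom x t j i (track x u t j i))"
    if "t \<le> time x" "j < J" "t + 1 \<le> i" "i + t + 1 < width x" for t j i
    using that
  proof (induction t arbitrary: j i)
    case 0
    then have i: "i - 1 < width x - 2" "i - 1 + 1 = i" by auto
    show ?case
    proof (cases "j = 1")
      case True
      show ?thesis
      proof (cases "?h \<le> i")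
        case h: True
        have "i - ?h < ?h" using 0 by (simp add: width_def)
        from a_tape[OF this] show ?thesis
          unfolding cell_run_0[OF \<open>j < J\<close>] using True h by (simp add: a_def of_nat_diff)
      next
        case False
        then have "tape_of u (int i - int ?h) = 0" "initial x j i = 0" using True k_ge
          by (auto simp: tape_of_def initial_def)
        then show ?thesis
          unfolding cell_run_0[OF \<open>j < J\<close>] using init[OF \<open>j < J\<close> i(1)] i(2) False True
          by (simp add: guessed_def)
      qed
    next
      case False
      then show ?thesis
        unfolding cell_run_0[OF \<open>j < J\<close>] using init[OF \<open>j < J\<close> i(1)] i(2)
        by (simp add: guessed_def)
    qed
  next
    case (Suc t)
    define z where "z = center (run x u t)"
    have z: "z < Z" "\<And>j. j < J \<Longrightarrow> dig z j = cell (run x u t) j 0"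
      unfolding z_def by (rule center[OF valid_run])+
    define i' where "i' = i - 1"
    have i': "i' < width x - 2" "i = i' + 1" using Suc.prems by (auto simp: i'_def)
    define e where "e = track x u t j (i' + mv z j)"
    have e: "e < B" unfolding e_def by (rule cell_less[OF valid_run])
    have IH1: "\<alpha> (atom x t j (i' + mv z j) e)"
      unfolding e_def by (rule Suc.IH) (use Suc.prems i' mv_le[of z j] in auto)
    have IH2: "\<alpha> (atom x t j' ?h (dig z j'))" if "j' < J" for j'
      using Suc.IH[of j' ?h] that Suc.prems by (simp add: z(2) width_def mid_def)
    define c where "c = cl x t j i' z e"
    note cd = cl_decode[OF \<open>j < J\<close> i'(1) z(1) e, of t, folded c_def]
    have "c < nclauses x"
      unfolding c_def by (rule cl_less[OF _ \<open>j < J\<close> i'(1) z(1) e]) (use Suc.prems in simp)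
    from sat[OF this] have "\<alpha> (atom x (t + 1) j (i' + 1) (if i' + mv z j = ?h then wr z j else e))"
      using Suc.prems IH1 IH2 by (auto simp: pos_lit_def neg_lit_def cd)
    moreover have "track x u (Suc t) j i = (if i' + mv z j = ?h then wr z j else e)"
      using cell_step[OF valid_run[of x u t] \<open>j < J\<close> z(2), of "int i - int ?h"]
      by (auto simp: run_Suc e_def i'(2) algebra_simps)
    ultimately show ?case by (simp add: i'(2))
  qed
  define d where "d = cfg_heads (run x u (time x)) 2"
  have d: "\<bar>d\<bar> \<le> int (time x)" unfolding d_def using k_ge by (intro heads_run) simp
  \<comment> \<open>The window position of cell 0 of the output tape.\<close>
  define i where "i = nat (int ?h - d)"
  have i: "int i = int ?h - d" using d by (simp add: i_def mid_def)
  have ir: "time x + 1 \<le> i" "i + time x + 1 < width x"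
    using i d by (auto simp: width_def mid_def)
  have c1: "track x u (time x) (k + 1) i = 1"
    by (simp add: cell_def i d_def[symmetric])
  have c2: "track x u (time x) 2 i = (if V x u then 2 else 1)"
    using run_time[OF lu] k_ge by (simp add: cell_def i d_def[symmetric])
  have m1: "\<alpha> (atom x (time x) (k + 1) i 1)"
    using main[OF _ J(1) ir] c1 by simp
  define i' where "i' = i - 1"
  have i1: "i' < width x - 2" "i = i' + 1" using ir by (auto simp: i'_def)
  from sat[OF cl_less[OF _ J_pos i1(1) Z_pos B_ge(2), of "time x + 1"]]
  have "\<not> \<alpha> (atom x (time x) 2 i 1)"
    using m1 by (auto simp: i1(2) pos_lit_def neg_lit_def cl_decode[OF J_pos i1(1) Z_pos B_ge(2)])
  then have "V x u" using main[OF _ J(2) ir] c2 by (auto split: if_splits)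
  with lu show ?thesis by blast
qed

theorem satisfiable_iff: "satisfiable (nvars x) (nclauses x) (lit x) \<longleftrightarrow> (\<exists>u. length u \<le> poly q (length x) \<and> V x u)"
  using accepted_satisfiable satisfiable_accepted unfolding guess_def by blast

lemma nvars_pos: "0 < nvars x"
  using B_ge J_pos width_ge[of x] by (simp add: nvars_def)

end

section \<open>Instances as definable words\<close>

lemma binary_nth:
  "i < length (binary n) \<longleftrightarrow> 2 ^ i \<le> n" "i < length (binary n) \<Longrightarrow> binary n ! i \<longleftrightarrow> odd (n div 2 ^ i)"
proof (induction n arbitrary: i rule: less_induct)
  case (less n)
  {
    case 1
    show ?case
    proof (cases "n = 0")
      case False
      then show ?thesis using less(1)[of "n div 2"]
        by (cases i) (auto simp: binary.simps[of n] less_eq_div_iff_mult_less_eq mult.commute)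
    qed (simp add: binary.simps)
  next
    case 2
    then show ?case
    proof (cases "n = 0")
      case False
      with 2 show ?thesis using less(2)[of "n div 2"]
        by (cases i) (auto simp: binary.simps[of n] div_mult2_eq)
    qed (simp add: binary.simps)
  }
qed

lemma binary_value: "n = (\<Sum>i<length (binary n). of_bool (binary n ! i) * 2 ^ i)"
proof (induction n rule: less_induct)
  case (less n)
  show ?case
  proof (cases "n = 0")
    case False
    define b where "b = binary (n div 2)"
    have "n div 2 = (\<Sum>i<length b. of_bool (b ! i) * 2 ^ i)"
      unfolding b_def using False by (intro less) simp
    moreover have "n = of_bool (odd n) + 2 * (n div 2)"
      by (simp flip: mod_2_eq_odd)
    ultimately have "n = of_bool (odd n) + 2 * (\<Sum>i<length b. of_bool (b ! i) * 2 ^ i)"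
      by (simp only:)
    also have "\<dots> = (\<Sum>i<length (binary n). of_bool (binary n ! i) * 2 ^ i)"
      using False by (simp add: binary.simps[of n] b_def sum.lessThan_Suc_shift sum_distrib_left
        mult.left_commute del: sum.lessThan_Suc sum_of_bool_mult_eq sum_mult_of_bool_eq)
    finally show ?thesis .
  qed (simp add: binary.simps)
qed

lemma binary_0 [simp]: "binary 0 = []"
  by (simp add: binary.simps)

lemma binary_surj: "r = [] \<or> last r \<Longrightarrow> \<exists>k. binary k = r"
proof (induction r)
  case (Cons b r)
  show ?case
  proof (cases "r = []")
    case True
    then show ?thesis using Cons.prems by (intro exI[of _ 1]) (simp add: binary.simps)
  next
    case False
    then obtain k where k: "binary k = r" using Cons by auto
    then have "k \<noteq> 0" using False by (cases "k = 0") auto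
    then have "binary (2 * k + of_bool b) = b # r"
      using k by (subst binary.simps) auto
    then show ?thesis by blast
  qed
qed (auto simp: binary.simps intro: exI[of _ 0])

lemma entries_nth:
  "entries A = map (\<lambda>e. A $$ (e div dim_col A, e mod dim_col A)) [0..<dim_row A * dim_col A]"
proof -
  have "concat (map (\<lambda>i. map (\<lambda>j. A $$ (i, j)) [0..<n]) [0..<m]) =
    map (\<lambda>e. A $$ (e div n, e mod n)) [0..<m * n]" for m n
  proof (induction m)
    case (Suc m)
    have "map (\<lambda>j. A $$ (m, j)) [0..<n] = map (\<lambda>e. A $$ (e div n, e mod n)) [m * n..<m * n + n]"
      by (rule nth_equalityI) auto
    moreover have "[0..<Suc m * n] = [0..<m * n] @ [m * n..<m * n + n]"
      using upt_add_eq_append[of 0 "m * n" n] by (simp add: add.commute)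
    ultimately show ?case using Suc by simp
  qed simp
  then show ?thesis by (simp add: entries_def)
qed

definition enc_length :: "nat \<Rightarrow> nat \<Rightarrow> nat \<Rightarrow> nat" where
  "enc_length R C K = R + C + 2 + R * C + (\<Sum>i<K. of_bool (2 ^ i \<le> K))"

definition enc_bit :: "nat \<Rightarrow> nat \<Rightarrow> (nat \<Rightarrow> nat \<Rightarrow> bool) \<Rightarrow> nat \<Rightarrow> nat \<Rightarrow> bool" where
  "enc_bit R C P K i =
     (if i < R + 1 + C then i \<noteq> R
      else if i < R + C + 2 then False
      else if i < R + C + 2 + R * C then P ((i - (R + C + 2)) div C) ((i - (R + C + 2)) mod C)
      else odd (K div 2 ^ (i - (R + C + 2 + R * C))))"

lemma length_binary: "length (binary K) = (\<Sum>i<K. of_bool (2 ^ i \<le> K))"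
proof -
  have "(\<Sum>i<K. of_bool (2 ^ i \<le> K)) = card {i. i < K \<and> 2 ^ i \<le> K}"
    by (rule count_eq)
  also have "{i. i < K \<and> 2 ^ i \<le> K} = {..<length (binary K)}"
  proof -
    have "i < K" if "2 ^ i \<le> K" for i using that less_exp[of i] by linarith
    then show ?thesis using binary_nth(1)[of _ K] by auto
  qed
  finally show ?thesis by simp
qed

lemma encode_eq_map:
  "encode (A, K) = map (enc_bit (dim_row A) (dim_col A) (\<lambda>i j. A $$ (i, j)) K)
     [0..<enc_length (dim_row A) (dim_col A) K]"
proof (rule nth_equalityI)
  show len: "length (encode (A, K)) = length (map (enc_bit (dim_row A) (dim_col A) (\<lambda>i j. A $$ (i, j)) K)
     [0..<enc_length (dim_row A) (dim_col A) K])"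
    by (simp add: unary_def enc_length_def length_entries length_binary)
  fix i assume i: "i < length (encode (A, K))"
  define R C where "R = dim_row A" and "C = dim_col A"
  have i': "i < R + C + 2 + R * C + length (binary K)"
    using i by (simp add: unary_def length_entries R_def C_def)
  have e: "encode (A, K) = replicate R True @ [False] @ replicate C True @ [False] @ entries A @ binary K"
    by (simp add: unary_def R_def C_def)
  consider "i < R" | "i = R" | "R < i" "i < R + 1 + C" | "i = R + 1 + C"
    | "R + C + 2 \<le> i" "i < R + C + 2 + R * C" | "R + C + 2 + R * C \<le> i" by linarith
  then have "encode (A, K) ! i = enc_bit R C (\<lambda>i j. A $$ (i, j)) K i"
  proof cases
    case 5
    define d where "d = i - (R + C + 2)"
    have d: "i = Suc (Suc (R + C + d))" "d < R * C" using 5 by (auto simp: d_def)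
    have "encode (A, K) ! i = entries A ! d"
      unfolding e using d by (simp add: nth_append length_entries R_def C_def)
    also have "\<dots> = A $$ (d div C, d mod C)"
      using d(2) by (simp add: entries_nth R_def C_def)
    finally show ?thesis using 5 by (simp add: enc_bit_def d_def)
  next
    case 6
    define d where "d = i - (R + C + 2 + R * C)"
    have d: "i = Suc (Suc (R + C + (R * C + d)))" "d < length (binary K)" using 6 i' by (auto simp: d_def)
    have "encode (A, K) ! i = binary K ! d"
      unfolding e using d by (simp add: nth_append length_entries R_def C_def)
    also have "\<dots> = odd (K div 2 ^ d)" by (rule binary_nth(2)[OF d(2)])
    finally show ?thesis using 6 by (simp add: enc_bit_def d_def)
  qed (auto simp: e nth_append enc_bit_def simp del: encode.simps)
  then show "encode (A, K) ! i = map (enc_bit (dim_row A) (dim_col A) (\<lambda>i j. A $$ (i, j)) K)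
     [0..<enc_length (dim_row A) (dim_col A) K] ! i"
    using i unfolding len by (simp add: R_def C_def)
qed

text \<open>Expressions lack exponentiation; having no odd divisor above 1 is a bounded condition
  and hence definable.\<close>

lemma power_of_2_iff:
  "(\<exists>i. y = 2 ^ i) \<longleftrightarrow> 0 < y \<and> (\<forall>d<Suc y. y mod d = 0 \<longrightarrow> d = 1 \<or> even d)" for y :: nat
proof
  assume "\<exists>i. y = 2 ^ i"
  then obtain i where i: "y = 2 ^ i" by blast
  have "d = 1 \<or> even d" if "y mod d = 0" for d
  proof -
    have "d dvd 2 ^ i" using that i by (simp add: dvd_eq_mod_eq_0)
    then obtain j where "d = 2 ^ j" using divides_primepow_nat[of 2 d i] two_is_prime_nat by auto
    then show ?thesis by (cases j) auto
  qed
  then show "0 < y \<and> (\<forall>d<Suc y. y mod d = 0 \<longrightarrow> d = 1 \<or> even d)" using i by simp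
next
  show "0 < y \<and> (\<forall>d<Suc y. y mod d = 0 \<longrightarrow> d = 1 \<or> even d) \<Longrightarrow> \<exists>i. y = 2 ^ i"
  proof (induction y rule: less_induct)
    case (less y)
    show ?case
    proof (cases "even y")
      case True
      then obtain z where z: "y = 2 * z" by blast
      have "d = 1 \<or> even d" if "d < Suc z" "z mod d = 0" for d
      proof -
        have "y mod d = 0" using that(2) unfolding z by (simp add: dvd_eq_mod_eq_0[symmetric])
        then show ?thesis using less.prems that(1) by (auto simp: z)
      qed
      then obtain i where "z = 2 ^ i" using less.IH[of z] less.prems by (auto simp: z)
      then show ?thesis by (intro exI[of _ "Suc i"]) (simp add: z)
    next
      case False
      then have "y = 1" using less.prems by (auto dest!: spec[of _ y])
      then show ?thesis by (intro exI[of _ 0]) simp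
    qed
  qed
qed

text \<open>Below the cap, \<open>2 ^ i\<close> can be searched for: it is the power of two that has
  exactly \<open>i\<close> smaller ones.\<close>

lemma capped_power:
  "(if 2 ^ i \<le> n then 2 ^ i else 0) = (\<Sum>y<Suc n.
     if (\<exists>j. y = 2 ^ j) \<and> i = (\<Sum>z<y. of_bool (\<exists>j. z = 2 ^ j)) then y else 0)" for n :: nat
proof -
  define lg where "lg y = (\<Sum>z<y. of_bool (\<exists>j. z = 2 ^ j) :: nat)" for y :: nat
  have lg: "lg (2 ^ l) = l" for l
  proof -
    have "lg (2 ^ l) = card {z :: nat. z < 2 ^ l \<and> (\<exists>j. z = 2 ^ j)}"
      unfolding lg_def by (rule count_eq)
    also have "{z :: nat. z < 2 ^ l \<and> (\<exists>j. z = 2 ^ j)} = (\<lambda>j. 2 ^ j) ` {..<l}" by auto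
    also have "card \<dots> = l" by (subst card_image) (auto simp: inj_on_def)
    finally show ?thesis .
  qed
  have "(\<exists>j. y = 2 ^ j) \<and> i = lg y \<longleftrightarrow> y = 2 ^ i" for y
  proof
    assume "(\<exists>j. y = 2 ^ j) \<and> i = lg y"
    then obtain j where "y = 2 ^ j" "i = lg y" by blast
    then show "y = 2 ^ i" by (simp only: lg)
  qed (auto simp: lg)
  then show ?thesis unfolding lg_def[symmetric]
    by (simp add: less_Suc_eq_le sum.delta del: sum.lessThan_Suc)
qed

lemma dfnp_even [dfn_intros]: "dfn f \<Longrightarrow> dfnp (\<lambda>E. even (f E))"
  unfolding even_iff_mod_2_eq_zero by (intro dfn_intros)

lemma dfn_capped_power [dfn_intros]:
  assumes "dfn f" "dfn g"
  shows "dfn (\<lambda>E. if 2 ^ f E \<le> g E then 2 ^ f E else 0)"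
  unfolding capped_power power_of_2_iff
  by (intro dfn_intros assms dfn_tle[OF assms(1)] dfn_tle[OF assms(2)])

lemma dfnp_power_le [dfn_intros]:
  assumes "dfn f" "dfn g"
  shows "dfnp (\<lambda>E. 2 ^ f E \<le> g E)"
proof -
  have "dfnp (\<lambda>E. 0 < (if 2 ^ f E \<le> g E then 2 ^ f E else 0 :: nat))"
    by (intro dfnp_less dfn_const dfn_capped_power assms)
  then show ?thesis by (auto elim!: rev_iffD1 intro!: arg_cong[where f = dfnp])
qed

lemma dfnp_power_bit [dfn_intros]:
  assumes "dfn f" "dfn g"
  shows "dfnp (\<lambda>E. odd (g E div 2 ^ f E))"
proof -
  \<comment> \<open>If the power exceeds \<open>g E\<close>, both quotients are 0, the left one
    because division by 0 gives 0.\<close>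
  have "g E div (if 2 ^ f E \<le> g E then 2 ^ f E else 0) = g E div 2 ^ f E" for E
    by simp
  moreover have "dfnp (\<lambda>E. odd (g E div (if 2 ^ f E \<le> g E then 2 ^ f E else 0)))"
    by (intro dfnp_odd dfn_div dfn_capped_power assms)
  ultimately show ?thesis by (simp only:)
qed

lemma poly_time_cong:
  assumes "poly_time_function n f" "\<And>xs. length xs = n \<Longrightarrow> f xs = g xs"
  shows "poly_time_function n g"
  using assms unfolding poly_time_function_def by auto

lemma poly_time_encode:
  assumes R: "dfn (\<lambda>E. R (wd 0 E))" and C: "dfn (\<lambda>E. C (wd 0 E))" and K: "dfn (\<lambda>E. K (wd 0 E))"
    and P: "\<And>f g. dfn f \<Longrightarrow> dfn g \<Longrightarrow> dfnp (\<lambda>E. P (wd 0 E) (f E) (g E))"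
  shows "poly_time_function 1 (\<lambda>xs. encode (mat (R (xs ! 0)) (C (xs ! 0)) (\<lambda>(i, j). P (xs ! 0) i j), K (xs ! 0)))"
proof (rule poly_time_cong)
  let ?l = "\<lambda>E. enc_length (R (wd 0 E)) (C (wd 0 E)) (K (wd 0 E))"
  let ?b = "\<lambda>E. enc_bit (R (wd 0 E)) (C (wd 0 E)) (P (wd 0 E)) (K (wd 0 E))"
  show "poly_time_function 1 (\<lambda>xs. map (?b (xs, [])) [0..<?l (xs, [])])"
  proof (rule poly_time_dfn)
    show "dfn ?l" unfolding enc_length_def
      by (intro dfn_intros R C K | simp only: wd_tle)+
    show "dfnp (\<lambda>E. ?b (tle E) (hde E))" unfolding enc_bit_def wd_tle
      by (intro dfn_intros R C K P)
  qed
  fix xs :: "bool list list" assume xs: "length xs = 1"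
  define x where "x = xs ! 0"
  have w: "wd 0 (xs, []) = x" using xs by (simp add: wd_def x_def)
  have "map (enc_bit (R x) (C x) (P x) (K x)) [0..<enc_length (R x) (C x) (K x)] =
    map (enc_bit (R x) (C x) (\<lambda>i j. mat (R x) (C x) (\<lambda>(i, j). P x i j) $$ (i, j)) (K x))
      [0..<enc_length (R x) (C x) (K x)]"
  proof (rule map_cong)
    fix i assume "i \<in> set [0..<enc_length (R x) (C x) (K x)]"
    show "enc_bit (R x) (C x) (P x) (K x) i =
      enc_bit (R x) (C x) (\<lambda>i j. mat (R x) (C x) (\<lambda>(i, j). P x i j) $$ (i, j)) (K x) i"
    proof (cases "R x + C x + 2 \<le> i \<and> i < R x + C x + 2 + R x * C x")
      case True
      define e where "e = i - (R x + C x + 2)"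
      have "e < R x * C x" using True by (auto simp: e_def)
      then have "e div C x < R x" "e mod C x < C x"
        by (auto simp: less_mult_imp_div_less intro!: mod_less_divisor gr0I)
      then show ?thesis by (simp add: enc_bit_def e_def)
    qed (auto simp: enc_bit_def)
  qed simp
  then show "map (?b (xs, [])) [0..<?l (xs, [])] =
    encode (mat (R (xs ! 0)) (C (xs ! 0)) (\<lambda>(i, j). P (xs ! 0) i j), K (xs ! 0))"
    unfolding w x_def[symmetric] encode_eq_map by simp
qed

section \<open>NP-hardness\<close>

lemma dfn_table2:
  fixes F :: "nat \<Rightarrow> nat \<Rightarrow> nat"
  assumes "dfn f" "dfn g"
  shows "dfn (\<lambda>E. if f E < m \<and> g E < n then F (f E) (g E) else 0)"
proof -
  let ?i = "\<lambda>E. f E * n + g E"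
  have "dfn (\<lambda>E. if f E < m \<and> g E < n then if ?i E < m * n then F (?i E div n) (?i E mod n) else 0 else 0)"
    by (intro dfn_if[OF _ dfn_table[where F = "\<lambda>i. F (i div n) (i mod n)"]] dfn_intros assms)
  moreover have "(if a < m \<and> b < n then if a * n + b < m * n then F ((a * n + b) div n) ((a * n + b) mod n) else 0 else 0) =
      (if a < m \<and> b < n then F a b else 0)" for a b
  proof -
    have "a * n + b < m * n" if "a < m" "b < n"
    proof -
      have "a * n + b < Suc a * n" using that by simp
      also have "\<dots> \<le> m * n" using that by (intro mult_right_mono) auto
      finally show ?thesis .
    qed
    then show ?thesis by auto
  qed
  ultimately show ?thesis by (simp only:)
qed

lemma poly_time_sat_mat:
  assumes n: "dfn (\<lambda>E. n (wd 0 E))" and m: "dfn (\<lambda>E. m (wd 0 E))"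
    and lit: "\<And>f g. dfn f \<Longrightarrow> dfn g \<Longrightarrow> dfnp (\<lambda>E. lit (wd 0 E) (f E) (g E))"
  shows "poly_time_function 1 (\<lambda>xs. encode
    (sat_mat (n (xs ! 0)) (m (xs ! 0)) (lit (xs ! 0)), budget (n (xs ! 0)) (m (xs ! 0)) (lit (xs ! 0))))"
proof -
  have w: "dfn (\<lambda>E. wgt (n (wd 0 E)) (m (wd 0 E)))"
    unfolding wgt_def by (intro dfn_intros n m)
  have K: "dfn (\<lambda>E. budget (n (wd 0 E)) (m (wd 0 E)) (lit (wd 0 E)))"
    unfolding budget_def occs_def by (intro dfn_intros n m w | simp only: wd_tle | rule lit)+
  have B: "dfn (\<lambda>E. body (n (wd 0 E)) (m (wd 0 E)) (lit (wd 0 E)))"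
    unfolding body_def by (intro dfn_intros w K)
  have N: "dfn (\<lambda>E. rod (n (wd 0 E)) (m (wd 0 E)) (lit (wd 0 E)))"
    unfolding rod_def by (intro dfn_intros B)
  have R: "dfn (\<lambda>E. nrows (n (wd 0 E)) (m (wd 0 E)) (lit (wd 0 E)))"
    unfolding nrows_def by (intro dfn_intros n K)
  have C: "dfn (\<lambda>E. ncols (n (wd 0 E)) (m (wd 0 E)) (lit (wd 0 E)))"
    unfolding ncols_def by (intro dfn_intros n m N)
  have P: "dfnp (\<lambda>E. entry (n (wd 0 E)) (m (wd 0 E)) (lit (wd 0 E)) (f E) (g E))"
    if f: "dfn f" and g: "dfn g" for f g
    unfolding entry_def by (intro dfn_intros n w B N K f g lit)
  show ?thesis
    unfolding sat_mat_def
    by (rule poly_time_encode[where R = "\<lambda>x. nrows (n x) (m x) (lit x)" and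
          C = "\<lambda>x. ncols (n x) (m x) (lit x)" and K = "\<lambda>x. budget (n x) (m x) (lit x)" and
          P = "\<lambda>x. entry (n x) (m x) (lit x)", OF R C K P])
qed

context verifier
begin

lemma dfn_sizes:
  "dfn (\<lambda>E. guess (wd 0 E))" "dfn (\<lambda>E. time (wd 0 E))" "dfn (\<lambda>E. mid (wd 0 E))"
  "dfn (\<lambda>E. width (wd 0 E))" "dfn (\<lambda>E. nvars (wd 0 E))" "dfn (\<lambda>E. nclauses (wd 0 E))"
  unfolding nvars_def nclauses_def width_def mid_def time_def guess_def by (intro dfn_intros)+

lemma dfn_atom:
  assumes "dfn t" "dfn j" "dfn i" "dfn e"
  shows "dfn (\<lambda>E. atom (wd 0 E) (t E) (j E) (i E) (e E))"
  unfolding atom_def by (intro dfn_intros dfn_sizes assms)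

lemma dfn_params:
  assumes "dfn c"
  shows "dfn (\<lambda>E. cE (c E))" "dfn (\<lambda>E. cZ (c E))" "dfn (\<lambda>E. cI (wd 0 E) (c E))"
    "dfn (\<lambda>E. cJ (wd 0 E) (c E))" "dfn (\<lambda>E. cT (wd 0 E) (c E))"
  unfolding cE_def cZ_def cI_def cJ_def cT_def by (intro dfn_intros dfn_sizes assms)+

lemma dfn_wr_mv:
  assumes "dfn c"
  shows "dfn (\<lambda>E. wr (cZ (c E)) (cJ (wd 0 E) (c E)))" "dfn (\<lambda>E. mv (cZ (c E)) (cJ (wd 0 E) (c E)))"
  using dfn_table2[OF dfn_params(2)[OF assms] dfn_params(4)[OF assms], of Z J wr]
    dfn_table2[OF dfn_params(2)[OF assms] dfn_params(4)[OF assms], of Z J mv] c_bounds by simp_all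

lemma dfnp_lit:
  assumes f: "dfn f" and c: "dfn c"
  shows "dfnp (\<lambda>E. lit (wd 0 E) (f E) (c E))"
proof -
  have initial: "dfn (\<lambda>E. initial (wd 0 E) (j E) (i E))" if "dfn j" "dfn i" for j i
    unfolding initial_def by (intro dfn_intros dfn_sizes that)
  have guessed: "dfnp (\<lambda>E. guessed (wd 0 E) (j E) (i E))" if "dfn j" "dfn i" for j i
    unfolding guessed_def by (intro dfn_intros dfn_sizes that)
  have pos: "dfnp (\<lambda>E. pos_lit (wd 0 E) (v E) (c E))" if v: "dfn v" for v
    unfolding pos_lit_def
    by (intro dfn_intros dfn_sizes dfn_atom dfn_params dfn_wr_mv initial guessed v c)
  \<comment> \<open>The inserted bounds always hold and turn \<open>dig\<close> into a finite table,
    as \<open>dfn_table2\<close> requires.\<close>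
  have dig: "(\<exists>j<J. v = atom x t j h (dig (cZ c) j)) \<longleftrightarrow>
    (\<exists>j<J. v = atom x t j h (if cZ c < Z \<and> j < J then dig (cZ c) j else 0))" for v x t h c
    using c_bounds(2) by auto
  note c' = dfn_tle[OF c]
  have neg: "dfnp (\<lambda>E. neg_lit (wd 0 E) (v E) (c E))" if v: "dfn v" for v
  proof -
    note v' = dfn_tle[OF v]
    have ex: "dfnp (\<lambda>E. \<exists>j<J. v E = atom (wd 0 E) (cT (wd 0 E) (c E)) j (mid (wd 0 E))
      (if cZ (c E) < Z \<and> j < J then dig (cZ (c E)) j else 0))"
      by (rule dfnp_bex[OF dfn_const], unfold wd_tle,
          intro dfnp_eq dfn_atom dfn_table2 dfn_sizes dfn_params v' c' dfn_hde)
    show ?thesis unfolding neg_lit_def dig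
      by (intro ex dfnp_if dfnp_disj dfnp_conj dfnp_not dfnp_eq dfnp_less dfn_add dfn_const dfn_sizes
          dfn_atom dfn_params dfn_wr_mv guessed v c)
  qed
  show ?thesis unfolding lit_def
    by (intro dfn_intros pos neg f)
qed

theorem reducible:
  "poly_time_reducible {x. \<exists>u. length u \<le> poly q (length x) \<and> V x u} (encode ` SC1P_editing)"
  unfolding poly_time_reducible_def
proof (intro exI conjI allI)
  let ?f = "\<lambda>x. encode (sat_mat (nvars x) (nclauses x) (lit x), budget (nvars x) (nclauses x) (lit x))"
  show "poly_time_function 1 (\<lambda>xs. ?f (xs ! 0))"
    by (rule poly_time_sat_mat[OF dfn_sizes(5,6) dfnp_lit])
  fix x
  have "?f x \<in> encode ` SC1P_editing \<longleftrightarrow> satisfiable (nvars x) (nclauses x) (lit x)"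
    using sat_mat_editing[where lit = "lit x", OF nvars_pos lit_no_taut, of x "nclauses x"]
    by (simp add: inj_image_mem_iff[OF inj_encode] del: encode.simps)
  then show "x \<in> {x. \<exists>u. length u \<le> poly q (length x) \<and> V x u} \<longleftrightarrow> ?f x \<in> encode ` SC1P_editing"
    by (simp add: satisfiable_iff)
qed

end

theorem SC1P_editing_NP_hard: "NP_hard (encode ` SC1P_editing)"
  unfolding NP_hard_def
proof (intro allI impI)
  fix L' assume "in_NP L'"
  then obtain V and q :: "nat poly" where V: "poly_time_function 2 (\<lambda>xs. [V (xs ! 0) (xs ! 1)])"
    and L': "\<And>x. x \<in> L' \<longleftrightarrow> (\<exists>u. length u \<le> poly q (length x) \<and> V x u)"
    unfolding in_NP_def by blast
  from V obtain M p where M: "turing_machine M" "2 < tm_tapes M"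
    and comp: "\<And>xs. length xs = 2 \<Longrightarrow> computes_within M xs [V (xs ! 0) (xs ! 1)] (poly p (\<Sum>x\<leftarrow>xs. length x))"
    unfolding poly_time_function_def by blast
  interpret verifier M p q V
  proof
    show "computes_within M [x, u] [V x u] (poly p (length x + length u))" for x u
      using comp[of "[x, u]"] by simp
  qed (use M in auto)
  have "L' = {x. \<exists>u. length u \<le> poly q (length x) \<and> V x u}" using L' by auto
  with reducible show "poly_time_reducible L' (encode ` SC1P_editing)" by simp
qed

section \<open>Membership in NP\<close>

text \<open>Decodes a unary number that starts at position \<open>b\<close>: index \<open>i\<close>
  counts if the \<open>i + 1\<close> bits from \<open>b\<close> on are ones.\<close>

definition lead :: "bool list \<Rightarrow> nat \<Rightarrow> nat" where
  "lead x b = (\<Sum>i<length x. of_bool (\<forall>j<Suc i. bit_at x (b + j)))"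

lemma lead_eq: "lead x b = (LEAST n. \<not> bit_at x (b + n))"
proof -
  define L where "L = (LEAST n. \<not> bit_at x (b + n))"
  have L: "\<not> bit_at x (b + L)"
    unfolding L_def by (rule LeastI[of _ "length x"]) (simp add: bit_at_def)
  have "{i. i < length x \<and> (\<forall>j<Suc i. bit_at x (b + j))} = {..<L}"
  proof (rule Set.set_eqI)
    fix i show "i \<in> {i. i < length x \<and> (\<forall>j<Suc i. bit_at x (b + j))} \<longleftrightarrow> i \<in> {..<L}"
    proof
      assume "i \<in> {..<L}"
      then have "bit_at x (b + j)" if "j < Suc i" for j
        using that not_less_Least[of j "\<lambda>n. \<not> bit_at x (b + n)"] by (auto simp: L_def)
      then show "i \<in> {i. i < length x \<and> (\<forall>j<Suc i. bit_at x (b + j))}"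
        by (force simp: bit_at_def)
    next
      assume "i \<in> {i. i < length x \<and> (\<forall>j<Suc i. bit_at x (b + j))}"
      then have "\<not> L < Suc i" using L by blast
      then show "i \<in> {..<L}" by simp
    qed
  qed
  then have "card {i. i < length x \<and> (\<forall>j<Suc i. bit_at x (b + j))} = L" by simp
  then show ?thesis unfolding lead_def count_eq L_def .
qed

lemma lead_bits: "j < lead x b \<Longrightarrow> bit_at x (b + j)" "\<not> bit_at x (b + lead x b)"
proof -
  show "\<not> bit_at x (b + lead x b)"
    unfolding lead_eq by (rule LeastI[of _ "length x"]) (simp add: bit_at_def)
  show "j < lead x b \<Longrightarrow> bit_at x (b + j)"
    unfolding lead_eq using not_less_Least by blast
qed

lemma leadI: "(\<And>j. j < n \<Longrightarrow> bit_at x (b + j)) \<Longrightarrow> \<not> bit_at x (b + n) \<Longrightarrow> lead x b = n"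
  unfolding lead_eq by (rule Least_equality) (auto simp: not_less[symmetric])

definition rows_of :: "bool list \<Rightarrow> nat" where "rows_of x = lead x 0"
definition cols_of :: "bool list \<Rightarrow> nat" where "cols_of x = lead x (rows_of x + 1)"

definition entry_of :: "bool list \<Rightarrow> nat \<Rightarrow> nat \<Rightarrow> bool" where
  "entry_of x i j = bit_at x (rows_of x + cols_of x + 2 + i * cols_of x + j)"

definition tail_of :: "bool list \<Rightarrow> nat" where
  "tail_of x = rows_of x + cols_of x + 2 + rows_of x * cols_of x"

text \<open>A nonempty numeral ends with its most significant bit, which must be a one. Together
  with the length condition this singles out the words that are encodings.\<close>

definition well_formed :: "bool list \<Rightarrow> bool" where
  "well_formed x \<longleftrightarrow> tail_of x \<le> length x \<and> (length x = tail_of x \<or> bit_at x (length x - 1))"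

text \<open>The numeral at the end of \<open>x\<close> is compared with \<open>n \<le> length x\<close> only, hence capped.\<close>

definition at_most :: "bool list \<Rightarrow> nat \<Rightarrow> bool" where
  "at_most x n \<longleftrightarrow> (\<exists>i<length x - tail_of x. bit_at x (tail_of x + i) \<and> \<not> 2 ^ i \<le> length x) \<or>
     n \<le> (\<Sum>i<length x - tail_of x. of_bool (bit_at x (tail_of x + i)) * (if 2 ^ i \<le> length x then 2 ^ i else 0))"

lemma enc_bit_at: "bit_at (encode (A, K)) i \<longleftrightarrow> i < enc_length (dim_row A) (dim_col A) K \<and>
    enc_bit (dim_row A) (dim_col A) (\<lambda>i j. A $$ (i, j)) K i"
  unfolding encode_eq_map bit_at_def by auto

lemma length_encode: "length (encode (A, K)) = enc_length (dim_row A) (dim_col A) K"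
  unfolding encode_eq_map by simp

lemma parse:
  fixes A K defines "x \<equiv> encode (A, K)"
  shows "rows_of x = dim_row A" "cols_of x = dim_col A" "well_formed x"
    "\<And>i j. i < dim_row A \<Longrightarrow> j < dim_col A \<Longrightarrow> entry_of x i j = A $$ (i, j)"
    "\<And>n. n \<le> length x \<Longrightarrow> at_most x n \<longleftrightarrow> n \<le> K"
proof -
  let ?R = "dim_row A" and ?C = "dim_col A"
  note bits = enc_bit_at[of A K, folded x_def]
  have len: "length x = ?R + ?C + 2 + ?R * ?C + length (binary K)"
    unfolding x_def length_encode by (simp add: enc_length_def length_binary)
  show r: "rows_of x = ?R"
    unfolding rows_of_def by (rule leadI) (auto simp: bits enc_length_def enc_bit_def)
  show c: "cols_of x = ?C"
    unfolding cols_of_def r by (rule leadI) (auto simp: bits enc_length_def enc_bit_def)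
  have t: "tail_of x = ?R + ?C + 2 + ?R * ?C" unfolding tail_of_def r c by simp
  have tb: "bit_at x (tail_of x + i) \<longleftrightarrow> i < length (binary K) \<and> binary K ! i" for i
    unfolding bits t using binary_nth[of i K] by (auto simp: enc_bit_def enc_length_def length_binary[symmetric])
  show "well_formed x"
  proof (cases "K = 0")
    case True
    then show ?thesis by (simp add: well_formed_def t len)
  next
    case False
    then have "binary K \<noteq> []" by (simp add: binary.simps[of K])
    moreover have "last (binary K)" using False
    proof (induction K rule: less_induct)
      case (less K)
      show ?case
      proof (cases "K div 2 = 0")
        case True
        then have "K = 1" using less.prems by auto
        then show ?thesis by (simp add: binary.simps[of "Suc 0"])
      next
        case False
        moreover from False have "binary (K div 2) \<noteq> []" by (simp add: binary.simps[of "K div 2"])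
        ultimately show ?thesis using less.IH[of "K div 2"] less.prems by (simp add: binary.simps[of K])
      qed
    qed
    ultimately have "bit_at x (tail_of x + (length (binary K) - 1))"
      unfolding tb by (auto simp: last_conv_nth)
    moreover have "tail_of x + (length (binary K) - 1) = length x - 1"
      using \<open>binary K \<noteq> []\<close> by (cases "binary K") (simp_all add: t len)
    ultimately have "bit_at x (length x - 1)" by (simp only:)
    moreover have "tail_of x \<le> length x" by (simp add: t len)
    ultimately show ?thesis unfolding well_formed_def by blast
  qed
  show "entry_of x i j = A $$ (i, j)" if ij: "i < ?R" "j < ?C" for i j
  proof -
    have "i * ?C + j < ?R * ?C"
    proof -
      have "i * ?C + j < Suc i * ?C" using ij by simp
      also have "\<dots> \<le> ?R * ?C" using ij by (intro mult_right_mono) auto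
      finally show ?thesis .
    qed
    then show ?thesis using ij
      unfolding entry_of_def r c bits by (auto simp: enc_bit_def enc_length_def)
  qed
  show "at_most x n \<longleftrightarrow> n \<le> K" if n: "n \<le> length x" for n
  proof -
    let ?l = "length (binary K)"
    have ll: "length x - tail_of x = ?l" by (simp add: len t)
    show ?thesis
    proof (cases "\<exists>i<?l. binary K ! i \<and> \<not> 2 ^ i \<le> length x")
      case True
      then obtain i where i: "i < ?l" "binary K ! i" "\<not> 2 ^ i \<le> length x" by blast
      \<comment> \<open>A one of weight above \<open>length x\<close> puts \<open>K\<close> above
        every admissible \<open>n\<close>, so the capped comparison may accept at once.\<close>
      have "2 ^ i \<le> K" using binary_nth(1) i(1) by blast
      with i(3) n have "n \<le> K" by linarith
      moreover have "at_most x n" using True unfolding at_most_def ll tb by blast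
      ultimately show ?thesis by blast
    next
      case False
      have "(\<Sum>i<?l. of_bool (i < ?l \<and> binary K ! i) * (if 2 ^ i \<le> length x then 2 ^ i else 0)) =
        (\<Sum>i<?l. of_bool (binary K ! i) * 2 ^ i :: nat)"
        using False by (intro sum.cong) auto
      also have "\<dots> = K" by (rule binary_value[symmetric])
      finally show ?thesis using False unfolding at_most_def ll tb by auto
    qed
  qed
qed

lemma parse_complete:
  assumes "well_formed x"
  obtains A K where "x = encode (A, K)"
proof -
  define R C t where "R = rows_of x" and "C = cols_of x" and "t = tail_of x"
  have t: "t = R + C + 2 + R * C" by (simp add: t_def tail_of_def R_def C_def)
  have len: "t \<le> length x" and last: "length x = t \<or> bit_at x (length x - 1)"
    using assms by (auto simp: well_formed_def t_def)
  define r where "r = drop t x"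
  have "r = [] \<or> last r"
    using last len by (cases "length x = t") (auto simp: r_def bit_at_def last_drop last_conv_nth)
  then obtain K where K: "binary K = r" using binary_surj by blast
  define A where "A = mat R C (\<lambda>(i, j). entry_of x i j)"
  have lx: "length x = enc_length R C K"
    using len by (simp add: enc_length_def length_binary[symmetric] K r_def t)
  have "x = encode (A, K)"
    unfolding encode_eq_map
  proof (rule nth_equalityI)
    show "length x = length (map (enc_bit (dim_row A) (dim_col A) (\<lambda>i j. A $$ (i, j)) K)
      [0..<enc_length (dim_row A) (dim_col A) K])" by (simp add: A_def lx)
    fix i assume i: "i < length x"
    then have xi: "x ! i \<longleftrightarrow> bit_at x i" by (simp add: bit_at_def)
    have rb: "j < R \<Longrightarrow> bit_at x j" "\<not> bit_at x R" for j
      using lead_bits(1)[of j x 0] lead_bits(2)[of x 0] by (auto simp: R_def rows_of_def)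
    have cb: "j < C \<Longrightarrow> bit_at x (R + 1 + j)" "\<not> bit_at x (R + 1 + C)" for j
      using lead_bits(1)[of j x "R + 1"] lead_bits(2)[of x "R + 1"] by (auto simp: C_def cols_of_def R_def)
    have "bit_at x i \<longleftrightarrow> enc_bit R C (\<lambda>i j. A $$ (i, j)) K i"
    proof -
      consider "i < R" | "i = R" | "R < i" "i < R + 1 + C" | "i = R + 1 + C"
        | "R + C + 2 \<le> i" "i < t" | "t \<le> i" unfolding t by linarith
      then show ?thesis
      proof cases
        case 3
        then show ?thesis using cb(1)[of "i - (R + 1)"] by (simp add: enc_bit_def)
      next
        case 5
        define e where "e = i - (R + C + 2)"
        have e: "e < R * C" "i = R + C + 2 + e" using 5 by (auto simp: e_def t)
        then have "e div C < R" "e mod C < C"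
          by (auto simp: less_mult_imp_div_less intro!: mod_less_divisor gr0I)
        then have "A $$ (e div C, e mod C) = bit_at x (R + C + 2 + (e div C * C + e mod C))"
          by (simp add: A_def entry_of_def R_def C_def add.assoc)
        then show ?thesis using e by (simp add: enc_bit_def)
      next
        case 6
        define d where "d = i - t"
        have d: "i = t + d" "d < length (binary K)" using 6 i by (auto simp: d_def K r_def)
        have "bit_at x i \<longleftrightarrow> binary K ! d" using d i by (simp add: K r_def bit_at_def)
        also have "\<dots> \<longleftrightarrow> odd (K div 2 ^ d)" by (rule binary_nth(2)[OF d(2)])
        finally show ?thesis by (simp add: enc_bit_def d(1) t)
      qed (use rb cb in \<open>auto simp: enc_bit_def\<close>)
    qed
    then show "x ! i = map (enc_bit (dim_row A) (dim_col A) (\<lambda>i j. A $$ (i, j)) K)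
      [0..<enc_length (dim_row A) (dim_col A) K] ! i"
      using i unfolding xi by (simp add: A_def lx)
  qed
  with that show thesis .
qed

text \<open>
  A certificate \<open>u\<close> is a table of numbers up to \<open>length x\<close>, each given by the number of ones in a
  block of \<open>length x\<close> bits.
\<close>

definition num :: "bool list \<Rightarrow> bool list \<Rightarrow> nat \<Rightarrow> nat" where
  "num x u g = (\<Sum>y<length x. of_bool (bit_at u (g * length x + y)))"

text \<open>The table interleaves six numbers per index: \<open>6 * i\<close>,
  \<open>6 * i + 2\<close> and \<open>6 * i + 4\<close> are low end, high end and key of row
  \<open>i\<close>; \<open>6 * j + 1\<close>, \<open>6 * j + 3\<close> and \<open>6 * j + 5\<close>
  are key, low end and high end of column \<open>j\<close>.\<close>

definition row_test :: "bool list \<Rightarrow> bool list \<Rightarrow> nat \<Rightarrow> nat \<Rightarrow> bool" where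
  "row_test x u i j \<longleftrightarrow> num x u (6 * i) \<le> num x u (6 * j + 1) \<and> num x u (6 * j + 1) < num x u (6 * i + 2)"

definition col_test :: "bool list \<Rightarrow> bool list \<Rightarrow> nat \<Rightarrow> nat \<Rightarrow> bool" where
  "col_test x u i j \<longleftrightarrow> num x u (6 * j + 3) \<le> num x u (6 * i + 4) \<and> num x u (6 * i + 4) < num x u (6 * j + 5)"

text \<open>The set of flips is not part of the certificate: the keys determine the edited matrix,
  and its differences from the given one are counted.\<close>

definition errors :: "bool list \<Rightarrow> bool list \<Rightarrow> nat" where
  "errors x u = (\<Sum>i<rows_of x. \<Sum>j<cols_of x. of_bool (\<not> (row_test x u i j \<longleftrightarrow> entry_of x i j)))"

definition verify :: "bool list \<Rightarrow> bool list \<Rightarrow> bool" where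
  "verify x u \<longleftrightarrow> well_formed x \<and>
     (\<forall>i<rows_of x. \<forall>j<cols_of x. row_test x u i j \<longleftrightarrow> col_test x u i j) \<and> at_most x (errors x u)"

lemma num_exists:
  assumes "\<And>g. g < m \<Longrightarrow> f g \<le> length x"
  shows "\<exists>u. length u = m * length x \<and> (\<forall>g<m. num x u g = f g)"
proof (intro exI conjI allI impI)
  let ?s = "length x"
  let ?u = "map (\<lambda>z. z mod ?s < f (z div ?s)) [0..<m * ?s]"
  show "length ?u = m * ?s" by simp
  fix g assume g: "g < m"
  have "bit_at ?u (g * ?s + y) \<longleftrightarrow> y < f g" if y: "y < ?s" for y
  proof -
    have "g * ?s + y < Suc g * ?s" using y by simp
    also have "\<dots> \<le> m * ?s" using g by (intro mult_right_mono) auto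
    finally have "g * ?s + y < m * ?s" .
    moreover have "(g * s + y) div s = g \<and> (g * s + y) mod s = y" if "y < s" for s
      using that by auto
    from this[OF y] have "(g * ?s + y) div ?s = g" "(g * ?s + y) mod ?s = y" by blast+
    ultimately show ?thesis by (simp add: bit_at_def)
  qed
  then have "num x ?u g = (\<Sum>y<?s. of_bool (y < f g))"
    unfolding num_def by (intro sum.cong) auto
  also have "\<dots> = card {y. y < ?s \<and> y < f g}" by (rule count_eq)
  also have "{y. y < ?s \<and> y < f g} = {..<f g}" using assms[OF g] by auto
  finally show "num x ?u g = f g" by simp
qed

lemma card_pairs:
  fixes R C :: nat
  shows "card {(i, j). i < R \<and> j < C \<and> P i j} = (\<Sum>i<R. \<Sum>j<C. of_bool (P i j))"
proof -
  have "{(i, j). i < R \<and> j < C \<and> P i j} = (SIGMA i : {..<R}. {j. j < C \<and> P i j})" by auto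
  then have "card {(i, j). i < R \<and> j < C \<and> P i j} = (\<Sum>i<R. card {j. j < C \<and> P i j})"
    by (simp only:) (subst card_SigmaI, auto)
  also have "\<dots> = (\<Sum>i<R. \<Sum>j<C. of_bool (P i j))"
    unfolding count_eq ..
  finally show ?thesis .
qed

text \<open>Puts the number of errors in the range where \<open>at_most\<close> compares
  correctly.\<close>

lemma errors_le:
  assumes "well_formed x" shows "errors x u \<le> length x"
proof -
  have "errors x u \<le> (\<Sum>i<rows_of x. \<Sum>j<cols_of x. 1)"
    unfolding errors_def by (intro sum_mono) auto
  also have "\<dots> \<le> length x" using assms by (simp add: well_formed_def tail_of_def)
  finally show ?thesis .
qed

lemma verify_sound:
  assumes "verify x u" shows "x \<in> encode ` SC1P_editing"
proof -
  have wf: "well_formed x" using assms by (simp add: verify_def)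
  then obtain A K where x: "x = encode (A, K)" by (rule parse_complete)
  note P = parse[where A = A and K = K, folded x]
  define F where "F = {(i, j). i < dim_row A \<and> j < dim_col A \<and> \<not> (row_test x u i j \<longleftrightarrow> entry_of x i j)}"
  have "card F = errors x u" unfolding F_def card_pairs errors_def P ..
  moreover have "errors x u \<le> K"
    using P(5)[OF errors_le[OF wf]] assms by (simp add: verify_def)
  ultimately have cF: "card F \<le> K" by simp
  have fl: "flip F A $$ (i, j) \<longleftrightarrow> row_test x u i j" "row_test x u i j \<longleftrightarrow> col_test x u i j"
    if "i < dim_row A" "j < dim_col A" for i j
    using that assms P(4)[OF that] by (auto simp: flip_def F_def verify_def P(1,2))
  have "c1p (dim_row A) (dim_col A) (\<lambda>i j. flip F A $$ (i, j))"
    by (rule c1p_keysI[where p = "\<lambda>j. num x u (6 * j + 1)" and a = "\<lambda>i. num x u (6 * i)"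
          and b = "\<lambda>i. num x u (6 * i + 2)"]) (simp add: fl(1) row_test_def)
  moreover have "c1p (dim_col A) (dim_row A) (\<lambda>j i. flip F A $$ (i, j))"
    by (rule c1p_keysI[where p = "\<lambda>i. num x u (6 * i + 4)" and a = "\<lambda>j. num x u (6 * j + 3)"
          and b = "\<lambda>j. num x u (6 * j + 5)"]) (simp only: fl, simp add: col_test_def)
  moreover have "dim_row (flip F A) = dim_row A" "dim_col (flip F A) = dim_col A"
    by (auto simp: flip_def)
  ultimately have "SC1P (flip F A)" unfolding SC1P_c1p by simp
  moreover have "F \<subseteq> {..<dim_row A} \<times> {..<dim_col A}" by (auto simp: F_def)
  ultimately have "(A, K) \<in> SC1P_editing" using cF unfolding SC1P_editing_def by blast
  then show ?thesis unfolding x by (rule imageI)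
qed

lemma verify_complete:
  assumes "x \<in> encode ` SC1P_editing"
  shows "\<exists>u. length u \<le> 6 * length x * length x \<and> verify x u"
proof -
  from assms obtain A K where x: "x = encode (A, K)" and AK: "(A, K) \<in> SC1P_editing" by fastforce
  from AK obtain F where F: "F \<subseteq> {..<dim_row A} \<times> {..<dim_col A}" "card F \<le> K" "SC1P (flip F A)"
    unfolding SC1P_editing_def by blast
  note P = parse[where A = A and K = K, folded x]
  let ?R = "dim_row A" and ?C = "dim_col A" and ?s = "length x"
  have s: "?R \<le> ?s" "?C \<le> ?s" using P(3) by (auto simp: well_formed_def tail_of_def P(1,2))
  have dims: "dim_row (flip F A) = ?R" "dim_col (flip F A) = ?C" by (auto simp: flip_def)
  from F(3) have "c1p ?R ?C (\<lambda>i j. flip F A $$ (i, j))" "c1p ?C ?R (\<lambda>j i. flip F A $$ (i, j))"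
    unfolding SC1P_c1p dims by auto
  note c = this
  from c1p_keysD[OF c(1)] obtain p a b :: "nat \<Rightarrow> nat" where
    k: "\<forall>j<?C. p j < ?C" "\<forall>i<?R. a i \<le> ?C \<and> b i \<le> ?C"
      "\<forall>i<?R. \<forall>j<?C. flip F A $$ (i, j) \<longleftrightarrow> a i \<le> p j \<and> p j < b i" by blast
  from c1p_keysD[OF c(2)] obtain p' a' b' :: "nat \<Rightarrow> nat" where
    k': "\<forall>i<?R. p' i < ?R" "\<forall>j<?C. a' j \<le> ?R \<and> b' j \<le> ?R"
      "\<forall>j<?C. \<forall>i<?R. flip F A $$ (i, j) \<longleftrightarrow> a' j \<le> p' i \<and> p' i < b' j" by blast
  define f where "f g = [a (g div 6), p (g div 6), b (g div 6), a' (g div 6), p' (g div 6), b' (g div 6)] ! (g mod 6)" for g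
  have f: "f (6 * i + d) = [a i, p i, b i, a' i, p' i, b' i] ! d" if "d < 6" for i d
    using that by (simp add: f_def)
  \<comment> \<open>The cap provides the bound demanded by \<open>num_exists\<close> at every index;
    at indices below the dimensions the relevant values are within it anyway.\<close>
  define f' where "f' g = min (f g) ?s" for g
  obtain u where u: "length u = 6 * ?s * ?s" "\<And>g. g < 6 * ?s \<Longrightarrow> num x u g = f' g"
    using num_exists[of "6 * ?s" f' x] by (auto simp: f'_def)
  have fv: "f' (6 * i) = a i" "f' (6 * i + 2) = b i" "f' (6 * i + 4) = p' i" if "i < ?R" for i
  proof -
    have "a i \<le> ?C" "b i \<le> ?C" "p' i \<le> ?R" using k(2) k'(1) that by (auto simp: less_imp_le)
    then have "a i \<le> ?s" "b i \<le> ?s" "p' i \<le> ?s" using s by linarith+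
    then show "f' (6 * i) = a i" "f' (6 * i + 2) = b i" "f' (6 * i + 4) = p' i"
      using f[of 0 i] f[of 2 i] f[of 4 i] by (simp_all add: f'_def)
  qed
  have fv': "f' (6 * j + 1) = p j" "f' (6 * j + 3) = a' j" "f' (6 * j + 5) = b' j" if "j < ?C" for j
  proof -
    have "p j \<le> ?C" "a' j \<le> ?R" "b' j \<le> ?R" using k'(2) k(1) that by (auto simp: less_imp_le)
    then have "p j \<le> ?s" "a' j \<le> ?s" "b' j \<le> ?s" using s by linarith+
    then show "f' (6 * j + 1) = p j" "f' (6 * j + 3) = a' j" "f' (6 * j + 5) = b' j"
      using f[of 1 j] f[of 3 j] f[of 5 j] by (simp_all add: f'_def)
  qed
  have t: "row_test x u i j \<longleftrightarrow> flip F A $$ (i, j)" "col_test x u i j \<longleftrightarrow> flip F A $$ (i, j)"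
    if "i < ?R" "j < ?C" for i j
    using that s k(3) k'(3) fv[OF that(1)] fv'[OF that(2)]
    by (simp_all add: row_test_def col_test_def u(2))
  have "errors x u = card {(i, j). i < ?R \<and> j < ?C \<and> \<not> (row_test x u i j \<longleftrightarrow> entry_of x i j)}"
    unfolding card_pairs errors_def P(1,2) ..
  also have "{(i, j). i < ?R \<and> j < ?C \<and> \<not> (row_test x u i j \<longleftrightarrow> entry_of x i j)} = F"
    using F(1) by (auto simp: t P(4) flip_def split: if_splits)
  finally have "errors x u = card F" .
  with F(2) have "errors x u \<le> K" by simp
  then have "at_most x (errors x u)" using P(5)[OF errors_le[OF P(3)]] by blast
  then have "verify x u" using P(3) by (simp add: verify_def P(1,2) t)
  with u(1) show ?thesis by (intro exI[of _ u]) simp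
qed

lemma dfn_lead: "dfn f \<Longrightarrow> dfn (\<lambda>E. lead (wd 0 E) (f E))"
  unfolding lead_def by (intro dfn_intros dfn_tle2[of f] | simp only: wd_tle)+

lemma dfn_dims: "dfn (\<lambda>E. rows_of (wd 0 E))" "dfn (\<lambda>E. cols_of (wd 0 E))" "dfn (\<lambda>E. tail_of (wd 0 E))"
  unfolding tail_of_def cols_of_def rows_of_def by (intro dfn_intros dfn_lead)+

lemma dfn_num: "dfn f \<Longrightarrow> dfn (\<lambda>E. num (wd 0 E) (wd 1 E) (f E))"
  unfolding num_def by (intro dfn_intros dfn_tle[of f] | simp only: wd_tle)+

lemma dfnp_tests:
  assumes "dfn f" "dfn g"
  shows "dfnp (\<lambda>E. row_test (wd 0 E) (wd 1 E) (f E) (g E))"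
    "dfnp (\<lambda>E. col_test (wd 0 E) (wd 1 E) (f E) (g E))"
    "dfnp (\<lambda>E. entry_of (wd 0 E) (f E) (g E))"
  unfolding row_test_def col_test_def entry_of_def by (intro dfn_intros dfn_num dfn_dims assms)+

lemma dfn_errors: "dfn (\<lambda>E. errors (wd 0 E) (wd 1 E))"
  unfolding errors_def by (intro dfn_intros dfn_dims | simp only: wd_tle | rule dfnp_tests)+

lemma dfnp_at_most: "dfn f \<Longrightarrow> dfnp (\<lambda>E. at_most (wd 0 E) (f E))"
  unfolding at_most_def by (intro dfn_intros dfn_dims | simp only: wd_tle)+

lemma dfnp_verify: "dfnp (\<lambda>E. verify (wd 0 E) (wd 1 E))"
  unfolding verify_def well_formed_def
  by (intro dfn_intros dfn_dims dfnp_at_most dfn_errors | simp only: wd_tle | rule dfnp_tests)+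

theorem SC1P_editing_in_NP: "in_NP (encode ` SC1P_editing)"
  unfolding in_NP_def
proof (intro exI[of _ verify] exI[of _ "[:0, 0, 6:]"] conjI allI)
  have "poly_time_function 2 (\<lambda>xs. map (\<lambda>_. verify (wd 0 (xs, [])) (wd 1 (xs, []))) [0..<1])"
    by (rule poly_time_dfn[where f = "\<lambda>_. 1"]) (simp_all only: wd_tle dfn_const dfnp_verify)
  then show "poly_time_function 2 (\<lambda>xs. [verify (xs ! 0) (xs ! 1)])"
    by (rule poly_time_cong) (simp add: wd_def)
  show "x \<in> encode ` SC1P_editing \<longleftrightarrow> (\<exists>u. length u \<le> poly [:0, 0, 6:] (length x) \<and> verify x u)" for x
    using verify_sound verify_complete[of x] by (auto simp: algebra_simps)
qed

theorem theorem12: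
  shows "NP_complete (encode ` SC1P_editing)"
  unfolding NP_complete_def using SC1P_editing_in_NP SC1P_editing_NP_hard ..

end
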